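(* Let $\Xi_1=(\mathbb{X}_1,d_1,\mu_1^*,\{\lambda_{1,k}\},\{\phi_{1,k}\})$ and $\Xi_2=(\mathbb{X}_2,d_2,\mu_2^*,\{\lambda_{2,k}\},\{\phi_{2,k}\})$ be two admissible systems satisfying the joint Gaussian upper bound condition with exponent $Q>0$, with joint distance $d_{1,2}$, connection matrix $\mathbf{A}=(A_{j,k})$ and joint eigenvalues $\boldsymbol{\lambda}=(\ell_{j,k})$. Let $h$ be a sufficiently smooth low pass filter, and let $\mu_1^*,\mu_2^*$ satisfy the joint regularity condition $$\mu_1^*(\mathbb{B}_{2,1}(x_2,r))\le c\,r^{q_1},\quad\mu_2^*(\mathbb{B}_{1,2}(x_1,r))\le c\,r^{q_2},\qquad x_1\in\mathbb{X}_1,\ x_2\in\mathbb{X}_2,\ r>0,$$ for some constants $c,q_1,q_2>0$ independent of $x_1,x_2,r$. Let $1\le p\le\infty$ (with $1/p=0$ if $p=\infty$), and $f\in L^p(\mathbb{X}_2,\mu_2^* )$. Assume further that there exist $\beta>Q-q_2-(q_1-q_2)/p$ and $c>0$ such that for all $n\ge1$, $P\in\Pi_n(\Xi_2)$ and $m=1,2,\dots$, $$\|\sigma_{2^{m+1}}(\Xi_1,\Xi_2;\mathbf{A},\boldsymbol{\lambda};h,P)-\sigma_{2^m}(\Xi_1,\Xi_2;\mathbf{A},\boldsymbol{\lambda};h,P)\|_{\mathbb{X}_1,\mu_1^*,p}\le c\,2^{-m\beta}n^{Q-q_2-(q_1-q_2)/p}\|P\|_{\mathbb{X}_2,\mu_2^*,p}.$$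 If $$\sum_{m=0}^\infty2^{m(Q-q_2-(q_1-q_2)/p)}E_{2^m,p}(\Xi_2;f)<\infty,$$ then $\mathcal{E}(f)=\lim_{n\to\infty}\sigma_{2^n}(\Xi_1,\Xi_2;\mathbf{A},\boldsymbol{\lambda};h,f)$ exists in the sense of $L^p(\mathbb{X}_1,\mu_1^* )$, and there is a constant $c>0$ independent of $f$ and $n$ such that for all integers $n\ge0$ $$\|\mathcal{E}(f)-\sigma_{2^n}(\Xi_1,\Xi_2;\mathbf{A},\boldsymbol{\lambda};h,f)\|_{\mathbb{X}_1,\mu_1^*,p}\le c\left\{\sum_{m=n}^\infty2^{m(Q-q_2-(q_1-q_2)/p)}E_{2^m,p}(\Xi_2;f)+2^{n(Q-q_2-(q_1-q_2)/p-\beta)}\|f\|_{\mathbb{X}_2,\mu_2^*,p}\right\}.$$ In particular, if $\alpha>0$ and $\alpha\ell_{j,k}\ge\lambda_{1,j}$ for all $j,k=0,1,\dots$, then $\sigma_n(\Xi_1,\Xi_2;\mathbf{A},\boldsymbol{\lambda};h,f)\in\Pi_{\alpha n}(\Xi_1)$ for $n>0$. Further (in this case), if $\gamma>0$, $Q-q_2-(q_1-q_2)/p<\gamma<\beta$, $0<\rho\le\infty$, and $f\in B_{p,\rho,\gamma}(\Xi_2)$, then $\mathcal{E}(f)\in B_{p,\rho,\gamma-Q+q_2+(q_1-q_2)/p}(\Xi_1)$.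
   Context: A quasi-metric is a symmetric nonnegative function vanishing exactly on the diagonal and satisfying $d(x,y)\le C(d(x,z)+d(z,y))$ for some constant $C$. $\|f\|_{\mathbb{X},\nu,p}$ is the usual $L^p(\mathbb{X},\nu)$ norm. Bessel system: $\{\phi_k\}_{k=0}^\infty\subset L^2(\mu^* )$ is a Bessel system if there are a subset $\mathcal{D}\subset L^1(\mu^* )\cap L^\infty(\mu^* )$ dense in $L^2(\mu^* )$ and a (finite valued) functional $\mathcal{N}$ on $L^2(\mu^* )$ with $\sum_{k}|\int f\overline{\phi_k}\,d\mu^*|^2\le\mathcal{N}(f)$ for $f\in\mathcal{D}$. Admissible system: a tuple $\Xi=(\mathbb{X},d,\mu^*,\{\lambda_k\},\{\phi_k\})$ where $\mathbb{X}$ is a locally compact quasi-metric space with quasi-metric $d$ and sigma-finite positive Borel measure $\mu^*$; $\{\lambda_k\}_{k\ge0}$ is a non-decreasing sequence of nonnegative numbers with $\lambda_0=0$, $\lambda_k\to\infty$; and $\{\phi_k\}$ is a Bessel system in $L^2(\mu^* )$ with each $\phi_k$ continuous, bounded and integrable. Joint distance: a function $d_{1,2}:\mathbb{X}_1\times\mathbb{X}_2\to[0,\infty)$ such that for some constant $c$, $d_{1,2}(x_1,x_2)\le c(d_1(x_1,x_1')+d_{1,2}(x_1',x_2))$ and $d_{1,2}(x_1,x_2)\le c(d_{1,2}(x_1,x_2')+d_2(x_2',x_2))$ for all $x_1,x_1'\in\mathbb{X}_1$, $x_2,x_2'\in\mathbb{X}_2$; $d_{2,1}(x_2,x_1)=d_{1,2}(x_1,x_2)$.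 Balls: $\mathbb{B}_{1,2}(x_1,r)=\{z\in\mathbb{X}_2:d_{1,2}(x_1,z)\le r\}$, $\mathbb{B}_{2,1}(x_2,r)=\{z\in\mathbb{X}_1:d_{2,1}(x_2,z)\le r\}$. Joint Gaussian upper bound condition with exponent $Q>0$: given a matrix $\mathbf{A}=(A_{j,k})_{j,k=0}^\infty$ (connection matrix) and numbers $\ell_{j,k}\ge0$ (joint eigenvalues) such that $\{(j,k):\ell_{j,k}<u\}$ is finite for each $u>0$, the condition says: there is $c>0$ with $\sum_{j,k:\ell_{j,k}<n}|A_{j,k}\phi_{1,j}(x_1)\overline{\phi_{2,k}(x_2)}|\le c\,n^Q$ for all $n\ge2$, $x_1\in\mathbb{X}_1$, $x_2\in\mathbb{X}_2$; the limit $K_t(\Xi_1,\Xi_2;x_1,x_2)=\lim_{n\to\infty}\sum_{j,k:\ell_{j,k}<n}\exp(-\ell_{j,k}^2t)A_{j,k}\phi_{1,j}(x_1)\overline{\phi_{2,k}(x_2)}$ exists for all $x_1,x_2$; and there are positive constants $c,c_1,c_2$ with $|K_t(\Xi_1,\Xi_2;x_1,x_2)|\le c_1t^{-c}\exp(-c_2d_{1,2}(x_1,x_2)^2/t)$ for $0<t\le1$, $x_1\in\mathbb{X}_1$, $x_2\in\mathbb{X}_2$. Low pass filter: an even function $h:\mathbb{R}\to[0,1]$, non-increasing on $[0,\infty)$, with $h(u)=1$ if $|u|<1/2$ and $h(u)=0$ if $|u|\ge1$. Here $h$ is "sufficiently smooth" if there are an integer $S>\max(q_1,q_2,Q+1)$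 and a signed measure $h^{[S]}$ on $[0,\infty)$ (of bounded variation on compact intervals) with $h(u)=\int_0^\infty(v^2-u^2)_+^S\,dh^{[S]}(v)$ for $u\ge0$ and $\int_0^\infty(v+2)^Q(v^S+v^{2S})\,d|h^{[S]}|(v)<\infty$, where $x_+^S=x^S$ if $x>0$ and $0$ otherwise. Operators: for $n>0$, $f\in L^1(\mathbb{X}_2,\mu_2^* )+L^\infty(\mathbb{X}_2,\mu_2^* )$, with $\hat f(\Xi_2;k)=\int_{\mathbb{X}_2}f\overline{\phi_{2,k}}\,d\mu_2^*$, $$\sigma_n(\Xi_1,\Xi_2;\mathbf{A},\boldsymbol{\lambda};h,f,x_1)=\sum_{j,k=0}^\infty h\left(\frac{\ell_{j,k}}{n}\right)A_{j,k}\hat f(\Xi_2;k)\phi_{1,j}(x_1),\qquad x_1\in\mathbb{X}_1.$$ For an admissible system $\Xi$ and $n>0$: $\Pi_n(\Xi)=\mathrm{span}\{\phi_k:\lambda_k<n\}$; $E_{n,p}(\Xi;g)=\inf_{P\in\Pi_n(\Xi)}\|g-P\|_{\mathbb{X},\mu^*,p}$ for $g\in L^p(\mathbb{X},\mu^* )$; $X^p(\Xi)$ is the set of $g\in L^p(\mathbb{X},\mu^* )$ with $E_{n,p}(\Xi;g)\to0$ as $n\to\infty$. For $0<\gamma<\infty$, the Besov space $B_{p,\rho,\gamma}(\Xi)$ is the set of $g\in X^p(\Xi)$ such that $\left(\sum_{j=0}^\infty2^{\gamma\rho j}E_{2^j,p}(\Xi;g)^\rho\right)^{1/\rho}<\infty$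 if $0<\rho<\infty$, or $\sup_{j\ge0}2^{\gamma j}E_{2^j,p}(\Xi;g)<\infty$ if $\rho=\infty$. *)

theory Defs
  imports "HOL-Analysis.Analysis" "HOL-Probability.Essential_Supremum"
begin

section \<open>Lebesgue spaces\<close>

text \<open>The exponent ranges over \<open>1 \<le> p \<le> \<infinity>\<close>; \<open>enn2real (1 / p)\<close> is \<open>1/p\<close>, and \<open>0\<close> for \<open>p = \<infinity>\<close>.
  The norm is real-valued and is meaningful only for members of \<open>Lp_space M p\<close>.\<close>

definition Lp_space :: "'a measure \<Rightarrow> ennreal \<Rightarrow> ('a \<Rightarrow> complex) set" where
  "Lp_space M p = {f \<in> borel_measurable M.
     if p = \<infinity> then esssup M (\<lambda>x. ennreal (norm (f x))) < \<infinity>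
     else integrable M (\<lambda>x. norm (f x) powr enn2real p)}"

definition Lp_norm :: "'a measure \<Rightarrow> ennreal \<Rightarrow> ('a \<Rightarrow> complex) \<Rightarrow> real" where
  "Lp_norm M p f =
     (if p = \<infinity> then enn2real (esssup M (\<lambda>x. ennreal (norm (f x))))
      else (\<integral>x. norm (f x) powr enn2real p \<partial>M) powr enn2real (1 / p))"

definition Lp_limit ::
    "'a measure \<Rightarrow> ennreal \<Rightarrow> (nat \<Rightarrow> 'a \<Rightarrow> complex) \<Rightarrow> ('a \<Rightarrow> complex) \<Rightarrow> bool" where
  "Lp_limit M p s F \<longleftrightarrow> F \<in> Lp_space M p \<and> (\<forall>n. s n \<in> Lp_space M p) \<and>
     (\<lambda>n. Lp_norm M p (\<lambda>x. F x - s n x)) \<longlonglongrightarrow> 0"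


section \<open>Quasi-metric spaces\<close>

definition quasi_metric :: "'a set \<Rightarrow> ('a \<Rightarrow> 'a \<Rightarrow> real) \<Rightarrow> bool" where
  "quasi_metric X d \<longleftrightarrow>
     (\<forall>x\<in>X. \<forall>y\<in>X. 0 \<le> d x y \<and> d x y = d y x \<and> (d x y = 0 \<longleftrightarrow> x = y)) \<and>
     (\<exists>C. \<forall>x\<in>X. \<forall>y\<in>X. \<forall>z\<in>X. d x y \<le> C * (d x z + d z y))"

text \<open>Balls of a quasi-metric need not be open; a set is open if it contains a ball around each
  of its points.\<close>

definition quasi_topology :: "'a set \<Rightarrow> ('a \<Rightarrow> 'a \<Rightarrow> real) \<Rightarrow> 'a topology" where
  "quasi_topology X d =
     topology (\<lambda>U. U \<subseteq> X \<and> (\<forall>x\<in>U. \<exists>r>0. {y \<in> X. d x y < r} \<subseteq> U))"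

lemma openin_quasi_topology:
  "openin (quasi_topology X d) U \<longleftrightarrow>
     U \<subseteq> X \<and> (\<forall>x\<in>U. \<exists>r>0. {y \<in> X. d x y < r} \<subseteq> U)"
proof -
  let ?P = "\<lambda>U. U \<subseteq> X \<and> (\<forall>x\<in>U. \<exists>r>0. {y \<in> X. d x y < r} \<subseteq> U)"
  have "istopology ?P"
    unfolding istopology_def
  proof (intro conjI allI impI ballI)
    fix S T x
    assume S: "?P S" and T: "?P T" and x: "x \<in> S \<inter> T"
    obtain r where "r > 0" "{y \<in> X. d x y < r} \<subseteq> S" using S x by blast
    moreover obtain s where "s > 0" "{y \<in> X. d x y < s} \<subseteq> T" using T x by blast
    ultimately show "\<exists>r>0. {y \<in> X. d x y < r} \<subseteq> S \<inter> T"
      by (intro exI[of _ "min r s"]) auto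
  next
    fix \<K> x
    assume K: "\<forall>K\<in>\<K>. ?P K" and x: "x \<in> \<Union>\<K>"
    then obtain K where "K \<in> \<K>" "x \<in> K" by blast
    moreover from this K obtain r where "r > 0" "{y \<in> X. d x y < r} \<subseteq> K" by meson
    ultimately show "\<exists>r>0. {y \<in> X. d x y < r} \<subseteq> \<Union>\<K>" by blast
  qed auto
  then show ?thesis
    by (simp add: quasi_topology_def topology_inverse')
qed

lemma topspace_quasi_topology: "topspace (quasi_topology X d) = X"
proof
  show "topspace (quasi_topology X d) \<subseteq> X"
    using openin_topspace[of "quasi_topology X d"] unfolding openin_quasi_topology by blast
  have "openin (quasi_topology X d) X"
    unfolding openin_quasi_topology by (auto intro: exI[of _ 1])
  then show "X \<subseteq> topspace (quasi_topology X d)" by (rule openin_subset)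
qed


section \<open>Admissible systems\<close>

text \<open>The underlying set \<open>\<X>\<close> of a system is the space of its measure.\<close>

record 'a system =
  qdist :: "'a \<Rightarrow> 'a \<Rightarrow> real"
  meas :: "'a measure"
  lam :: "nat \<Rightarrow> real"
  phi :: "nat \<Rightarrow> 'a \<Rightarrow> complex"

definition fourier_coeff :: "'a system \<Rightarrow> ('a \<Rightarrow> complex) \<Rightarrow> nat \<Rightarrow> complex" where
  "fourier_coeff \<Xi> f k = (\<integral>x. f x * cnj (phi \<Xi> k x) \<partial>(meas \<Xi>))"

definition bessel_system :: "'a system \<Rightarrow> bool" where
  "bessel_system \<Xi> \<longleftrightarrow>
     (\<forall>k. phi \<Xi> k \<in> Lp_space (meas \<Xi>) 2) \<and>
     (\<exists>D N. D \<subseteq> Lp_space (meas \<Xi>) 1 \<inter> Lp_space (meas \<Xi>) \<infinity> \<and>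
        (\<forall>g\<in>Lp_space (meas \<Xi>) 2. \<forall>\<epsilon>>0. \<exists>f\<in>D. Lp_norm (meas \<Xi>) 2 (\<lambda>x. g x - f x) < \<epsilon>) \<and>
        (\<forall>f\<in>D. summable (\<lambda>k. (norm (fourier_coeff \<Xi> f k))\<^sup>2) \<and>
           (\<Sum>k. (norm (fourier_coeff \<Xi> f k))\<^sup>2) \<le> (N :: ('a \<Rightarrow> complex) \<Rightarrow> real) f))"

definition admissible :: "'a system \<Rightarrow> bool" where
  "admissible \<Xi> \<longleftrightarrow>
     (let X = space (meas \<Xi>); T = quasi_topology X (qdist \<Xi>) in
       quasi_metric X (qdist \<Xi>) \<and>
       locally_compact_space T \<and>
       sets (meas \<Xi>) = sigma_sets X {U. openin T U} \<and>
       sigma_finite_measure (meas \<Xi>) \<and>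
       incseq (lam \<Xi>) \<and> (\<forall>k. 0 \<le> lam \<Xi> k) \<and> lam \<Xi> 0 = 0 \<and>
       filterlim (lam \<Xi>) at_top sequentially \<and>
       bessel_system \<Xi> \<and>
       (\<forall>k. continuous_map T euclidean (phi \<Xi> k) \<and> bounded (phi \<Xi> k ` X) \<and>
            integrable (meas \<Xi>) (phi \<Xi> k)))"

text \<open>The linear span over the complex numbers; for an admissible system the index set
  \<open>{k. lam \<Xi> k < n}\<close> is finite.\<close>

definition Pi_space :: "'a system \<Rightarrow> real \<Rightarrow> ('a \<Rightarrow> complex) set" where
  "Pi_space \<Xi> n = range (\<lambda>a x. \<Sum>k | lam \<Xi> k < n. a k * phi \<Xi> k x)"

definition approx_err :: "'a system \<Rightarrow> ennreal \<Rightarrow> real \<Rightarrow> ('a \<Rightarrow> complex) \<Rightarrow> real" where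
  "approx_err \<Xi> p n g = (INF P\<in>Pi_space \<Xi> n. Lp_norm (meas \<Xi>) p (\<lambda>x. g x - P x))"

definition X_space :: "'a system \<Rightarrow> ennreal \<Rightarrow> ('a \<Rightarrow> complex) set" where
  "X_space \<Xi> p = {g \<in> Lp_space (meas \<Xi>) p. ((\<lambda>n::real. approx_err \<Xi> p n g) \<longlongrightarrow> 0) at_top}"

definition besov :: "'a system \<Rightarrow> ennreal \<Rightarrow> ennreal \<Rightarrow> real \<Rightarrow> ('a \<Rightarrow> complex) set" where
  "besov \<Xi> p \<rho> \<gamma> = {g \<in> X_space \<Xi> p.
     if \<rho> = \<infinity> then bdd_above (range (\<lambda>j::nat. 2 powr (\<gamma> * real j) * approx_err \<Xi> p (2 ^ j) g))
     else summable (\<lambda>j::nat. 2 powr (\<gamma> * enn2real \<rho> * real j) *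
            approx_err \<Xi> p (2 ^ j) g powr enn2real \<rho>)}"


section \<open>Joint conditions on two systems\<close>

definition joint_distance ::
    "'a system \<Rightarrow> 'b system \<Rightarrow> ('a \<Rightarrow> 'b \<Rightarrow> real) \<Rightarrow> bool" where
  "joint_distance \<Xi>1 \<Xi>2 d \<longleftrightarrow>
     (let X1 = space (meas \<Xi>1); X2 = space (meas \<Xi>2) in
       (\<forall>x1\<in>X1. \<forall>x2\<in>X2. 0 \<le> d x1 x2) \<and>
       (\<exists>c.
         (\<forall>x1\<in>X1. \<forall>x1'\<in>X1. \<forall>x2\<in>X2. d x1 x2 \<le> c * (qdist \<Xi>1 x1 x1' + d x1' x2)) \<and>
         (\<forall>x1\<in>X1. \<forall>x2\<in>X2. \<forall>x2'\<in>X2. d x1 x2 \<le> c * (d x1 x2' + qdist \<Xi>2 x2' x2))))"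

definition joint_ball12 :: "'b system \<Rightarrow> ('a \<Rightarrow> 'b \<Rightarrow> real) \<Rightarrow> 'a \<Rightarrow> real \<Rightarrow> 'b set" where
  "joint_ball12 \<Xi>2 d x1 r = {z \<in> space (meas \<Xi>2). d x1 z \<le> r}"

definition joint_ball21 :: "'a system \<Rightarrow> ('a \<Rightarrow> 'b \<Rightarrow> real) \<Rightarrow> 'b \<Rightarrow> real \<Rightarrow> 'a set" where
  "joint_ball21 \<Xi>1 d x2 r = {z \<in> space (meas \<Xi>1). d z x2 \<le> r}"

text \<open>Measurability of the joint balls, implicit whenever their measure is written, is stated
  explicitly, since \<open>emeasure\<close> is \<open>0\<close> on non-measurable sets.\<close>

definition joint_regular ::
    "'a system \<Rightarrow> 'b system \<Rightarrow> ('a \<Rightarrow> 'b \<Rightarrow> real) \<Rightarrow> real \<Rightarrow> real \<Rightarrow> bool" where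
  "joint_regular \<Xi>1 \<Xi>2 d q1 q2 \<longleftrightarrow> q1 > 0 \<and> q2 > 0 \<and>
     (\<exists>c>0.
       (\<forall>x2\<in>space (meas \<Xi>2). \<forall>r>0. joint_ball21 \<Xi>1 d x2 r \<in> sets (meas \<Xi>1) \<and>
          emeasure (meas \<Xi>1) (joint_ball21 \<Xi>1 d x2 r) \<le> ennreal (c * r powr q1)) \<and>
       (\<forall>x1\<in>space (meas \<Xi>1). \<forall>r>0. joint_ball12 \<Xi>2 d x1 r \<in> sets (meas \<Xi>2) \<and>
          emeasure (meas \<Xi>2) (joint_ball12 \<Xi>2 d x1 r) \<le> ennreal (c * r powr q2)))"

definition joint_kernel_sum ::
    "'a system \<Rightarrow> 'b system \<Rightarrow> (nat \<Rightarrow> nat \<Rightarrow> complex) \<Rightarrow> (nat \<Rightarrow> nat \<Rightarrow> real) \<Rightarrow>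
     real \<Rightarrow> 'a \<Rightarrow> 'b \<Rightarrow> real \<Rightarrow> complex" where
  "joint_kernel_sum \<Xi>1 \<Xi>2 A l t x1 x2 n =
     (\<Sum>(j, k) | l j k < n.
        of_real (exp (- (l j k)\<^sup>2 * t)) * A j k * phi \<Xi>1 j x1 * cnj (phi \<Xi>2 k x2))"

definition joint_heat_kernel ::
    "'a system \<Rightarrow> 'b system \<Rightarrow> (nat \<Rightarrow> nat \<Rightarrow> complex) \<Rightarrow> (nat \<Rightarrow> nat \<Rightarrow> real) \<Rightarrow>
     real \<Rightarrow> 'a \<Rightarrow> 'b \<Rightarrow> complex" where
  "joint_heat_kernel \<Xi>1 \<Xi>2 A l t x1 x2 = Lim at_top (joint_kernel_sum \<Xi>1 \<Xi>2 A l t x1 x2)"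

definition joint_gaussian_bound ::
    "'a system \<Rightarrow> 'b system \<Rightarrow> ('a \<Rightarrow> 'b \<Rightarrow> real) \<Rightarrow>
     (nat \<Rightarrow> nat \<Rightarrow> complex) \<Rightarrow> (nat \<Rightarrow> nat \<Rightarrow> real) \<Rightarrow> real \<Rightarrow> bool" where
  "joint_gaussian_bound \<Xi>1 \<Xi>2 d A l Q \<longleftrightarrow>
     (let X1 = space (meas \<Xi>1); X2 = space (meas \<Xi>2) in
       Q > 0 \<and>
       (\<forall>j k. 0 \<le> l j k) \<and>
       (\<forall>u>0. finite {(j, k). l j k < u}) \<and>
       (\<exists>c>0. \<forall>n::real. n \<ge> 2 \<longrightarrow> (\<forall>x1\<in>X1. \<forall>x2\<in>X2.
          (\<Sum>(j, k) | l j k < n. norm (A j k * phi \<Xi>1 j x1 * cnj (phi \<Xi>2 k x2)))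
            \<le> c * n powr Q)) \<and>
       (\<forall>t>0. \<forall>x1\<in>X1. \<forall>x2\<in>X2. \<exists>K. (joint_kernel_sum \<Xi>1 \<Xi>2 A l t x1 x2 \<longlongrightarrow> K) at_top) \<and>
       (\<exists>c>0. \<exists>c1>0. \<exists>c2>0. \<forall>t. 0 < t \<and> t \<le> 1 \<longrightarrow> (\<forall>x1\<in>X1. \<forall>x2\<in>X2.
          norm (joint_heat_kernel \<Xi>1 \<Xi>2 A l t x1 x2)
            \<le> c1 * t powr (- c) * exp (- c2 * (d x1 x2)\<^sup>2 / t))))"


section \<open>Filters and operators\<close>

definition low_pass_filter :: "(real \<Rightarrow> real) \<Rightarrow> bool" where
  "low_pass_filter h \<longleftrightarrow>
     (\<forall>u. 0 \<le> h u \<and> h u \<le> 1) \<and> (\<forall>u. h (- u) = h u) \<and> antimono_on {0..} h \<and>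
     (\<forall>u. \<bar>u\<bar> < 1/2 \<longrightarrow> h u = 1) \<and> (\<forall>u. \<bar>u\<bar> \<ge> 1 \<longrightarrow> h u = 0)"

text \<open>A signed Borel measure on \<open>[0, \<infinity>)\<close> of bounded variation on compact intervals, given by its
  Jordan decomposition \<open>\<nu> - \<nu>'\<close>; its total variation measure is \<open>\<nu> + \<nu>'\<close>.\<close>

definition jordan_pair :: "real measure \<Rightarrow> real measure \<Rightarrow> bool" where
  "jordan_pair \<nu> \<nu>' \<longleftrightarrow>
     sets \<nu> = sets (restrict_space borel {0..}) \<and> sets \<nu>' = sets (restrict_space borel {0..}) \<and>
     (\<forall>b. emeasure \<nu> {0..b} < \<infinity> \<and> emeasure \<nu>' {0..b} < \<infinity>) \<and>
     (\<exists>N\<in>sets \<nu>. emeasure \<nu>' N = 0 \<and> emeasure \<nu> ({0..} - N) = 0)"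

definition sufficiently_smooth :: "real \<Rightarrow> real \<Rightarrow> real \<Rightarrow> (real \<Rightarrow> real) \<Rightarrow> bool" where
  "sufficiently_smooth q1 q2 Q h \<longleftrightarrow>
     (\<exists>(S::nat) \<nu> \<nu>'. real S > max (max q1 q2) (Q + 1) \<and> jordan_pair \<nu> \<nu>' \<and>
       (\<forall>u\<ge>0. h u = (\<integral>v. (max 0 (v\<^sup>2 - u\<^sup>2)) ^ S \<partial>\<nu>) - (\<integral>v. (max 0 (v\<^sup>2 - u\<^sup>2)) ^ S \<partial>\<nu>')) \<and>
       (\<integral>\<^sup>+v. ennreal ((v + 2) powr Q * (v ^ S + v ^ (2 * S))) \<partial>\<nu>) +
       (\<integral>\<^sup>+v. ennreal ((v + 2) powr Q * (v ^ S + v ^ (2 * S))) \<partial>\<nu>') < \<infinity>)"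

definition sigma_op ::
    "'a system \<Rightarrow> 'b system \<Rightarrow> (nat \<Rightarrow> nat \<Rightarrow> complex) \<Rightarrow> (nat \<Rightarrow> nat \<Rightarrow> real) \<Rightarrow>
     (real \<Rightarrow> real) \<Rightarrow> real \<Rightarrow> ('b \<Rightarrow> complex) \<Rightarrow> 'a \<Rightarrow> complex" where
  "sigma_op \<Xi>1 \<Xi>2 A l h n f x1 =
     (\<Sum>\<^sub>\<infinity>(j, k)\<in>UNIV.
        of_real (h (l j k / n)) * A j k * fourier_coeff \<Xi>2 f k * phi \<Xi>1 j x1)"

end

theory Submission
  imports Defs "HOL-Probability.Sinc_Integral" "HOL-Real_Asymp.Real_Asymp"
begin

text \<open>
  For fixed \<open>x\<^sub>1, x\<^sub>2\<close> the numbers \<open>A\<^sub>j\<^sub>k \<phi>\<^sub>1\<^sub>,\<^sub>j(x\<^sub>1) cnj (\<phi>\<^sub>2\<^sub>,\<^sub>k(x\<^sub>2))\<close>, placed at the points \<open>\<ell>\<^sub>j\<^sub>k\<close>, form a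
  discrete complex measure of polynomial growth. The Gaussian bound makes this measure annihilate
  every even function whose Fourier transform lives on \<open>[-\<delta> d, \<delta> d]\<close>, where \<open>d = d\<^sub>1\<^sub>2(x\<^sub>1, x\<^sub>2)\<close>
  (finite propagation speed). This is seen by approximating such functions by polynomials in
  \<open>z = exp (- u\<^sup>2 \<theta>)\<close> as \<open>\<theta> \<rightarrow> 0\<close>: with \<open>z = cos\<^sup>2 \<omega>\<close>, trigonometric polynomials in \<open>\<omega>\<close> of degree \<open>M\<close>
  become polynomials in \<open>z\<close> with coefficients at most \<open>7^M\<close>, which the factor
  \<open>exp (- c d\<^sup>2 / (M \<theta>))\<close> beats as long as \<open>M \<surd>\<theta>\<close> is at most a small multiple of \<open>d\<close>.

  Comparing \<open>h (\<cdot> / n)\<close> with a band-limited approximant of error \<open>(n d)^(-S)\<close> therefore shows that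
  the kernel of \<open>\<sigma>\<^sub>n\<close> is at most \<open>C n^Q min(1, (n d)^(-S))\<close>. Schur's test gives
  \<open>\<parallel>\<sigma>\<^sub>n f\<parallel> \<le> C n^\<kappa> \<parallel>f\<parallel>\<close>. Splitting \<open>f = (f - P) + P\<close> with a near-best \<open>P\<close> of degree \<open>2^m\<close> bounds
  \<open>\<sigma>(2^(m+1)) f - \<sigma>(2^m) f\<close>; the sequence then converges by telescoping, and a discrete Hardy
  inequality yields the Besov regularity of the limit.
\<close>

section \<open>Chebyshev polynomials and Dirichlet kernels\<close>

text \<open>The power of \<open>t\<close> in the Gaussian bound bears no relation to
  \<open>Q\<close>, so integrating that bound cannot give the order \<open>n^Q\<close>. It is used
  only qualitatively: it forces certain integrals to be exactly \<open>0\<close> in a limit, where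
  any fixed power of \<open>t\<close> is harmless. All sizes come from the growth bound, and neither
  \<open>c1\<close> nor \<open>\<alpha>\<close> enters the constant of the Tauberian theorem. The
  growth bound is applied to functions decaying at least like \<open>(1 + u)^(-Q-1)\<close>; hence
  the high powers \<open>sinc ^ (2 * R)\<close>, and the factor \<open>z ^ R\<close> in front of the
  trigonometric polynomials. Under \<open>\<theta> = \<tau>^2 / L^2\<close> normalised powers of the
  Dirichlet kernel tend to powers of \<open>sinc\<close>, whose symmetrised translates span the
  band-limited functions in use. The approximant of \<open>h\<close> is of Jackson type: the error
  is an average of \<open>S\<close>-th differences of \<open>h\<close>. The condition
  \<open>S > max q1 q2\<close> makes the kernel bound summable over dyadic shells in either
  variable.\<close>

lemma integral_chebyshev_bound:
  fixes a :: "'i \<Rightarrow> complex" and z w :: "'i \<Rightarrow> real"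
  assumes int: "\<And>k. k \<ge> R \<Longrightarrow> integrable M (\<lambda>i. a i * of_real (z i ^ k))"
    and [measurable]: "w \<in> borel_measurable M"
    and z: "\<And>i. i \<in> space M \<Longrightarrow> cos (2 * w i) = 2 * z i - 1"
    and B: "\<And>k. R \<le> k \<Longrightarrow> k \<le> K \<Longrightarrow> norm (\<integral>i. a i * of_real (z i ^ k) \<partial>M) \<le> B"
    and "R \<le> k" "k + m \<le> K"
  shows "integrable M (\<lambda>i. a i * of_real (z i ^ k * cos (2 * real m * w i)))"
    and "norm (\<integral>i. a i * of_real (z i ^ k * cos (2 * real m * w i)) \<partial>M) \<le> 7 ^ m * B"
proof -
  have I: "integrable M (\<lambda>i. a i * of_real (z i ^ k * cos (2 * real m * w i)))"
    if "k \<ge> R" for k m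
  proof (rule Bochner_Integration.integrable_bound[OF int[OF that]])
    have [measurable]: "(\<lambda>i. a i * of_real (z i ^ k)) \<in> borel_measurable M"
      using int[OF that] by auto
    have "(\<lambda>i. (a i * of_real (z i ^ k)) * of_real (cos (2 * real m * w i))) \<in> borel_measurable M"
      by measurable
    then show "(\<lambda>i. a i * of_real (z i ^ k * cos (2 * real m * w i))) \<in> borel_measurable M"
      by (simp add: mult.assoc)
    show "AE i in M. norm (a i * of_real (z i ^ k * cos (2 * real m * w i)))
        \<le> norm (a i * of_real (z i ^ k))"
      by (auto simp: norm_mult abs_mult intro!: mult_left_mono mult_right_le_one_le)
  qed
  show "integrable M (\<lambda>i. a i * of_real (z i ^ k * cos (2 * real m * w i)))"
    using I \<open>R \<le> k\<close> .
  have B0: "B \<ge> 0" using B[of k] assms(5,6) by (meson le_add1 norm_ge_zero order_trans)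
  define J where "J k m = (\<integral>i. a i * of_real (z i ^ k * cos (2 * real m * w i)) \<partial>M)" for k m
  \<comment> \<open>Since \<open>cos (2 * w i) = 2 * z i - 1\<close>, the cosine of
    \<open>2 * m * w i\<close> is the Chebyshev polynomial \<open>T_m\<close> at
    \<open>2 * z i - 1\<close>, and the three-term recurrence becomes one for \<open>J\<close>. Each
    step may use one more power of \<open>z\<close>, hence the condition
    \<open>k + m \<le> K\<close>. The base 7 works because
    \<open>6 * 7 + 1 \<le> 49\<close>.\<close>
  have "norm (J k m) \<le> 7 ^ m * B"
    using \<open>R \<le> k\<close> \<open>k + m \<le> K\<close>
  proof (induction m arbitrary: k rule: induct_nat_012)
    case 0
    then show ?case using B[of k] by (simp add: J_def)
  next
    case 1
    have "J k 1 = (\<integral>i. 2 * (a i * of_real (z i ^ Suc k)) - a i * of_real (z i ^ k) \<partial>M)"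
      unfolding J_def
    proof (intro Bochner_Integration.integral_cong refl)
      fix i assume "i \<in> space M"
      then have e: "cos (2 * real 1 * w i) = 2 * z i - 1" by (simp add: z)
      show "a i * of_real (z i ^ k * cos (2 * real 1 * w i)) =
          2 * (a i * of_real (z i ^ Suc k)) - a i * of_real (z i ^ k)"
        unfolding e by (simp add: algebra_simps)
    qed
    also have "\<dots> = 2 * (\<integral>i. a i * of_real (z i ^ Suc k) \<partial>M) - (\<integral>i. a i * of_real (z i ^ k) \<partial>M)"
      using int[of k] int[of "Suc k"] 1
      by (subst Bochner_Integration.integral_diff) (auto simp del: power_Suc)
    also have "norm \<dots> \<le> 2 * B + B"
      using B[of k] B[of "Suc k"] 1
      by (intro order.trans[OF norm_triangle_ineq4] add_mono) (auto simp: norm_mult simp del: power_Suc)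
    finally show ?case using B0 by simp
  next
    case (ge2 m)
    have "J k (Suc (Suc m)) = (\<integral>i. 4 * (a i * of_real (z i ^ Suc k * cos (2 * real (Suc m) * w i)))
        - 2 * (a i * of_real (z i ^ k * cos (2 * real (Suc m) * w i)))
        - a i * of_real (z i ^ k * cos (2 * real m * w i)) \<partial>M)"
      unfolding J_def
    proof (intro Bochner_Integration.integral_cong refl)
      fix i assume i: "i \<in> space M"
      have "cos (2 * real (Suc m) * w i + 2 * w i) + cos (2 * real (Suc m) * w i - 2 * w i)
          = 2 * cos (2 * w i) * cos (2 * real (Suc m) * w i)"
        by (simp only: cos_add cos_diff) algebra
      then have "cos (2 * real (Suc (Suc m)) * w i) + cos (2 * real m * w i)
          = 2 * cos (2 * w i) * cos (2 * real (Suc m) * w i)"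
        by (simp add: algebra_simps)
      then have e: "cos (2 * real (Suc (Suc m)) * w i)
          = 2 * (2 * z i - 1) * cos (2 * real (Suc m) * w i) - cos (2 * real m * w i)"
        using z[OF i] by simp
      show "a i * of_real (z i ^ k * cos (2 * real (Suc (Suc m)) * w i))
        = 4 * (a i * of_real (z i ^ Suc k * cos (2 * real (Suc m) * w i)))
        - 2 * (a i * of_real (z i ^ k * cos (2 * real (Suc m) * w i)))
        - a i * of_real (z i ^ k * cos (2 * real m * w i))"
        unfolding e by (simp add: algebra_simps)
    qed
    also have "\<dots> = 4 * J (Suc k) (Suc m) - 2 * J k (Suc m) - J k m"
      unfolding J_def using I[of k "Suc m"] I[of "Suc k" "Suc m"] I[of k m] ge2(3)
      by (subst Bochner_Integration.integral_diff
          Bochner_Integration.integral_mult_right_zero, (auto simp del: power_Suc of_nat_Suc)[2])+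
         (simp_all del: power_Suc of_nat_Suc)
    also have "norm \<dots> \<le> 4 * norm (J (Suc k) (Suc m)) + 2 * norm (J k (Suc m)) + norm (J k m)"
      by (rule order.trans[OF norm_triangle_ineq4] add_mono order.refl)+ (simp_all add: norm_mult)
    also have "\<dots> \<le> 4 * (7 ^ Suc m * B) + 2 * (7 ^ Suc m * B) + 7 ^ m * B"
      using ge2 by (intro add_mono mult_left_mono ge2.IH) auto
    also have "\<dots> \<le> 7 ^ Suc (Suc m) * B"
      using B0 by (simp add: algebra_simps)
    finally show ?case .
  qed
  then show "norm (\<integral>i. a i * of_real (z i ^ k * cos (2 * real m * w i)) \<partial>M) \<le> 7 ^ m * B"
    by (simp add: J_def)
qed

text \<open>The frequencies are doubled because only cosines of even multiples of an angle are
  polynomials in its squared cosine.\<close>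

definition dirichlet :: "nat \<Rightarrow> real \<Rightarrow> complex" where
  "dirichlet L x = (\<Sum>r<L. cis (2 * real r * x))"

lemma norm_dirichlet_le: "norm (dirichlet L x) \<le> real L"
  unfolding dirichlet_def by (rule order.trans[OF norm_sum]) simp

lemma norm_cis_minus_one: "norm (cis (2 * x) - 1) = 2 * \<bar>sin x\<bar>"
  using dist_exp_i_1[of "2 * x"] by (simp add: cis_conv_exp)

lemma norm_dirichlet_sin: "norm (dirichlet L x) * \<bar>sin x\<bar> = \<bar>sin (real L * x)\<bar>"
proof -
  have "(cis (2 * x) - 1) * dirichlet L x = cis (2 * x) ^ L - 1"
    unfolding dirichlet_def power_diff_1_eq[of "cis (2 * x)" L]
    by (intro arg_cong2[where f="(*)"] refl sum.cong) (simp only: Complex.DeMoivre mult_ac)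
  also have "cis (2 * x) ^ L = cis (2 * (real L * x))"
    by (simp add: Complex.DeMoivre mult_ac)
  finally have "norm (cis (2 * x) - 1) * norm (dirichlet L x) = norm (cis (2 * (real L * x)) - 1)"
    by (metis norm_mult)
  then show ?thesis
    unfolding norm_cis_minus_one by (simp add: mult.commute)
qed

lemma norm_dirichlet_0: "norm (dirichlet L 0) = real L"
  by (simp add: dirichlet_def)

text \<open>Expanding over index functions leaves every coefficient equal to 1, so the coefficients
  of the power need no computation. Only the number \<open>L ^ (2 * R)\<close> of terms and the size
  of the frequencies, at most \<open>R * L\<close>, matter later.\<close>

lemma norm_dirichlet_power:
  "norm (dirichlet L x) ^ (2 * R) =
     (\<Sum>f\<in>PiE {..<R} (\<lambda>_. {..<L}). \<Sum>g\<in>PiE {..<R} (\<lambda>_. {..<L}).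
        cos (2 * (real (\<Sum>i<R. f i) - real (\<Sum>i<R. g i)) * x))"
proof -
  let ?G = "PiE {..<R} (\<lambda>_. {..<L})"
  have cis_prod: "(\<Prod>i<R. cis (t i)) = cis (\<Sum>i<R. t i)" for t :: "nat \<Rightarrow> real" and R
    by (induction R) (auto simp: cis_mult)
  have "dirichlet L x ^ R = (\<Prod>i<R. \<Sum>r<L. cis (2 * real r * x))"
    by (simp add: dirichlet_def)
  also have "\<dots> = (\<Sum>f\<in>?G. \<Prod>i<R. cis (2 * real (f i) * x))"
    by (subst prod_sum_PiE) auto
  also have "\<dots> = (\<Sum>f\<in>?G. cis (2 * real (\<Sum>i<R. f i) * x))"
    by (simp add: cis_prod sum_distrib_left sum_distrib_right)
  finally have D: "dirichlet L x ^ R = (\<Sum>f\<in>?G. cis (2 * real (\<Sum>i<R. f i) * x))" .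
  have "complex_of_real (norm (dirichlet L x) ^ (2 * R)) = of_real ((norm (dirichlet L x ^ R))\<^sup>2)"
    by (simp add: norm_power power_mult[symmetric] mult.commute)
  also have "\<dots> = dirichlet L x ^ R * cnj (dirichlet L x ^ R)"
    by (rule complex_norm_square)
  also have "\<dots> = (\<Sum>f\<in>?G. \<Sum>g\<in>?G.
        cis (2 * (real (\<Sum>i<R. f i) - real (\<Sum>i<R. g i)) * x))"
    unfolding D cnj_sum sum_product
    by (intro sum.cong refl) (simp add: cis_cnj cis_mult algebra_simps)
  finally have "Re (complex_of_real (norm (dirichlet L x) ^ (2 * R))) = Re \<dots>" by simp
  then show ?thesis by (simp add: cis.sel)
qed

text \<open>Adding the kernels shifted by \<open>v\<close> and by \<open>- v\<close> cancels the
  sines and leaves products of a constant cosine in \<open>v\<close> with a cosine in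
  \<open>w\<close>, to which the Chebyshev bound applies. Dividing by \<open>L ^ (2 * R)\<close>
  turns the sum over pairs of index functions into an average, whence the factor 2.\<close>

lemma integral_dirichlet_bound:
  fixes a :: "'i \<Rightarrow> complex" and z w :: "'i \<Rightarrow> real"
  assumes int: "\<And>k. k \<ge> R \<Longrightarrow> integrable M (\<lambda>i. a i * of_real (z i ^ k))"
    and [measurable]: "w \<in> borel_measurable M"
    and z: "\<And>i. i \<in> space M \<Longrightarrow> cos (2 * w i) = 2 * z i - 1"
    and B: "\<And>k. R \<le> k \<Longrightarrow> k \<le> R + R * L \<Longrightarrow> norm (\<integral>i. a i * of_real (z i ^ k) \<partial>M) \<le> B"
    and L: "L > 0"
  shows "norm (\<integral>i. a i * of_real (z i ^ R * ((norm (dirichlet L (w i - v)) / L) ^ (2 * R)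
            + (norm (dirichlet L (w i + v)) / L) ^ (2 * R))) \<partial>M) \<le> 2 * 7 ^ (R * L) * B"
proof -
  let ?G = "PiE {..<R} (\<lambda>_. {..<L})"
  define s where "s f = (\<Sum>i<R. f i)" for f :: "nat \<Rightarrow> nat"
  define q where "q f g = nat \<bar>int (s f) - int (s g)\<bar>" for f g
  have s: "s f \<le> R * L" if "f \<in> ?G" for f
    using sum_bounded_above[of "{..<R}" f L] PiE_mem[OF that] by (simp add: s_def less_imp_le)
  have q: "q f g \<le> R * L" if "f \<in> ?G" "g \<in> ?G" for f g
    using s[OF that(1)] s[OF that(2)] by (auto simp: q_def)
  have qr: "real (q f g) = \<bar>real (s f) - real (s g)\<bar>" for f g
    by (simp add: q_def)
  have cosq: "cos (2 * (real (s f) - real (s g)) * x) = cos (2 * real (q f g) * x)" for f g x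
    unfolding qr using cos_minus[of "2 * (real (s f) - real (s g)) * x"]
    by (cases "real (s f) \<ge> real (s g)") (simp_all add: abs_if algebra_simps)
  have B0: "B \<ge> 0" using B[of R] by (meson le_add1 norm_ge_zero order_refl order_trans)
  have eq: "(norm (dirichlet L (x - v)) / L) ^ (2 * R) + (norm (dirichlet L (x + v)) / L) ^ (2 * R)
     = (\<Sum>f\<in>?G. \<Sum>g\<in>?G. 2 / L ^ (2 * R) * cos (2 * real (q f g) * v) * cos (2 * real (q f g) * x))" for x
  proof -
    have c: "cos (2 * real k * (x - v)) / real L ^ (2 * R) + cos (2 * real k * (x + v)) / real L ^ (2 * R) =
      2 * cos (2 * real k * v) * cos (2 * real k * x) / real L ^ (2 * R)" for k
      by (simp add: cos_add cos_diff algebra_simps add_divide_distrib[symmetric] distrib_left)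
    show ?thesis
      unfolding power_divide norm_dirichlet_power s_def[symmetric] cosq
      by (simp add: sum_divide_distrib sum.distrib[symmetric] c)
  qed
  note ch = integral_chebyshev_bound[where R=R and K="R + R * L" and M=M and a=a and z=z and w=w and B=B and k=R,
      OF int assms(2) z B]
  have "(\<integral>i. a i * of_real (z i ^ R * ((norm (dirichlet L (w i - v)) / L) ^ (2 * R)
            + (norm (dirichlet L (w i + v)) / L) ^ (2 * R))) \<partial>M)
     = (\<integral>i. (\<Sum>f\<in>?G. \<Sum>g\<in>?G. of_real (2 / L ^ (2 * R) * cos (2 * real (q f g) * v)) *
           (a i * of_real (z i ^ R * cos (2 * real (q f g) * w i)))) \<partial>M)"
    unfolding eq
    by (intro Bochner_Integration.integral_cong refl)
       (simp only: sum_distrib_left of_real_sum, intro sum.cong refl, simp)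
  also have "\<dots> = (\<Sum>f\<in>?G. \<Sum>g\<in>?G. of_real (2 / L ^ (2 * R) * cos (2 * real (q f g) * v)) *
           (\<integral>i. a i * of_real (z i ^ R * cos (2 * real (q f g) * w i)) \<partial>M))"
  proof -
    have I: "integrable M (\<lambda>i. of_real (2 / L ^ (2 * R) * cos (2 * real (q f g) * v)) *
           (a i * of_real (z i ^ R * cos (2 * real (q f g) * w i))))" if "f \<in> ?G" "g \<in> ?G" for f g
      by (intro integrable_mult_right ch(1)) (use q[OF that] in auto)
    show ?thesis
      by (subst Bochner_Integration.integral_sum, intro Bochner_Integration.integrable_sum I, assumption+,
          intro sum.cong refl, subst Bochner_Integration.integral_sum, intro I, assumption+,
          simp only: integral_mult_right_zero)
  qed
  finally have E: "(\<integral>i. a i * of_real (z i ^ R * ((norm (dirichlet L (w i - v)) / L) ^ (2 * R)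
            + (norm (dirichlet L (w i + v)) / L) ^ (2 * R))) \<partial>M) = \<dots>" .
  have "norm (\<integral>i. a i * of_real (z i ^ R * ((norm (dirichlet L (w i - v)) / L) ^ (2 * R)
            + (norm (dirichlet L (w i + v)) / L) ^ (2 * R))) \<partial>M)
      \<le> (\<Sum>f\<in>?G. \<Sum>g\<in>?G. 2 / L ^ (2 * R) * (7 ^ (R * L) * B))"
    unfolding E
  proof (intro sum_norm_le)
    fix f g assume fg: "f \<in> ?G" "g \<in> ?G"
    have "norm (\<integral>i. a i * of_real (z i ^ R * cos (2 * real (q f g) * w i)) \<partial>M) \<le> 7 ^ q f g * B"
      by (rule ch(2)) (use q[OF fg] in auto)
    also have "\<dots> \<le> 7 ^ (R * L) * B"
      using q[OF fg] B0 by (intro mult_right_mono power_increasing) auto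
    finally have V: "norm (\<integral>i. a i * of_real (z i ^ R * cos (2 * real (q f g) * w i)) \<partial>M) \<le> 7 ^ (R * L) * B" .
    have W: "norm (complex_of_real (2 / L ^ (2 * R) * cos (2 * real (q f g) * v))) \<le> 2 / L ^ (2 * R)"
    proof -
      have "\<bar>2 / real (L ^ (2 * R))\<bar> = 2 / real (L ^ (2 * R))"
        by (rule abs_of_nonneg) (rule divide_nonneg_nonneg, auto)
      then show ?thesis
        unfolding norm_of_real abs_mult by (simp only:) (intro mult_left_le, auto)
    qed
    show "norm (of_real (2 / L ^ (2 * R) * cos (2 * real (q f g) * v)) *
           (\<integral>i. a i * of_real (z i ^ R * cos (2 * real (q f g) * w i)) \<partial>M)) \<le> 2 / L ^ (2 * R) * (7 ^ (R * L) * B)"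
      unfolding norm_mult using V W by (intro mult_mono) simp_all
  qed
  also have "\<dots> = 2 * 7 ^ (R * L) * B"
  proof -
    have "card ?G = L ^ R" by (simp add: card_PiE)
    moreover have "real L ^ R * (real L ^ R * (2 / real L ^ (2 * R))) = 2"
      using L by (simp add: power_mult power2_eq_square power_mult_distrib)
    then have "real L ^ R * (real L ^ R * (2 / real L ^ (2 * R) * (7 ^ (R * L) * B))) = 2 * 7 ^ (R * L) * B"
      by (metis mult.assoc)
    ultimately show ?thesis by (simp only: sum_constant of_nat_power)
  qed
  finally show ?thesis .
qed

text \<open>The complex measure is a density \<open>a\<close> with respect to \<open>M\<close>,
  transported by \<open>u\<close> to the half-line; the condition bounds its total variation on
  \<open>[0, x)\<close>. A general \<open>M\<close> covers the discrete case through
  \<open>count_space\<close>.\<close>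

definition poly_growth :: "'i measure \<Rightarrow> ('i \<Rightarrow> complex) \<Rightarrow> ('i \<Rightarrow> real) \<Rightarrow> real \<Rightarrow> real \<Rightarrow> bool" where
  "poly_growth M a u c Q \<longleftrightarrow> a \<in> borel_measurable M \<and> u \<in> borel_measurable M \<and>
     (\<forall>i\<in>space M. 0 \<le> u i) \<and> 0 \<le> c \<and> 0 < Q \<and>
     (\<forall>x\<ge>2. (\<integral>\<^sup>+i. ennreal (norm (a i)) * indicator {i. u i < x} i \<partial>M) \<le> ennreal (c * x powr Q))"

text \<open>Dyadic balls take the place of dyadic shells, since growth is known on balls. A single
  term suffices: the least \<open>r\<close> with \<open>x < 2 ^ Suc r\<close> also satisfies
  \<open>2 ^ r \<le> 1 + x\<close>.\<close>

lemma inverse_power_le_dyadic_suminf: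
  fixes x :: real
  assumes "0 \<le> x"
  shows "ennreal ((1 / (1 + x)) ^ m) \<le>
    (\<Sum>r. ennreal (2 ^ m * (1 / 2 ^ m) ^ Suc r) * indicator {x. x < 2 ^ Suc r} x)"
proof -
  have ex: "\<exists>r::nat. x < 2 ^ Suc r"
    using real_arch_pow[of 2 x] by (metis lessI one_less_numeral_iff order_less_trans power_strict_increasing_iff semiring_norm(76))
  define r where "r = (LEAST r::nat. x < 2 ^ Suc r)"
  have r: "x < 2 ^ Suc r" unfolding r_def using ex by (rule LeastI_ex)
  have "2 ^ r \<le> 1 + x"
  proof (cases r)
    case (Suc k)
    then have "\<not> x < 2 ^ Suc k" using not_less_Least[of k "\<lambda>r. x < 2 ^ Suc r"] r_def by auto
    then show ?thesis using Suc by simp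
  qed (use assms in simp)
  then have "(1 / (1 + x)) ^ m \<le> (1 / 2 ^ r) ^ m"
    using assms by (intro power_mono divide_left_mono) (auto intro: mult_pos_pos)
  also have "\<dots> = 2 ^ m * (1 / 2 ^ m) ^ Suc r"
    by (simp add: power_divide power_mult[symmetric] mult.commute)
  finally have *: "ennreal ((1 / (1 + x)) ^ m) \<le> ennreal (2 ^ m * (1 / 2 ^ m) ^ Suc r) * indicator {x. x < 2 ^ Suc r} x"
    using r by (simp add: ennreal_leI)
  define F where "F r = ennreal (2 ^ m * (1 / 2 ^ m) ^ Suc r) * indicator {x. x < 2 ^ Suc r} x" for r
  have "F r \<le> (\<Sum>r. F r)"
    using sum_le_suminf[of F "{r}"] by simp
  with * show ?thesis
    unfolding F_def by (rule order.trans)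
qed

text \<open>The ball of radius \<open>2 ^ Suc r * n\<close> has mass of order
  \<open>2^((r+1) Q) n^Q\<close>, against a decay \<open>2^(-(r+1) m)\<close>. For
  \<open>m \<ge> Q + 1\<close> the series is dominated by that of \<open>(1/2) ^ Suc r\<close>,
  whose sum is 1. The condition \<open>n \<ge> 1\<close> keeps all radii at least 2.\<close>

lemma poly_growth_decay:
  assumes g: "poly_growth M a u c Q" and m: "real m \<ge> Q + 1" and n: "(n::real) \<ge> 1"
  shows "(\<integral>\<^sup>+i. ennreal (norm (a i) * (1 / (1 + u i / n)) ^ m) \<partial>M) \<le> ennreal (2 ^ m * c * n powr Q)"
proof -
  have [measurable]: "a \<in> borel_measurable M" "u \<in> borel_measurable M"
    and u: "\<And>i. i \<in> space M \<Longrightarrow> 0 \<le> u i" and c: "0 \<le> c" "0 < Q"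
    and G: "\<And>x. x \<ge> 2 \<Longrightarrow> (\<integral>\<^sup>+i. ennreal (norm (a i)) * indicator {i. u i < x} i \<partial>M) \<le> ennreal (c * x powr Q)"
    using g by (auto simp: poly_growth_def)
  have "(\<integral>\<^sup>+i. ennreal (norm (a i) * (1 / (1 + u i / n)) ^ m) \<partial>M)
    \<le> (\<integral>\<^sup>+i. (\<Sum>r. ennreal (2 ^ m * (1 / 2 ^ m) ^ Suc r) *
          (ennreal (norm (a i)) * indicator {i. u i < 2 ^ Suc r * n} i)) \<partial>M)"
  proof (intro nn_integral_mono)
    fix i assume i: "i \<in> space M"
    have "ennreal (norm (a i) * (1 / (1 + u i / n)) ^ m) = ennreal (norm (a i)) * ennreal ((1 / (1 + u i / n)) ^ m)"
      using u[OF i] n by (intro ennreal_mult) auto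
    also have "\<dots> \<le> ennreal (norm (a i)) * (\<Sum>r. ennreal (2 ^ m * (1 / 2 ^ m) ^ Suc r) * indicator {x. x < 2 ^ Suc r} (u i / n))"
      using u[OF i] n by (intro mult_left_mono inverse_power_le_dyadic_suminf) auto
    also have "\<dots> = (\<Sum>r. ennreal (2 ^ m * (1 / 2 ^ m) ^ Suc r) *
          (ennreal (norm (a i)) * indicator {i. u i < 2 ^ Suc r * n} i))"
      unfolding ennreal_suminf_cmult[symmetric] using n
      by (intro suminf_cong) (auto simp: indicator_def divide_simps mult_ac)
    finally show "ennreal (norm (a i) * (1 / (1 + u i / n)) ^ m) \<le> \<dots>" .
  qed
  also have "\<dots> = (\<Sum>r. ennreal (2 ^ m * (1 / 2 ^ m) ^ Suc r) *
          (\<integral>\<^sup>+i. ennreal (norm (a i)) * indicator {i. u i < 2 ^ Suc r * n} i \<partial>M))"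
    by (subst nn_integral_suminf) (auto simp: nn_integral_cmult)
  also have "\<dots> \<le> (\<Sum>r. ennreal ((2 ^ m * c * n powr Q) * (1/2) ^ Suc r))"
  proof (intro suminf_le allI)
    fix r :: nat
    have "(1::real) * 2 \<le> n * 2 ^ Suc r" using n by (intro mult_mono) auto
    then have "(\<integral>\<^sup>+i. ennreal (norm (a i)) * indicator {i. u i < 2 ^ Suc r * n} i \<partial>M) \<le> ennreal (c * (2 ^ Suc r * n) powr Q)"
      by (intro G) (simp add: mult.commute)
    then have "ennreal (2 ^ m * (1 / 2 ^ m) ^ Suc r) *
          (\<integral>\<^sup>+i. ennreal (norm (a i)) * indicator {i. u i < 2 ^ Suc r * n} i \<partial>M)
       \<le> ennreal (2 ^ m * (1 / 2 ^ m) ^ Suc r) * ennreal (c * (2 ^ Suc r * n) powr Q)"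
      by (intro mult_left_mono) auto
    also have "\<dots> = ennreal ((2 ^ m * c * n powr Q) * ((1 / 2 ^ m) ^ Suc r * (2 ^ Suc r) powr Q))"
      using n c by (subst ennreal_mult[symmetric]) (auto simp: powr_mult mult_ac)
    also have "\<dots> \<le> ennreal ((2 ^ m * c * n powr Q) * (1/2) ^ Suc r)"
    proof (intro ennreal_leI mult_left_mono)
      have "(1 / 2 ^ m) ^ Suc r * (2 ^ Suc r) powr Q = 2 powr (- real m * real (Suc r)) * 2 powr (real (Suc r) * Q)"
      proof -
        have "(1 / 2 ^ m) ^ Suc r = (2::real) powr (- real (m * Suc r))"
          unfolding powr_minus powr_realpow[OF zero_less_numeral] power_mult
          by (simp only: power_one_over inverse_eq_divide)
        moreover have "(2 ^ Suc r) powr Q = (2::real) powr (real (Suc r) * Q)"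
          unfolding powr_realpow[OF zero_less_numeral, symmetric] powr_powr ..
        ultimately show ?thesis by (simp only: of_nat_mult mult_minus_left)
      qed
      also have "\<dots> = 2 powr ((Q - real m) * real (Suc r))"
        by (simp add: powr_add[symmetric] algebra_simps)
      also have "\<dots> \<le> 2 powr (- 1 * real (Suc r))"
        using m by (intro powr_mono mult_right_mono) auto
      also have "\<dots> = (1 / 2) ^ Suc r"
        by (simp only: mult_minus_left mult_1 powr_minus powr_realpow[OF zero_less_numeral] inverse_eq_divide power_one_over)
      finally show "(1 / 2 ^ m) ^ Suc r * (2 ^ Suc r) powr Q \<le> (1 / 2) ^ Suc r" .
    qed (use c n in auto)
    finally show "ennreal (2 ^ m * (1 / 2 ^ m) ^ Suc r) *
          (\<integral>\<^sup>+i. ennreal (norm (a i)) * indicator {i. u i < 2 ^ Suc r * n} i \<partial>M)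
       \<le> ennreal ((2 ^ m * c * n powr Q) * (1/2) ^ Suc r)" .
  qed auto
  also have "\<dots> = ennreal (\<Sum>r. (2 ^ m * c * n powr Q) * (1/2) ^ Suc r)"
    using c by (intro suminf_ennreal2 summable_mult sums_summable[OF power_half_series]) auto
  also have "\<dots> = ennreal (2 ^ m * c * n powr Q)"
    using sums_unique[OF sums_mult[OF power_half_series, of "2 ^ m * c * n powr Q"]] by (simp only: mult_1_right)
  finally show ?thesis .
qed

lemma poly_growth_integrable:
  fixes f :: "'i \<Rightarrow> complex"
  assumes g: "poly_growth M a u c Q" and m: "real m \<ge> Q + 1" and n: "(n::real) \<ge> 1"
    and [measurable]: "f \<in> borel_measurable M"
    and f: "\<And>i. i \<in> space M \<Longrightarrow> norm (f i) \<le> K * (1 / (1 + u i / n)) ^ m"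
    and K: "0 \<le> K"
  shows "integrable M (\<lambda>i. a i * f i)" "norm (\<integral>i. a i * f i \<partial>M) \<le> K * (2 ^ m * c * n powr Q)"
proof -
  have [measurable]: "a \<in> borel_measurable M" "u \<in> borel_measurable M" and c: "0 \<le> c"
    using g by (auto simp: poly_growth_def)
  have "(\<integral>\<^sup>+i. ennreal (norm (a i * f i)) \<partial>M) \<le> (\<integral>\<^sup>+i. ennreal K * ennreal (norm (a i) * (1 / (1 + u i / n)) ^ m) \<partial>M)"
  proof (intro nn_integral_mono)
    fix i assume i: "i \<in> space M"
    have "norm (a i * f i) \<le> K * (norm (a i) * (1 / (1 + u i / n)) ^ m)"
      using mult_left_mono[OF f[OF i], of "norm (a i)"] by (simp add: norm_mult mult_ac)
    then show "ennreal (norm (a i * f i)) \<le> ennreal K * ennreal (norm (a i) * (1 / (1 + u i / n)) ^ m)"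
      using K by (simp add: ennreal_mult'[symmetric] ennreal_leI)
  qed
  also have "\<dots> \<le> ennreal K * ennreal (2 ^ m * c * n powr Q)"
    by (subst nn_integral_cmult) (auto intro!: mult_left_mono poly_growth_decay[OF g m n])
  also have "\<dots> = ennreal (K * (2 ^ m * c * n powr Q))"
    using K by (simp add: ennreal_mult')
  finally have *: "(\<integral>\<^sup>+i. ennreal (norm (a i * f i)) \<partial>M) \<le> ennreal (K * (2 ^ m * c * n powr Q))" .
  show I: "integrable M (\<lambda>i. a i * f i)"
    using * by (intro integrableI_bounded) (auto intro: le_less_trans simp: less_top)
  have "ennreal (norm (\<integral>i. a i * f i \<partial>M)) \<le> (\<integral>\<^sup>+i. ennreal (norm (a i * f i)) \<partial>M)"
    by (rule integral_norm_bound_ennreal[OF I])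
  also note *
  finally show "norm (\<integral>i. a i * f i \<partial>M) \<le> K * (2 ^ m * c * n powr Q)"
    using K c by (subst (asm) ennreal_le_iff) auto
qed

text \<open>The angle \<omega> in \<open>[0, pi/2)\<close> with
  \<open>cos^2 \<omega> = exp (- u^2 \<theta>)\<close>, written through
  \<open>tan^2 \<omega> = exp (u^2 \<theta>) - 1\<close>.\<close>

definition heat_angle :: "real \<Rightarrow> real \<Rightarrow> real" where
  "heat_angle \<theta> u = arctan (sqrt (exp (u\<^sup>2 * \<theta>) - 1))"

lemma heat_angle:
  assumes "0 \<le> \<theta>"
  shows "sin (heat_angle \<theta> u) = sqrt (1 - exp (- u\<^sup>2 * \<theta>))"
    and "cos (2 * heat_angle \<theta> u) = 2 * exp (- u\<^sup>2 * \<theta>) - 1"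
proof -
  have e: "1 \<le> exp (u\<^sup>2 * \<theta>)" using assms by simp
  have c: "cos (heat_angle \<theta> u) ^ 2 = exp (- u\<^sup>2 * \<theta>)"
    using e by (simp add: heat_angle_def cos_arctan power_divide exp_minus inverse_eq_divide)
  show "cos (2 * heat_angle \<theta> u) = 2 * exp (- u\<^sup>2 * \<theta>) - 1"
    using c by (simp add: cos_double_cos)
  have "0 \<le> sin (heat_angle \<theta> u)"
    using e by (simp add: heat_angle_def sin_arctan)
  moreover have "sin (heat_angle \<theta> u) ^ 2 = 1 - exp (- u\<^sup>2 * \<theta>)"
    using c sin_cos_squared_add[of "heat_angle \<theta> u"] by linarith
  ultimately show "sin (heat_angle \<theta> u) = sqrt (1 - exp (- u\<^sup>2 * \<theta>))"
    by (simp add: real_sqrt_unique)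
qed

text \<open>The bound is uniform in \<open>L\<close>, as dominated convergence requires. The
  normalised kernel is at most 1 and at most the inverse of \<open>L\<close> times the absolute
  sine. The angle never reaches \<open>pi / 2\<close>, so this sine cannot follow
  \<open>\<tau> * u / L\<close> for large \<open>u\<close>; the factor \<open>sqrt z\<close>
  compensates, because \<open>u^2 \<theta> z \<le> 1 - z\<close>, which is the squared sine of the
  heat angle.\<close>

lemma dirichlet_heat_angle_bound:
  assumes L: "L > 0" and \<tau>: "\<tau> > 0" and y: "0 \<le> y" and u: "0 \<le> u"
    and v: "v = heat_angle (\<tau>\<^sup>2 / (real L)\<^sup>2) y \<or> v = - heat_angle (\<tau>\<^sup>2 / (real L)\<^sup>2) y"
  shows "exp (- u\<^sup>2 * (\<tau>\<^sup>2 / (real L)\<^sup>2)) ^ R * (norm (dirichlet L (heat_angle (\<tau>\<^sup>2 / (real L)\<^sup>2) u + v)) / L) ^ (2 * R)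
      \<le> ((2 + \<tau> * y) / (1 + \<tau> * u)) ^ (2 * R)"
proof -
  define \<theta> where "\<theta> = \<tau>\<^sup>2 / (real L)\<^sup>2"
  define x where "x = heat_angle \<theta> u"
  define z where "z = exp (- u\<^sup>2 * \<theta>)"
  define e where "e = norm (dirichlet L (x + v)) / L"
  have \<theta>: "0 \<le> \<theta>" "(real L)\<^sup>2 * \<theta> = \<tau>\<^sup>2" using L by (auto simp: \<theta>_def)
  have z: "0 < z" "z \<le> 1" using \<theta> by (auto simp: z_def)
  have e1: "0 \<le> e" "e \<le> 1" using norm_dirichlet_le[of L "x + v"] L by (auto simp: e_def)
  have e2: "e * (L * \<bar>sin (x + v)\<bar>) \<le> 1"
    using norm_dirichlet_sin[of L "x + v"] L by (simp add: e_def)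
  have "sin x = sin (x + v) * cos v - cos (x + v) * sin v"
    using sin_diff[of "x + v" v] by simp
  also have "\<dots> \<le> \<bar>sin (x + v) * cos v\<bar> + \<bar>cos (x + v) * sin v\<bar>" by linarith
  also have "\<dots> \<le> \<bar>sin (x + v)\<bar> + \<bar>sin v\<bar>"
    unfolding abs_mult by (intro add_mono mult_left_le mult_left_le_one_le) auto
  finally have s1: "L * sin x \<le> L * \<bar>sin (x + v)\<bar> + L * \<bar>sin v\<bar>"
    by (metis distrib_left mult_left_mono of_nat_0_le_iff)
  have "\<bar>sin v\<bar> = \<bar>sin (heat_angle \<theta> y)\<bar>"
    using v by (auto simp: \<theta>_def)
  also have "\<dots> = sqrt (1 - exp (- y\<^sup>2 * \<theta>))" using \<theta>(1) by (simp add: heat_angle)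
  also have "\<dots> \<le> sqrt (y\<^sup>2 * \<theta>)"
    using exp_ge_add_one_self[of "- y\<^sup>2 * \<theta>"] by simp
  finally have "L * \<bar>sin v\<bar> \<le> L * sqrt (y\<^sup>2 * \<theta>)" by (simp add: mult_left_mono)
  also have "\<dots> = \<tau> * y"
    using \<tau> y L by (simp add: \<theta>_def real_sqrt_mult real_sqrt_divide)
  finally have s2: "L * \<bar>sin v\<bar> \<le> \<tau> * y" .
  have "(1 + u\<^sup>2 * \<theta>) * z \<le> exp (u\<^sup>2 * \<theta>) * z"
    using z by (intro mult_right_mono) (simp_all add: exp_ge_add_one_self)
  also have "\<dots> = 1" by (simp add: z_def exp_minus)
  finally have "u\<^sup>2 * \<theta> * z \<le> 1 - z" by (simp add: algebra_simps)
  then have "sqrt (u\<^sup>2 * \<theta> * z) \<le> sin x"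
    using \<theta>(1) by (simp add: x_def heat_angle z_def)
  then have "L * sqrt (u\<^sup>2 * \<theta> * z) \<le> L * sin x" by (simp add: mult_left_mono)
  moreover have "L * sqrt (u\<^sup>2 * \<theta> * z) = \<tau> * u * sqrt z"
    using \<tau> u L by (simp add: \<theta>_def real_sqrt_mult real_sqrt_divide)
  ultimately have s3: "\<tau> * u * sqrt z \<le> L * sin x" by simp
  have "sqrt z * e * (1 + \<tau> * u) = sqrt z * e + e * (\<tau> * u * sqrt z)" by (simp add: algebra_simps)
  also have "\<dots> \<le> 1 * 1 + e * (L * \<bar>sin (x + v)\<bar> + \<tau> * y)"
    using e1 z s1 s2 s3 \<tau> u by (intro add_mono mult_mono) auto
  also have "\<dots> \<le> 1 + (1 + 1 * (\<tau> * y))"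
    unfolding distrib_left using e2 e1 \<tau> y by (intro add_mono mult_right_mono) auto
  finally have "sqrt z * e \<le> (2 + \<tau> * y) / (1 + \<tau> * u)"
    using \<tau> u by (simp add: pos_le_divide_eq add_pos_nonneg)
  then have "(sqrt z * e) ^ (2 * R) \<le> ((2 + \<tau> * y) / (1 + \<tau> * u)) ^ (2 * R)"
    using z e1 by (intro power_mono) auto
  moreover have "(sqrt z * e) ^ (2 * R) = z ^ R * e ^ (2 * R)"
    using z by (simp add: power_mult_distrib power_mult)
  ultimately show ?thesis by (simp add: z_def e_def x_def \<theta>_def)
qed

text \<open>Up to absolute values the kernel is \<open>sinc (L * \<nu> L) / sinc (\<nu> L)\<close>,
  and \<open>\<nu> L\<close> tends to 0. For \<open>s = 0\<close> the sequence is required to vanish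
  identically, which avoids the quotient at 0; in the application the two heat angles then cancel
  for every \<open>L\<close>.\<close>

lemma tendsto_dirichlet_sinc:
  assumes \<nu>: "(\<lambda>L. real L * \<nu> L) \<longlonglongrightarrow> s" and 0: "s = 0 \<Longrightarrow> \<forall>L. \<nu> L = 0"
  shows "(\<lambda>L. norm (dirichlet L (\<nu> L)) / L) \<longlonglongrightarrow> \<bar>sinc s\<bar>"
proof (cases "s = 0")
  case True
  have "(\<lambda>L. norm (dirichlet L (\<nu> L)) / L) \<longlonglongrightarrow> 1"
    by (rule tendsto_eventually)
       (use 0 True in \<open>auto simp: norm_dirichlet_0 eventually_sequentially intro!: exI[of _ 1]\<close>)
  then show ?thesis using True by simp
next
  case False
  have "(\<lambda>L. real L * \<nu> L * inverse (real L)) \<longlonglongrightarrow> s * 0"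
    by (intro tendsto_mult \<nu> lim_inverse_n)
  moreover have "\<forall>\<^sub>F L in sequentially. real L * \<nu> L * inverse (real L) = \<nu> L"
    by (auto simp: eventually_sequentially intro!: exI[of _ 1])
  ultimately have \<nu>0: "\<nu> \<longlonglongrightarrow> 0" by (simp add: tendsto_cong)
  have ne: "\<forall>\<^sub>F L in sequentially. real L * \<nu> L \<noteq> 0"
    using tendsto_imp_eventually_ne[OF \<nu> False] .
  have "\<forall>\<^sub>F L in sequentially. sinc (\<nu> L) \<noteq> 0"
    by (rule tendsto_imp_eventually_ne[OF isCont_tendsto_compose[OF isCont_sinc \<nu>0]]) simp
  with ne have ev: "\<forall>\<^sub>F L in sequentially. \<bar>sinc (real L * \<nu> L)\<bar> / \<bar>sinc (\<nu> L)\<bar> = norm (dirichlet L (\<nu> L)) / L"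
  proof eventually_elim
    case (elim L)
    then have "sin (\<nu> L) \<noteq> 0" by auto
    then show ?case
      using norm_dirichlet_sin[of L "\<nu> L"] elim by (auto simp: field_simps abs_mult)
  qed
  have "(\<lambda>L. \<bar>sinc (real L * \<nu> L)\<bar> / \<bar>sinc (\<nu> L)\<bar>) \<longlonglongrightarrow> \<bar>sinc s\<bar> / \<bar>sinc 0\<bar>"
    by (intro tendsto_divide tendsto_rabs isCont_tendsto_compose[OF isCont_sinc] \<nu> \<nu>0) simp
  then have "(\<lambda>L. \<bar>sinc (real L * \<nu> L)\<bar> / \<bar>sinc (\<nu> L)\<bar>) \<longlonglongrightarrow> \<bar>sinc s\<bar>" by simp
  then show ?thesis using tendsto_cong[OF ev] by blast
qed

lemma tendsto_heat_angle:
  assumes "\<tau> > 0" "0 \<le> u"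
  shows "(\<lambda>L. real L * heat_angle (\<tau>\<^sup>2 / (real L)\<^sup>2) u) \<longlonglongrightarrow> \<tau> * u"
proof (cases "u = 0")
  case False
  with assms have "u > 0" by simp
  with assms(1) have "(\<lambda>L. real L * heat_angle (\<tau>\<^sup>2 / (real L)\<^sup>2) u) \<longlonglongrightarrow> (u\<^sup>2 * \<tau>\<^sup>2) powr (1 / 2)"
    unfolding heat_angle_def by real_asymp
  then show ?thesis
    using \<open>u > 0\<close> assms(1) by (simp add: powr_half_sqrt real_sqrt_mult mult.commute)
qed (simp add: heat_angle_def)

lemma heat_angle_measurable [measurable]: "heat_angle \<theta> \<in> borel_measurable borel"
  unfolding heat_angle_def by (intro borel_measurable_continuous_onI continuous_intros)

lemma dirichlet_measurable [measurable]: "dirichlet L \<in> borel_measurable borel"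
  unfolding dirichlet_def cis_conv_exp by (intro borel_measurable_continuous_onI continuous_intros)

text \<open>This is the heat kernel bound at one pair of points. At time
  \<open>t = k * \<theta>\<close> the integral is the \<open>k\<close>-th moment of
  \<open>z = exp (- u^2 \<theta>)\<close>, which is how the bound meets polynomials in
  \<open>z\<close>.\<close>

definition gauss_decay :: "'i measure \<Rightarrow> ('i \<Rightarrow> complex) \<Rightarrow> ('i \<Rightarrow> real) \<Rightarrow> real \<Rightarrow> real \<Rightarrow> real \<Rightarrow> real \<Rightarrow> bool" where
  "gauss_decay M a u c1 \<alpha> c2 d \<longleftrightarrow>
     (\<forall>t. 0 < t \<and> t \<le> 1 \<longrightarrow> norm (\<integral>i. a i * of_real (exp (- (u i)\<^sup>2 * t)) \<partial>M)
        \<le> c1 * t powr (- \<alpha>) * exp (- c2 * d\<^sup>2 / t))"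

section \<open>Finite propagation speed\<close>

text \<open>Only the order of decay matters: one exponential factor yields the order 2, so
  \<open>R\<close> factors yield the order \<open>2 * R \<ge> Q + 1\<close> needed for
  integrability.\<close>

lemma gauss_le_decay:
  fixes s x :: real
  assumes s: "s > 0" and x: "0 \<le> x"
  shows "exp (- x\<^sup>2 * s) \<le> ((s powr (- 1) + 2) * (1 / (1 + x))) ^ 2"
proof -
  have "(1 + x\<^sup>2 * s) * exp (- x\<^sup>2 * s) \<le> exp (x\<^sup>2 * s) * exp (- x\<^sup>2 * s)"
    by (intro mult_right_mono) (simp_all add: exp_ge_add_one_self)
  also have "\<dots> = 1" by (simp add: exp_minus)
  finally have *: "(1 + x\<^sup>2 * s) * exp (- x\<^sup>2 * s) \<le> 1" .
  have "(1 + x)\<^sup>2 \<le> (s powr (- 1) + 2)\<^sup>2 * (1 + x\<^sup>2 * s)"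
  proof -
    define t where "t = inverse (s)"
    have t: "t > 0" "t * s = 1" using s by (auto simp: t_def)
    have "(1 + x)\<^sup>2 \<le> 2 * (1 + x\<^sup>2)"
      using zero_le_power2[of "1 - x"] by (simp add: power2_eq_square algebra_simps)
    also have "x\<^sup>2 = t * (x\<^sup>2 * s)" using t by (simp add: mult_ac)
    also have "2 * (1 + t * (x\<^sup>2 * s)) \<le> (t + 2)\<^sup>2 * (1 + x\<^sup>2 * s)"
    proof -
      have "1 * 2 + (2 * t) * (x\<^sup>2 * s) \<le> 1 * (t + 2)\<^sup>2 + (t + 2)\<^sup>2 * (x\<^sup>2 * s)"
        using t s by (intro add_mono mult_right_mono) (auto simp: power2_eq_square algebra_simps)
      then show ?thesis by (simp add: algebra_simps)
    qed
    finally show ?thesis using s by (simp add: powr_minus t_def)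
  qed
  then have "(1 + x)\<^sup>2 * exp (- x\<^sup>2 * s) \<le> (s powr (- 1) + 2)\<^sup>2 * ((1 + x\<^sup>2 * s) * exp (- x\<^sup>2 * s))"
    by (metis exp_ge_zero mult.assoc mult_right_mono)
  also have "\<dots> \<le> (s powr (- 1) + 2)\<^sup>2 * 1"
    using * by (intro mult_left_mono) auto
  finally show "exp (- x\<^sup>2 * s) \<le> ((s powr (- 1) + 2) * (1 / (1 + x))) ^ 2"
    using x by (simp add: power_divide pos_le_divide_eq add_pos_nonneg mult.commute)
qed

text \<open>The constant \<open>9\<close> ensures that, for trigonometric degree \<open>M = R L\<close> and times up to
  \<open>2 M \<theta>\<close> with \<open>\<theta> = \<tau>\<^sup>2 / L\<^sup>2\<close>, the Gaussian factor beats the growth \<open>7^M\<close> of the coefficients.\<close>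

lemma gauss_decay_band_limited:
  assumes g: "poly_growth M a u c Q" and R: "2 * real R \<ge> Q + 1" "R \<ge> 1"
    and gd: "gauss_decay M a u c1 \<alpha> c2 d" and pos: "c1 > 0" "\<alpha> > 0"
    and \<tau>: "\<tau> > 0" "9 * (real R)\<^sup>2 * \<tau>\<^sup>2 \<le> c2 * d\<^sup>2" and y: "0 \<le> y"
  shows "(\<integral>i. a i * of_real (sinc (\<tau> * (u i - y)) ^ (2 * R) + sinc (\<tau> * (u i + y)) ^ (2 * R)) \<partial>M) = 0"
proof -
  have [measurable]: "a \<in> borel_measurable M" "u \<in> borel_measurable M"
    and u: "\<And>i. i \<in> space M \<Longrightarrow> 0 \<le> u i"
    using g by (auto simp: poly_growth_def)
  define \<theta> where "\<theta> L = \<tau>\<^sup>2 / (real L)\<^sup>2" for L :: nat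
  define w where "w L i = heat_angle (\<theta> L) (u i)" for L i
  define v where "v L = heat_angle (\<theta> L) y" for L
  \<comment> \<open>At stage \<open>L\<close> the test function is a polynomial in
    \<open>z = exp (- u^2 \<theta>)\<close> with degrees between \<open>R\<close> and
    \<open>R + R * L\<close>. Its pointwise limit is the band-limited function in \<open>f\<close>,
    and \<open>D\<close> is an integrable majorant.\<close>
  define s where "s L i = a i * of_real (exp (- (u i)\<^sup>2 * \<theta> L) ^ R *
    ((norm (dirichlet L (w L i - v L)) / L) ^ (2 * R) + (norm (dirichlet L (w L i + v L)) / L) ^ (2 * R)))" for L i
  define f where "f i = a i * of_real (sinc (\<tau> * (u i - y)) ^ (2 * R) + sinc (\<tau> * (u i + y)) ^ (2 * R))" for i
  define B where "B = 2 * ((2 + \<tau> * y) * (1 + 1 / \<tau>)) ^ (2 * R)"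
  define D where "D i = norm (a i * of_real (B * (1 / (1 + u i / 1)) ^ (2 * R)))" for i
  have [measurable]: "w L \<in> borel_measurable M" for L unfolding w_def by measurable
  have \<theta>0: "0 \<le> \<theta> L" for L by (simp add: \<theta>_def)

  have bound: "norm (s L i) \<le> D i" if i: "i \<in> space M" for L i
  proof (cases "L = 0")
    case True
    \<comment> \<open>At \<open>L = 0\<close> division by zero gives 0, so the majorant holds for
      every index without exception.\<close>
    then have "s L i = 0" using R by (simp add: s_def power_0_left)
    then show ?thesis by (simp add: D_def)
  next
    case False
    have p: "0 < \<tau>" "0 \<le> u i" using \<tau> u[OF i] by auto
    have k: "(2 + \<tau> * y) / (1 + \<tau> * u i) \<le> (2 + \<tau> * y) * (1 + 1 / \<tau>) * (1 / (1 + u i / 1))"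
    proof -
      have "1 + u i \<le> (1 + 1 / \<tau>) * (1 + \<tau> * u i)"
        using p by (simp add: field_simps)
      then have "(2 + \<tau> * y) * (1 + u i) \<le> (2 + \<tau> * y) * ((1 + 1 / \<tau>) * (1 + \<tau> * u i))"
        using p y by (intro mult_left_mono) auto
      moreover have "0 < 1 + \<tau> * u i" using p by (simp add: add_pos_nonneg)
      ultimately show ?thesis using p by (simp add: divide_simps mult_ac)
    qed
    have *: "exp (- (u i)\<^sup>2 * \<theta> L) ^ R * (norm (dirichlet L (w L i + x)) / L) ^ (2 * R)
        \<le> B / 2 * (1 / (1 + u i / 1)) ^ (2 * R)" if "x = v L \<or> x = - v L" for x
    proof -
      have "exp (- (u i)\<^sup>2 * \<theta> L) ^ R * (norm (dirichlet L (w L i + x)) / L) ^ (2 * R)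
          \<le> ((2 + \<tau> * y) / (1 + \<tau> * u i)) ^ (2 * R)"
        unfolding \<theta>_def w_def
        by (rule dirichlet_heat_angle_bound) (use False \<tau> y p that in \<open>auto simp: v_def \<theta>_def\<close>)
      also have "\<dots> \<le> ((2 + \<tau> * y) * (1 + 1 / \<tau>) * (1 / (1 + u i / 1))) ^ (2 * R)"
        using k p y by (intro power_mono) (auto intro!: divide_nonneg_nonneg add_nonneg_nonneg)
      finally show ?thesis unfolding B_def power_mult_distrib by simp
    qed
    have "norm (s L i) = norm (a i) * (exp (- (u i)\<^sup>2 * \<theta> L) ^ R * (norm (dirichlet L (w L i + - v L)) / L) ^ (2 * R)
        + exp (- (u i)\<^sup>2 * \<theta> L) ^ R * (norm (dirichlet L (w L i + v L)) / L) ^ (2 * R))"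
      unfolding s_def norm_mult norm_of_real by (simp add: distrib_left abs_mult)
    also have "\<dots> \<le> norm (a i) * (B / 2 * (1 / (1 + u i / 1)) ^ (2 * R) + B / 2 * (1 / (1 + u i / 1)) ^ (2 * R))"
      by (intro mult_left_mono add_mono *) auto
    also have "\<dots> = D i"
      using p y unfolding D_def norm_mult norm_of_real by (simp add: B_def abs_mult)
    finally show ?thesis .
  qed

  have lim: "(\<lambda>L. s L i) \<longlonglongrightarrow> f i" if i: "i \<in> space M" for i
  proof -
    have wl: "(\<lambda>L. real L * w L i) \<longlonglongrightarrow> \<tau> * u i"
      unfolding w_def \<theta>_def using tendsto_heat_angle[OF \<tau>(1) u[OF i]] .
    have vl: "(\<lambda>L. real L * v L) \<longlonglongrightarrow> \<tau> * y"
      unfolding v_def \<theta>_def using tendsto_heat_angle[OF \<tau>(1) y] .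
    have "(\<lambda>L. norm (dirichlet L (w L i - v L)) / L) \<longlonglongrightarrow> \<bar>sinc (\<tau> * (u i - y))\<bar>"
    proof (rule tendsto_dirichlet_sinc)
      show "(\<lambda>L. real L * (w L i - v L)) \<longlonglongrightarrow> \<tau> * (u i - y)"
        using tendsto_diff[OF wl vl] by (simp add: algebra_simps)
    qed (use \<tau>(1) in \<open>auto simp: w_def v_def\<close>)
    moreover have "(\<lambda>L. norm (dirichlet L (w L i + v L)) / L) \<longlonglongrightarrow> \<bar>sinc (\<tau> * (u i + y))\<bar>"
    proof (rule tendsto_dirichlet_sinc)
      show "(\<lambda>L. real L * (w L i + v L)) \<longlonglongrightarrow> \<tau> * (u i + y)"
        using tendsto_add[OF wl vl] by (simp add: algebra_simps)
      assume "\<tau> * (u i + y) = 0"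
      then have "u i = 0" "y = 0" using u[OF i] y \<tau>(1) by auto
      then show "\<forall>L. w L i + v L = 0" by (simp add: w_def v_def heat_angle_def)
    qed
    moreover have "(\<lambda>L. exp (- (u i)\<^sup>2 * \<theta> L)) \<longlonglongrightarrow> exp (- (u i)\<^sup>2 * 0)"
    proof (intro tendsto_intros)
      have "(\<lambda>L. \<tau>\<^sup>2 * (inverse (real L))\<^sup>2) \<longlonglongrightarrow> \<tau>\<^sup>2 * 0\<^sup>2"
        by (intro tendsto_intros lim_inverse_n)
      then show "\<theta> \<longlonglongrightarrow> 0" by (simp add: \<theta>_def[abs_def] power_inverse divide_inverse)
    qed
    ultimately have "(\<lambda>L. s L i) \<longlonglongrightarrow> a i * of_real (exp (- (u i)\<^sup>2 * 0) ^ R *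
        (\<bar>sinc (\<tau> * (u i - y))\<bar> ^ (2 * R) + \<bar>sinc (\<tau> * (u i + y))\<bar> ^ (2 * R)))"
      unfolding s_def by (intro tendsto_mult tendsto_const tendsto_power tendsto_of_real tendsto_add)
    then show ?thesis
      by (simp only: f_def power_even_abs even_mult_iff even_numeral simp_thms mult_zero_right exp_zero power_one mult_1)
  qed

  have Dint: "integrable M D"
    unfolding D_def using R u
    by (intro integrable_norm poly_growth_integrable(1)[OF g, where n=1 and m="2 * R" and K="\<bar>B\<bar>"])
       (auto simp: norm_mult norm_divide norm_power abs_mult simp del: of_real_power of_real_add of_real_divide of_real_mult intro!: divide_left_mono)
  have conv: "(\<lambda>L. integral\<^sup>L M (s L)) \<longlonglongrightarrow> integral\<^sup>L M f"
  proof (rule integral_dominated_convergence[where w = D])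
    show "f \<in> borel_measurable M" unfolding f_def by measurable
    show "s L \<in> borel_measurable M" for L unfolding s_def by measurable
  qed (use Dint lim bound in \<open>auto simp del: of_nat_mult\<close>)

  define E where "E L = 2 * 7 ^ (R * L) * (c1 * \<theta> L powr (- \<alpha>) * exp (- c2 * d\<^sup>2 / (2 * real R * \<tau>\<^sup>2 / real L)))" for L :: nat
  \<comment> \<open>The longest heat time involved is at most \<open>2 * R * \<tau>^2 / L\<close>,
    which tends to 0; eventually all times lie in \<open>(0, 1]\<close>, where the Gaussian bound is
    available.\<close>
  have small: "\<forall>\<^sub>F L in sequentially. norm (integral\<^sup>L M (s L)) \<le> E L"
  proof -
    have "(\<lambda>L. 2 * real R * \<tau>\<^sup>2 / real L) \<longlonglongrightarrow> 0" by real_asymp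
    then have "\<forall>\<^sub>F L in sequentially. 2 * real R * \<tau>\<^sup>2 / real L < 1"
      by (rule order_tendstoD) simp
    then show ?thesis
      using eventually_gt_at_top[of 0]
    proof eventually_elim
      case (elim L)
      have \<theta>p: "0 < \<theta> L" using elim \<tau> by (simp add: \<theta>_def)
      have "norm (integral\<^sup>L M (s L)) \<le> 2 * 7 ^ (R * L) *
           (c1 * \<theta> L powr (- \<alpha>) * exp (- c2 * d\<^sup>2 / (2 * real R * \<tau>\<^sup>2 / real L)))"
        unfolding s_def
      proof (rule integral_dirichlet_bound)
        fix k assume k: "k \<ge> R"
        have "norm (complex_of_real (exp (- (u i)\<^sup>2 * \<theta> L) ^ k)) \<le> (\<theta> L powr (- 1) + 2) ^ (2 * R) * (1 / (1 + u i / 1)) ^ (2 * R)"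
          if i: "i \<in> space M" for i
        proof -
          have "exp (- (u i)\<^sup>2 * \<theta> L) ^ k \<le> exp (- (u i)\<^sup>2 * \<theta> L) ^ R"
            using k \<theta>0[of L] by (intro power_decreasing) auto
          also have "\<dots> \<le> (((\<theta> L powr (- 1) + 2) * (1 / (1 + u i / 1))) ^ 2) ^ R"
          proof (intro power_mono)
            show "exp (- (u i)\<^sup>2 * \<theta> L) \<le> ((\<theta> L powr (- 1) + 2) * (1 / (1 + u i / 1))) ^ 2"
              using gauss_le_decay[OF \<theta>p u[OF i]] by simp
          qed auto
          also have "\<dots> = (\<theta> L powr (- 1) + 2) ^ (2 * R) * (1 / (1 + u i / 1)) ^ (2 * R)"
            by (simp only: power_mult power_mult_distrib)
          finally show ?thesis unfolding norm_of_real by (simp only: abs_of_nonneg zero_le_power exp_ge_zero)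
        qed
        then show "integrable M (\<lambda>i. a i * of_real (exp (- (u i)\<^sup>2 * \<theta> L) ^ k))"
          using R by (intro poly_growth_integrable(1)[OF g, where n=1 and m="2 * R"]) auto
      next
        fix k assume k: "R \<le> k" "k \<le> R + R * L"
        have kp: "k \<ge> 1" using k R by simp
        have "real k \<le> real (R + R * L)" using k by (simp only: of_nat_le_iff)
        also have "\<dots> \<le> 2 * (real R * real L)" using elim R by (simp add: algebra_simps)
        finally have "real k * \<theta> L \<le> 2 * (real R * real L) * \<theta> L" using \<theta>p by (simp add: mult_right_mono)
        also have "\<dots> = 2 * real R * \<tau>\<^sup>2 / real L" using elim by (simp add: \<theta>_def power2_eq_square)
        finally have kt: "real k * \<theta> L \<le> 2 * real R * \<tau>\<^sup>2 / real L" .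
        have kt0: "0 < real k * \<theta> L" using kp \<theta>p by simp
        have "norm (\<integral>i. a i * of_real (exp (- (u i)\<^sup>2 * (real k * \<theta> L))) \<partial>M)
            \<le> c1 * (real k * \<theta> L) powr (- \<alpha>) * exp (- c2 * d\<^sup>2 / (real k * \<theta> L))"
        proof -
          have "real k * \<theta> L \<le> 1" using kt elim(1) by linarith
          then show ?thesis using gd kt0 unfolding gauss_decay_def by blast
        qed
        also have "\<dots> \<le> c1 * \<theta> L powr (- \<alpha>) * exp (- c2 * d\<^sup>2 / (2 * real R * \<tau>\<^sup>2 / real L))"
        proof (intro mult_mono)
          show "(real k * \<theta> L) powr (- \<alpha>) \<le> \<theta> L powr (- \<alpha>)"
            using kp \<theta>p pos by (intro powr_mono2') auto
          have "0 \<le> c2 * d\<^sup>2" using \<tau>(2) by (meson order_trans zero_le_mult_iff zero_le_numeral zero_le_power2)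
          then have "c2 * d\<^sup>2 / (2 * real R * \<tau>\<^sup>2 / real L) \<le> c2 * d\<^sup>2 / (real k * \<theta> L)"
            using mult_pos_pos[OF less_le_trans[OF kt0 kt] kt0] by (rule divide_left_mono[OF kt])
          then show "exp (- c2 * d\<^sup>2 / (real k * \<theta> L)) \<le> exp (- c2 * d\<^sup>2 / (2 * real R * \<tau>\<^sup>2 / real L))"
            by simp
        qed (use pos in auto)
        also have "(\<lambda>i. a i * of_real (exp (- (u i)\<^sup>2 * (real k * \<theta> L)))) = (\<lambda>i. a i * of_real (exp (- (u i)\<^sup>2 * \<theta> L) ^ k))"
          by (simp add: exp_of_nat_mult[symmetric] mult_ac)
        finally show "norm (\<integral>i. a i * of_real (exp (- (u i)\<^sup>2 * \<theta> L) ^ k) \<partial>M)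
          \<le> c1 * \<theta> L powr (- \<alpha>) * exp (- c2 * d\<^sup>2 / (2 * real R * \<tau>\<^sup>2 / real L))" .
      next
        show "cos (2 * w L i) = 2 * exp (- (u i)\<^sup>2 * \<theta> L) - 1" for i
          unfolding w_def by (rule heat_angle(2)[OF \<theta>0])
      qed (use elim in \<open>auto simp: w_def\<close>)
      then show ?case by (simp add: E_def)
    qed
  qed
  have E0: "E \<longlonglongrightarrow> 0"
  proof (rule tendsto_sandwich)
    show "\<forall>\<^sub>F L in sequentially. 0 \<le> E L" using pos by (auto simp: E_def)
    show "\<forall>\<^sub>F L in sequentially. E L \<le> 2 * c1 * ((\<tau>\<^sup>2 / (real L)\<^sup>2) powr (- \<alpha>) * exp (- real L / 2))"
      using eventually_gt_at_top[of 0]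
    proof eventually_elim
      case (elim L)
      \<comment> \<open>Here \<open>7 \<le> 2^4 \<le> e^4\<close>. The hypothesis on \<tau> gives a
        Gaussian exponent of at least \<open>9/2 * R * L\<close>, so at least
        \<open>R * L / 2\<close> is left over, and \<open>exp (- L / 2)\<close> beats the power of
        \<open>L\<close> hidden in \<open>\<theta> L powr (- \<alpha>)\<close>.\<close>
      have "(7::real) ^ (R * L) \<le> exp 4 ^ (R * L)"
      proof (intro power_mono)
        have "(2::real) ^ 4 \<le> exp 1 ^ 4" using exp_ge_add_one_self[of 1] by (intro power_mono) auto
        then show "7 \<le> exp (4::real)" by (simp add: exp_of_nat_mult[symmetric])
      qed auto
      also have "\<dots> = exp (4 * (real R * real L))" by (simp add: exp_of_nat_mult[symmetric] mult_ac)
      finally have 1: "(7::real) ^ (R * L) \<le> exp (4 * (real R * real L))" .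
      have "9 / 2 * (real R * real L) * (2 * real R * \<tau>\<^sup>2 / real L) \<le> c2 * d\<^sup>2"
        using \<tau>(2) elim by (simp add: power2_eq_square mult_ac)
      moreover have "0 < 2 * real R * \<tau>\<^sup>2 / real L" using elim R \<tau>(1) by simp
      ultimately have 2: "9 / 2 * (real R * real L) \<le> c2 * d\<^sup>2 / (2 * real R * \<tau>\<^sup>2 / real L)"
        by (subst pos_le_divide_eq) auto
      have 3: "real L \<le> real R * real L" using R mult_right_mono[of 1 "real R" "real L"] by simp
      have "7 ^ (R * L) * exp (- c2 * d\<^sup>2 / (2 * real R * \<tau>\<^sup>2 / real L))
          \<le> exp (4 * (real R * real L)) * exp (- (9 / 2 * (real R * real L)))"
        using 1 2 by (intro mult_mono) auto
      also have "\<dots> \<le> exp (- real L / 2)"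
        unfolding exp_add[symmetric] using 3 by (simp add: algebra_simps)
      finally have 4: "7 ^ (R * L) * exp (- c2 * d\<^sup>2 / (2 * real R * \<tau>\<^sup>2 / real L)) \<le> exp (- real L / 2)" .
      have "E L = 2 * c1 * \<theta> L powr (- \<alpha>) * (7 ^ (R * L) * exp (- c2 * d\<^sup>2 / (2 * real R * \<tau>\<^sup>2 / real L)))"
        by (simp add: E_def)
      also have "\<dots> \<le> 2 * c1 * \<theta> L powr (- \<alpha>) * exp (- real L / 2)"
        using 4 pos by (intro mult_left_mono) auto
      finally show ?case by (simp add: \<theta>_def)
    qed
    have "(\<lambda>L::nat. (\<tau>\<^sup>2 / (real L)\<^sup>2) powr (- \<alpha>) * exp (- real L / 2)) \<longlonglongrightarrow> 0"
      using \<tau>(1) pos(2) by real_asymp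
    then show "(\<lambda>L::nat. 2 * c1 * ((\<tau>\<^sup>2 / (real L)\<^sup>2) powr (- \<alpha>) * exp (- real L / 2))) \<longlonglongrightarrow> 0"
      by (rule tendsto_mult_right_zero)
  qed auto
  have "(\<lambda>L. integral\<^sup>L M (s L)) \<longlonglongrightarrow> 0"
    by (rule Lim_null_comparison[OF small E0])
  with conv have "integral\<^sup>L M f = 0" by (rule LIMSEQ_unique)
  then show ?thesis by (simp add: f_def[abs_def])
qed

section \<open>Finite differences of smooth filters\<close>

primrec bdiff :: "nat \<Rightarrow> real \<Rightarrow> (real \<Rightarrow> real) \<Rightarrow> real \<Rightarrow> real" where
  "bdiff 0 s f u = f u"
| "bdiff (Suc r) s f u = bdiff r s f u - bdiff r s f (u - s)"

text \<open>The coefficients depend neither on the step nor on the function or the point, so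
  differences pass through integrals. The value \<open>c 0 = 1\<close> later singles out the
  function itself among its translates.\<close>

lemma bdiff_coeffs:
  "\<exists>c. c 0 = 1 \<and> (\<forall>s f u. bdiff r s f u = (\<Sum>j\<le>r. c j * f (u - real j * s)))"
proof -
  have "\<exists>c. c 0 = 1 \<and> (\<forall>j>r. c j = 0) \<and> (\<forall>s f u. bdiff r s f u = (\<Sum>j\<le>r. c j * f (u - real j * s)))"
  proof (induction r)
    case 0
    show ?case by (intro exI[of _ "\<lambda>j. if j = 0 then 1 else 0"]) auto
  next
    case (Suc r)
    then obtain c where c: "c 0 = (1::real)" "\<And>j. j > r \<Longrightarrow> c j = 0"
      "\<And>s f u. bdiff r s f u = (\<Sum>j\<le>r. c j * f (u - real j * s))" by blast
    define c' where "c' j = c j - (if j = 0 then 0 else c (j - 1))" for j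
    have "bdiff (Suc r) s f u = (\<Sum>j\<le>Suc r. c' j * f (u - real j * s))" for s f u
    proof -
      have "(\<Sum>j\<le>Suc r. (if j = 0 then 0 else c (j - 1)) * f (u - real j * s))
          = (\<Sum>j\<le>r. c j * f (u - s - real j * s))"
        by (subst sum.atMost_Suc_shift) (simp add: algebra_simps)
      moreover have "(\<Sum>j\<le>Suc r. c j * f (u - real j * s)) = (\<Sum>j\<le>r. c j * f (u - real j * s))"
        by (simp add: c(2))
      ultimately show ?thesis
        by (simp only: bdiff.simps c(3) c'_def left_diff_distrib sum_subtractf)
    qed
    then show ?case using c by (intro exI[of _ c']) (auto simp: c'_def)
  qed
  then show ?thesis by blast
qed

lemma bdiff_linear:
  "bdiff r s (\<lambda>x. \<alpha> * f x + \<beta> * g x) u = \<alpha> * bdiff r s f u + \<beta> * bdiff r s g u"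
  by (induction r arbitrary: u) (auto simp: algebra_simps)

lemma bdiff_has_derivative:
  assumes "\<And>x. (f has_real_derivative f' x) (at x)"
  shows "(bdiff r s f has_real_derivative bdiff r s f' x) (at x)"
proof (induction r arbitrary: x)
  case 0
  have "bdiff 0 s f = f" for f by (rule ext) simp
  then show ?case using assms by simp
next
  case (Suc r)
  have "((\<lambda>x. bdiff r s f (x - s)) has_real_derivative bdiff r s f' (x - s) * 1) (at x)"
    by (rule DERIV_chain2[OF Suc]) (auto intro!: derivative_eq_intros)
  then show ?case
    using Suc[of x] by (auto intro!: derivative_eq_intros)
qed

section \<open>Truncated powers and their differences\<close>

lemma pos_part_power_has_derivative:
  fixes x :: real
  assumes "n \<ge> 2"
  shows "((\<lambda>x. max 0 x ^ n) has_real_derivative real n * max 0 x ^ (n - 1)) (at x)"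
proof -
  consider "x > 0" | "x < 0" | "x = 0" by linarith
  then show ?thesis
  proof cases
    case 1
    have "((\<lambda>x. x ^ n) has_real_derivative real n * x ^ (n - 1)) (at x)"
      by (auto intro!: derivative_eq_intros)
    then show ?thesis
      using 1 by (rule_tac has_field_derivative_transform_within[where d=x and f="\<lambda>x. x ^ n"])
        (auto simp: dist_real_def max_def)
  next
    case 2
    show ?thesis
      using 2 assms by (rule_tac has_field_derivative_transform_within[where d="-x" and f="\<lambda>x. 0"])
        (auto simp: dist_real_def max_def power_0_left)
  next
    case 3
    have "(\<lambda>h. (max 0 (0 + h) ^ n - max 0 0 ^ n) / h) \<midarrow>0\<rightarrow> (0::real)"
    proof (rule Lim_null_comparison)
      show "\<forall>\<^sub>F h in at (0::real). norm ((max 0 (0 + h) ^ n - max 0 0 ^ n) / h) \<le> \<bar>h\<bar>"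
        unfolding eventually_at
      proof (intro exI[of _ 1] conjI ballI impI)
        fix h :: real assume h: "h \<noteq> 0 \<and> dist h 0 < 1"
        have "max 0 h ^ n \<le> \<bar>h\<bar> ^ n" by (intro power_mono) auto
        also have "\<dots> \<le> \<bar>h\<bar> ^ 2" using h assms by (intro power_decreasing) (auto simp: dist_real_def)
        finally show "norm ((max 0 (0 + h) ^ n - max 0 0 ^ n) / h) \<le> \<bar>h\<bar>"
          using h assms by (simp add: power_0_left divide_le_eq power2_eq_square)
      qed simp
      show "((\<lambda>h. \<bar>h\<bar>) \<longlongrightarrow> (0::real)) (at 0)" by (rule tendsto_rabs_zero) (rule tendsto_ident_at)
    qed
    then show ?thesis using 3 assms by (simp add: DERIV_def power_0_left)
  qed
qed

definition two_sided_power :: "real \<Rightarrow> nat \<Rightarrow> nat \<Rightarrow> real \<Rightarrow> real" where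
  "two_sided_power v a b u = max 0 (v - u) ^ a * max 0 (v + u) ^ b"

lemma two_sided_power_has_derivative:
  assumes "a \<ge> 2" "b \<ge> 2"
  shows "(two_sided_power v a b has_real_derivative
     (- real a) * two_sided_power v (a - 1) b u + real b * two_sided_power v a (b - 1) u) (at u)"
proof -
  have "((\<lambda>u. max 0 (v - u) ^ a) has_real_derivative real a * max 0 (v - u) ^ (a - 1) * (- 1)) (at u)"
    by (rule DERIV_chain2[OF pos_part_power_has_derivative[OF assms(1)]])
       (auto intro!: derivative_eq_intros)
  moreover have "((\<lambda>u. max 0 (v + u) ^ b) has_real_derivative real b * max 0 (v + u) ^ (b - 1) * 1) (at u)"
    by (rule DERIV_chain2[OF pos_part_power_has_derivative[OF assms(2)]])
       (auto intro!: derivative_eq_intros)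
  ultimately show ?thesis
    unfolding two_sided_power_def[abs_def] by (rule DERIV_cong[OF DERIV_mult]) simp
qed

lemma power_diff_le:
  fixes x y B :: real
  assumes "0 \<le> x" "x \<le> B" "0 \<le> y" "y \<le> B"
  shows "\<bar>x ^ n - y ^ n\<bar> \<le> real n * B ^ (n - 1) * \<bar>x - y\<bar>"
proof (induction n)
  case (Suc n)
  have B: "0 \<le> B" using assms by linarith
  have "x ^ Suc n - y ^ Suc n = x * (x ^ n - y ^ n) + (x - y) * y ^ n" by (simp add: algebra_simps)
  then have "\<bar>x ^ Suc n - y ^ Suc n\<bar> \<le> x * \<bar>x ^ n - y ^ n\<bar> + \<bar>x - y\<bar> * y ^ n"
    using assms abs_triangle_ineq[of "x * (x ^ n - y ^ n)" "(x - y) * y ^ n"] by (simp add: abs_mult)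
  also have "\<dots> \<le> B * (real n * B ^ (n - 1) * \<bar>x - y\<bar>) + \<bar>x - y\<bar> * B ^ n"
    using assms B Suc by (intro add_mono mult_mono power_mono) auto
  also have "B * (real n * B ^ (n - 1) * \<bar>x - y\<bar>) = real n * B ^ n * \<bar>x - y\<bar>"
    by (cases n) auto
  finally show ?case by (simp add: algebra_simps)
qed simp

text \<open>The function vanishes outside \<open>[- v, v]\<close>, so its argument may be clamped to
  this interval by \<open>k\<close>. There both factors \<open>p\<close> and \<open>q\<close> lie
  between 0 and \<open>2 * v\<close> and have Lipschitz constant 1.\<close>

lemma two_sided_power_lipschitz:
  assumes ab: "a \<ge> 1" "b \<ge> 1" and v: "0 \<le> v"
  shows "\<bar>two_sided_power v a b x - two_sided_power v a b y\<bar>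
     \<le> real (a + b) * (2 * v) ^ (a + b - 1) * \<bar>x - y\<bar>"
proof -
  define k where "k u = max (- v) (min v u)" for u
  define p q where "p u = v - k u" and "q u = v + k u" for u
  have k: "- v \<le> k u" "k u \<le> v" for u using v by (auto simp: k_def)
  have eq: "two_sided_power v a b u = p u ^ a * q u ^ b" for u
  proof -
    consider "u < - v" | "u > v" | "- v \<le> u" "u \<le> v" by linarith
    then show ?thesis
      using ab v by cases (auto simp: two_sided_power_def p_def q_def k_def power_0_left max_def min_def)
  qed
  have pq: "0 \<le> p u" "p u \<le> 2 * v" "0 \<le> q u" "q u \<le> 2 * v" for u
    using k[of u] by (auto simp: p_def q_def)
  have d: "\<bar>p x - p y\<bar> \<le> \<bar>x - y\<bar>" "\<bar>q x - q y\<bar> \<le> \<bar>x - y\<bar>"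
    by (auto simp: p_def q_def k_def)
  have "p x ^ a * q x ^ b - p y ^ a * q y ^ b = (p x ^ a - p y ^ a) * q x ^ b + p y ^ a * (q x ^ b - q y ^ b)"
    by (simp add: algebra_simps)
  then have "\<bar>p x ^ a * q x ^ b - p y ^ a * q y ^ b\<bar> \<le> \<bar>p x ^ a - p y ^ a\<bar> * q x ^ b + p y ^ a * \<bar>q x ^ b - q y ^ b\<bar>"
    using abs_triangle_ineq[of "(p x ^ a - p y ^ a) * q x ^ b" "p y ^ a * (q x ^ b - q y ^ b)"] pq
    by (simp add: abs_mult)
  also have "\<dots> \<le> (real a * (2 * v) ^ (a - 1) * \<bar>x - y\<bar>) * (2 * v) ^ b + (2 * v) ^ a * (real b * (2 * v) ^ (b - 1) * \<bar>x - y\<bar>)"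
    using v pq d
    by (intro add_mono mult_mono power_mono order.trans[OF power_diff_le[where B="2 * v"]] order.refl) auto
  also have "\<dots> = real a * ((2 * v) ^ (a - 1) * (2 * v) ^ b) * \<bar>x - y\<bar> + real b * ((2 * v) ^ a * (2 * v) ^ (b - 1)) * \<bar>x - y\<bar>"
    by (simp add: mult_ac)
  also have "\<dots> = real (a + b) * (2 * v) ^ (a + b - 1) * \<bar>x - y\<bar>"
    using ab unfolding power_add[symmetric] by (simp add: algebra_simps)
  finally show ?thesis by (simp add: eq)
qed

text \<open>By the mean value inequality a difference costs one derivative, which lowers one
  exponent. After \<open>r\<close> derivatives an exponent may be 1, where the function has a kink,
  so the last difference uses the Lipschitz bound instead. In this way exponents \<open>S\<close>
  carry a full \<open>S\<close> differences.\<close>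

lemma bdiff_two_sided_power:
  assumes "a \<ge> Suc r" "b \<ge> Suc r"
  shows "\<exists>K\<ge>0. \<forall>v\<ge>0. \<forall>s u. \<bar>bdiff (Suc r) s (two_sided_power v a b) u\<bar> \<le> K * v ^ (a + b - Suc r) * \<bar>s\<bar> ^ Suc r"
  using assms
proof (induction r arbitrary: a b)
  case 0
  show ?case
  proof (intro exI[of _ "real (a + b) * 2 ^ (a + b - 1)"] conjI allI impI)
    fix v s u :: real assume "0 \<le> v"
    then show "\<bar>bdiff (Suc 0) s (two_sided_power v a b) u\<bar> \<le> real (a + b) * 2 ^ (a + b - 1) * v ^ (a + b - Suc 0) * \<bar>s\<bar> ^ Suc 0"
      using two_sided_power_lipschitz[of a b v u "u - s"] 0 by (simp add: power_mult_distrib)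
  qed simp
next
  case (Suc r)
  obtain K1 where K1: "K1 \<ge> 0" "\<And>v s u. v \<ge> 0 \<Longrightarrow>
      \<bar>bdiff (Suc r) s (two_sided_power v (a - 1) b) u\<bar> \<le> K1 * v ^ (a - 1 + b - Suc r) * \<bar>s\<bar> ^ Suc r"
  proof -
    have "Suc r \<le> a - 1" "Suc r \<le> b" using Suc.prems by auto
    from Suc.IH[OF this] show ?thesis using that by blast
  qed
  obtain K2 where K2: "K2 \<ge> 0" "\<And>v s u. v \<ge> 0 \<Longrightarrow>
      \<bar>bdiff (Suc r) s (two_sided_power v a (b - 1)) u\<bar> \<le> K2 * v ^ (a + (b - 1) - Suc r) * \<bar>s\<bar> ^ Suc r"
  proof -
    have "Suc r \<le> a" "Suc r \<le> b - 1" using Suc.prems by auto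
    from Suc.IH[OF this] show ?thesis using that by blast
  qed
  have e: "a - 1 + b - Suc r = a + b - Suc (Suc r)" "a + (b - 1) - Suc r = a + b - Suc (Suc r)"
    using Suc.prems by auto
  show ?case
  proof (intro exI[of _ "real a * K1 + real b * K2"] conjI allI impI)
    fix v s u :: real assume v: "0 \<le> v"
    let ?f = "two_sided_power v a b"
    let ?f' = "\<lambda>u. (- real a) * two_sided_power v (a - 1) b u + real b * two_sided_power v a (b - 1) u"
    let ?w = "v ^ (a + b - Suc (Suc r)) * \<bar>s\<bar> ^ Suc r"
    have der: "(bdiff (Suc r) s ?f has_real_derivative bdiff (Suc r) s ?f' x) (at x)" for x
      using Suc.prems by (intro bdiff_has_derivative two_sided_power_has_derivative) auto
    have b': "\<bar>bdiff (Suc r) s ?f' x\<bar> \<le> (real a * K1 + real b * K2) * ?w" for x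
    proof -
      have "\<bar>bdiff (Suc r) s ?f' x\<bar> \<le> real a * \<bar>bdiff (Suc r) s (two_sided_power v (a - 1) b) x\<bar>
          + real b * \<bar>bdiff (Suc r) s (two_sided_power v a (b - 1)) x\<bar>"
        unfolding bdiff_linear
        using abs_triangle_ineq[of "- real a * bdiff (Suc r) s (two_sided_power v (a - 1) b) x"
            "real b * bdiff (Suc r) s (two_sided_power v a (b - 1)) x"] by (simp add: abs_mult del: bdiff.simps)
      also have "\<dots> \<le> real a * (K1 * v ^ (a - 1 + b - Suc r) * \<bar>s\<bar> ^ Suc r) + real b * (K2 * v ^ (a + (b - 1) - Suc r) * \<bar>s\<bar> ^ Suc r)"
        by (intro add_mono mult_left_mono K1 K2 v) auto
      also have "\<dots> = (real a * K1 + real b * K2) * ?w"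
        unfolding e by (simp add: algebra_simps del: power_Suc)
      finally show ?thesis .
    qed
    have "norm (bdiff (Suc r) s ?f u - bdiff (Suc r) s ?f (u - s)) \<le> (real a * K1 + real b * K2) * ?w * norm (u - (u - s))"
      by (rule field_differentiable_bound[where S=UNIV and f'="bdiff (Suc r) s ?f'"])
         (use der b' in \<open>simp_all only: real_norm_def convex_UNIV UNIV_I\<close>)
    then show "\<bar>bdiff (Suc (Suc r)) s ?f u\<bar> \<le> (real a * K1 + real b * K2) * v ^ (a + b - Suc (Suc r)) * \<bar>s\<bar> ^ Suc (Suc r)"
      by (simp add: mult_ac)
  qed (use K1 K2 in auto)
qed

text \<open>Differences are taken under the integral sign. The moment of order \<open>S\<close> of
  the two measures bounds the differences, and the moment of order \<open>2 * S\<close> makes the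
  representing integrals converge. Evenness extends the representation to negative arguments, which
  is needed because differences cross the origin.\<close>

lemma sufficiently_smooth_bdiff:
  assumes h: "sufficiently_smooth q1 q2 Q h" "low_pass_filter h"
    and Q: "Q > 0" and q: "q1 > 0"
  shows "\<exists>S H. real S > max q1 q2 \<and> H \<ge> 0 \<and> (\<forall>s u. \<bar>bdiff S s h u\<bar> \<le> H * \<bar>s\<bar> ^ S)"
proof -
  obtain S :: nat and \<nu> \<nu>' where S: "real S > max (max q1 q2) (Q + 1)" and jp: "jordan_pair \<nu> \<nu>'"
    and rep: "\<And>u. u \<ge> 0 \<Longrightarrow> h u = (\<integral>v. (max 0 (v\<^sup>2 - u\<^sup>2)) ^ S \<partial>\<nu>) - (\<integral>v. (max 0 (v\<^sup>2 - u\<^sup>2)) ^ S \<partial>\<nu>')"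
    and fin: "(\<integral>\<^sup>+v. ennreal ((v + 2) powr Q * (v ^ S + v ^ (2 * S))) \<partial>\<nu>) +
       (\<integral>\<^sup>+v. ennreal ((v + 2) powr Q * (v ^ S + v ^ (2 * S))) \<partial>\<nu>') < \<infinity>"
    using h(1) unfolding sufficiently_smooth_def by blast
  have even: "h (- u) = h u" for u using h(2) by (auto simp: low_pass_filter_def)
  obtain r where r: "S = Suc r" using S Q by (cases S) auto
  obtain K where K: "K \<ge> 0" "\<And>v s u. v \<ge> 0 \<Longrightarrow> \<bar>bdiff S s (two_sided_power v S S) u\<bar> \<le> K * v ^ S * \<bar>s\<bar> ^ S"
    using bdiff_two_sided_power[of r S S] unfolding r by auto
  obtain c where c: "\<And>s f u. bdiff S s f u = (\<Sum>j\<le>S. c j * f (u - real j * s))"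
    using bdiff_coeffs[of S] by blast
  have part: "integrable N (\<lambda>v. v ^ S) \<and> (\<forall>u. integrable N (\<lambda>v. two_sided_power v S S u)) \<and>
      (\<forall>s u. \<bar>bdiff S s (\<lambda>u. \<integral>v. two_sided_power v S S u \<partial>N) u\<bar> \<le> K * (\<integral>v. v ^ S \<partial>N) * \<bar>s\<bar> ^ S)"
    if sets: "sets N = sets (restrict_space borel {0..})"
      and f: "(\<integral>\<^sup>+v. ennreal ((v + 2) powr Q * (v ^ S + v ^ (2 * S))) \<partial>N) < \<infinity>" for N :: "real measure"
  proof -
    have meas: "g \<in> borel_measurable N" if "g \<in> borel_measurable borel" for g :: "real \<Rightarrow> real"
      using measurable_restrict_space1[OF that] measurable_cong_sets[OF sets refl] by blast
    have sp: "v \<ge> 0" if "v \<in> space N" for v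
      using that sets_eq_imp_space_eq[OF sets] by (auto simp: space_restrict_space)
    have int: "integrable N g" if g: "g \<in> borel_measurable borel"
      and b: "\<And>v. v \<ge> 0 \<Longrightarrow> \<bar>g v\<bar> \<le> v ^ S + v ^ (2 * S)" for g :: "real \<Rightarrow> real"
    proof (rule integrableI_bounded)
      show "g \<in> borel_measurable N" by (rule meas[OF g])
      have "(\<integral>\<^sup>+ v. ennreal (norm (g v)) \<partial>N) \<le> (\<integral>\<^sup>+v. ennreal ((v + 2) powr Q * (v ^ S + v ^ (2 * S))) \<partial>N)"
      proof (intro nn_integral_mono ennreal_leI)
        fix v assume "v \<in> space N"
        then have v: "v \<ge> 0" by (rule sp)
        have "1 * (v ^ S + v ^ (2 * S)) \<le> (v + 2) powr Q * (v ^ S + v ^ (2 * S))"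
          using v Q by (intro mult_right_mono ge_one_powr_ge_zero) auto
        then show "norm (g v) \<le> (v + 2) powr Q * (v ^ S + v ^ (2 * S))" using b[OF v] by simp
      qed
      then show "(\<integral>\<^sup>+ v. ennreal (norm (g v)) \<partial>N) < \<infinity>" using f by (rule le_less_trans)
    qed
    have i1: "integrable N (\<lambda>v. v ^ S)" by (rule int) auto
    have i2: "integrable N (\<lambda>v. two_sided_power v S S u)" for u
    proof (rule int)
      show "(\<lambda>v. two_sided_power v S S u) \<in> borel_measurable borel"
        unfolding two_sided_power_def by measurable
      fix v :: real assume v: "v \<ge> 0"
      have "two_sided_power v S S u = (max 0 (v - u) * max 0 (v + u)) ^ S"
        by (simp add: two_sided_power_def power_mult_distrib)
      moreover have "max 0 (v - u) * max 0 (v + u) \<le> v\<^sup>2"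
        using v by (auto simp: max_def power2_eq_square algebra_simps)
      ultimately have "\<bar>two_sided_power v S S u\<bar> \<le> v ^ (2 * S)"
        by (simp add: power_mult power_mono)
      then show "\<bar>two_sided_power v S S u\<bar> \<le> v ^ S + v ^ (2 * S)" using v by (simp add: add_increasing)
    qed
    have "\<bar>bdiff S s (\<lambda>u. \<integral>v. two_sided_power v S S u \<partial>N) u\<bar> \<le> K * (\<integral>v. v ^ S \<partial>N) * \<bar>s\<bar> ^ S" for s u
    proof -
      have e: "bdiff S s (\<lambda>u. \<integral>v. two_sided_power v S S u \<partial>N) u = (\<integral>v. bdiff S s (two_sided_power v S S) u \<partial>N)"
        unfolding c
        by (subst Bochner_Integration.integral_sum, intro integrable_mult_right i2)
           (simp only: integral_mult_right_zero)
      have ib: "integrable N (\<lambda>v. bdiff S s (two_sided_power v S S) u)"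
        unfolding c by (intro Bochner_Integration.integrable_sum integrable_mult_right i2)
      have "norm (\<integral>v. bdiff S s (two_sided_power v S S) u \<partial>N) \<le> (\<integral>v. norm (bdiff S s (two_sided_power v S S) u) \<partial>N)"
        by (rule integral_norm_bound)
      also have "\<dots> \<le> (\<integral>v. (K * \<bar>s\<bar> ^ S) * v ^ S \<partial>N)"
        using K(2)[OF sp] ib i1 by (intro integral_mono integrable_norm integrable_mult_right) (auto simp: mult_ac)
      also have "\<dots> = K * (\<integral>v. v ^ S \<partial>N) * \<bar>s\<bar> ^ S" by simp
      finally show ?thesis unfolding e by simp
    qed
    then show ?thesis using i1 i2 by blast
  qed
  have sets: "sets \<nu> = sets (restrict_space borel {0..})" "sets \<nu>' = sets (restrict_space borel {0..})"
    using jp by (auto simp: jordan_pair_def)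
  have f: "(\<integral>\<^sup>+v. ennreal ((v + 2) powr Q * (v ^ S + v ^ (2 * S))) \<partial>\<nu>) < \<infinity>"
       "(\<integral>\<^sup>+v. ennreal ((v + 2) powr Q * (v ^ S + v ^ (2 * S))) \<partial>\<nu>') < \<infinity>"
    using fin by (auto simp: ennreal_add_eq_top less_top[symmetric] top_unique)
  note p = part[OF sets(1) f(1)] part[OF sets(2) f(2)]
  \<comment> \<open>For \<open>v \<ge> 0\<close> the factors \<open>v - u\<close> and
    \<open>v + u\<close> are never both negative, so the positive part of their product is the
    product of their positive parts.\<close>
  have tsp: "(max 0 (v\<^sup>2 - u\<^sup>2)) ^ S = two_sided_power v S S u" if "v \<ge> 0" for u v :: real
  proof -
    have "max 0 (v\<^sup>2 - u\<^sup>2) = max 0 (v - u) * max 0 (v + u)"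
    proof -
      have f: "v\<^sup>2 - u\<^sup>2 = (v - u) * (v + u)" by (simp add: power2_eq_square algebra_simps)
      show ?thesis unfolding f using that
        by (auto simp: max_def mult_le_0_iff zero_le_mult_iff)
    qed
    then show ?thesis by (simp add: two_sided_power_def power_mult_distrib)
  qed
  have hrep: "h u = (\<integral>v. two_sided_power v S S u \<partial>\<nu>) - (\<integral>v. two_sided_power v S S u \<partial>\<nu>')" for u
  proof -
    have "h u = (\<integral>v. (max 0 (v\<^sup>2 - u\<^sup>2)) ^ S \<partial>\<nu>) - (\<integral>v. (max 0 (v\<^sup>2 - u\<^sup>2)) ^ S \<partial>\<nu>')"
      using rep[of u] rep[of "- u"] even[of u] by (cases "u \<ge> 0") auto
    also have "\<dots> = (\<integral>v. two_sided_power v S S u \<partial>\<nu>) - (\<integral>v. two_sided_power v S S u \<partial>\<nu>')"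
      using sets_eq_imp_space_eq[OF sets(1)] sets_eq_imp_space_eq[OF sets(2)]
      by (intro arg_cong2[where f="(-)"] Bochner_Integration.integral_cong refl tsp) (auto simp: space_restrict_space)
    finally show ?thesis .
  qed
  have "\<bar>bdiff S s h u\<bar> \<le> (K * (\<integral>v. v ^ S \<partial>\<nu>) + K * (\<integral>v. v ^ S \<partial>\<nu>')) * \<bar>s\<bar> ^ S" for s u
  proof -
    have "h = (\<lambda>u. 1 * (\<integral>v. two_sided_power v S S u \<partial>\<nu>) + (- 1) * (\<integral>v. two_sided_power v S S u \<partial>\<nu>'))"
      using hrep by (intro ext) simp
    then have "bdiff S s h u = 1 * bdiff S s (\<lambda>u. \<integral>v. two_sided_power v S S u \<partial>\<nu>) u
        + (- 1) * bdiff S s (\<lambda>u. \<integral>v. two_sided_power v S S u \<partial>\<nu>') u"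
      by (simp only: bdiff_linear)
    moreover have "\<bar>bdiff S s (\<lambda>u. \<integral>v. two_sided_power v S S u \<partial>\<nu>) u\<bar> \<le> K * (\<integral>v. v ^ S \<partial>\<nu>) * \<bar>s\<bar> ^ S"
      using p(1) by blast
    moreover have "\<bar>bdiff S s (\<lambda>u. \<integral>v. two_sided_power v S S u \<partial>\<nu>') u\<bar> \<le> K * (\<integral>v. v ^ S \<partial>\<nu>') * \<bar>s\<bar> ^ S"
      using p(2) by blast
    ultimately show ?thesis unfolding distrib_right by linarith
  qed
  moreover have "0 \<le> (\<integral>v. v ^ S \<partial>\<nu>)" "0 \<le> (\<integral>v. v ^ S \<partial>\<nu>')"
    by (intro Bochner_Integration.integral_nonneg zero_le_power;
        simp add: sets_eq_imp_space_eq[OF sets(1)] sets_eq_imp_space_eq[OF sets(2)] space_restrict_space)+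
  ultimately show ?thesis using S K(1)
    by (intro exI[of _ S] exI[of _ "K * (\<integral>v. v ^ S \<partial>\<nu>) + K * (\<integral>v. v ^ S \<partial>\<nu>')"]) auto
qed

section \<open>The Tauberian theorem\<close>

lemma abs_sinc_le: "\<bar>sinc t\<bar> \<le> 1" "\<bar>sinc t\<bar> \<le> 2 / (1 + \<bar>t\<bar>)"
proof -
  show 1: "\<bar>sinc t\<bar> \<le> 1"
    using abs_sin_x_le_abs_x[of t] by (auto simp: divide_le_eq)
  show "\<bar>sinc t\<bar> \<le> 2 / (1 + \<bar>t\<bar>)"
  proof (cases "\<bar>t\<bar> \<le> 1")
    case True
    then have "1 \<le> 2 / (1 + \<bar>t\<bar>)" by (subst pos_le_divide_eq) simp_all
    with 1 show ?thesis by linarith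
  next
    case False
    then have "\<bar>sinc t\<bar> \<le> 1 / \<bar>t\<bar>" by (auto intro: divide_right_mono)
    also have "\<dots> \<le> 2 / (1 + \<bar>t\<bar>)" using False by (simp add: divide_simps)
    finally show ?thesis .
  qed
qed

lemma sinc_power_moment_integrable:
  assumes "r + 2 \<le> 2 * R"
  shows "integrable lborel (\<lambda>s. \<bar>s\<bar> ^ r * sinc s ^ (2 * R))"
proof (rule Bochner_Integration.integrable_bound)
  have "integrable lborel (\<lambda>x::real. inverse (1 + x\<^sup>2))"
    using integrable_inverse_1_plus_square by (simp add: set_integrable_def)
  then show "integrable lborel (\<lambda>x::real. 4 ^ R * (2 * inverse (1 + x\<^sup>2)))" by simp
  show "AE s in lborel. norm (\<bar>s\<bar> ^ r * sinc s ^ (2 * R)) \<le> norm (4 ^ R * (2 * inverse (1 + s\<^sup>2)))"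
  proof (intro AE_I2)
    fix s :: real
    have "norm (\<bar>s\<bar> ^ r * sinc s ^ (2 * R)) = \<bar>s\<bar> ^ r * \<bar>sinc s\<bar> ^ (2 * R)"
      by (simp only: real_norm_def abs_mult power_abs abs_idempotent)
    also have "\<dots> \<le> (1 + \<bar>s\<bar>) ^ r * (2 / (1 + \<bar>s\<bar>)) ^ (2 * R)"
      using abs_sinc_le(2)[of s] by (intro mult_mono power_mono) auto
    also have "\<dots> = 4 ^ R * ((1 + \<bar>s\<bar>) ^ r / (1 + \<bar>s\<bar>) ^ (2 * R))"
      by (simp add: power_divide power_mult)
    also have "\<dots> \<le> 4 ^ R * (2 * inverse (1 + s\<^sup>2))"
    proof (intro mult_left_mono)
      have "(1 + \<bar>s\<bar>) ^ r * (1 + s\<^sup>2) \<le> (1 + \<bar>s\<bar>) ^ r * (1 + \<bar>s\<bar>)\<^sup>2"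
        by (intro mult_left_mono) (auto simp: power2_eq_square algebra_simps)
      also have "\<dots> \<le> (1 + \<bar>s\<bar>) ^ (2 * R)"
        unfolding power_add[symmetric] using assms by (intro power_increasing) auto
      finally have "(1 + \<bar>s\<bar>) ^ r * (1 + s\<^sup>2) \<le> 2 * (1 + \<bar>s\<bar>) ^ (2 * R)"
        using zero_le_power[of "1 + \<bar>s\<bar>" "2 * R"] by linarith
      moreover have "0 < 1 + s\<^sup>2" "0 < (1 + \<bar>s\<bar>) ^ (2 * R)" by (auto intro: add_pos_nonneg)
      ultimately show "(1 + \<bar>s\<bar>) ^ r / (1 + \<bar>s\<bar>) ^ (2 * R) \<le> 2 * inverse (1 + s\<^sup>2)"
        by (simp add: divide_simps)
    qed simp
    also have "\<dots> = norm (4 ^ R * (2 * inverse (1 + s\<^sup>2)))"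
      by (simp add: abs_mult)
    finally show "norm (\<bar>s\<bar> ^ r * sinc s ^ (2 * R)) \<le> norm (4 ^ R * (2 * inverse (1 + s\<^sup>2)))" .
  qed
qed measurable

lemma sinc_power_integrable: "R \<ge> 1 \<Longrightarrow> integrable lborel (\<lambda>s. sinc s ^ (2 * R))"
  using sinc_power_moment_integrable[of 0 R] by (simp del: power_mult)

text \<open>This integral is later a divisor. On \<open>(0, 1]\<close> the mean value theorem gives
  \<open>sinc s = cos t\<close> for some \<open>t < s\<close>, and \<open>1 < pi / 3\<close> makes
  this at least \<open>1 / 2\<close>.\<close>

lemma sinc_power_integral_pos:
  assumes "R \<ge> 1"
  shows "0 < (\<integral>s. sinc s ^ (2 * R) \<partial>lborel)"
proof -
  have "(\<integral>s. indicator {0..1::real} s * (1/2) ^ (2 * R) \<partial>lborel) \<le> (\<integral>s. sinc s ^ (2 * R) \<partial>lborel)"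
  proof (rule integral_mono)
    show "integrable lborel (\<lambda>s. sinc s ^ (2 * R))"
      using assms by (rule sinc_power_integrable)
    show "integrable lborel (\<lambda>s. indicator {0..1::real} s * (1/2::real) ^ (2 * R))"
      by (intro integrable_mult_left integrable_real_indicator) auto
    fix s :: real
    show "indicator {0..1} s * (1/2) ^ (2 * R) \<le> sinc s ^ (2 * R)"
    proof (cases "s \<in> {0<..1}")
      case True
      then obtain t where t: "0 < t" "t < s" "sin s - sin 0 = (s - 0) * cos t"
        using MVT2[of 0 s sin cos] by (auto intro: DERIV_sin)
      have "cos (pi / 3) \<le> cos t"
        using t True pi_gt3 by (intro cos_monotone_0_pi_le) auto
      then have "s * (1 / 2) \<le> s * cos t" using True by (intro mult_left_mono) (auto simp: cos_60)
      then have "1 / 2 \<le> sinc s" using t True by (simp add: pos_le_divide_eq)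
      then show ?thesis using True by (simp del: power_mult add: power_mono)
    qed (auto simp: indicator_def power_le_one simp del: power_mult power_one_over intro: zero_le_even_power)
  qed
  moreover have "0 < (\<integral>s. indicator {0..1::real} s * (1/2::real) ^ (2 * R) \<partial>lborel)"
    by simp
  ultimately show ?thesis by linarith
qed

lemma sinc_dilate_bound:
  assumes e: "0 < e" and x: "0 \<le> x" and y: "\<bar>y\<bar> \<le> 1"
  shows "\<bar>sinc (e * (x - y))\<bar> \<le> 4 * (1 + 1 / e) / (1 + x)"
proof -
  have "\<bar>sinc (e * (x - y))\<bar> \<le> 2 / (1 + e * \<bar>x - y\<bar>)"
    using abs_sinc_le(2)[of "e * (x - y)"] e by (simp only: abs_mult abs_of_pos)
  also have "\<dots> \<le> 4 * (1 + 1 / e) / (1 + x)"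
  proof -
    have "1 + x \<le> 2 + \<bar>x - y\<bar>" using y by linarith
    also have "\<dots> \<le> 2 * ((1 + 1 / e) * (1 + e * \<bar>x - y\<bar>))"
      using e by (simp add: field_simps)
    finally have "1 + x \<le> 2 * ((1 + 1 / e) * (1 + e * \<bar>x - y\<bar>))" .
    moreover have "0 < 1 + e * \<bar>x - y\<bar>" using e by (intro add_pos_nonneg) auto
    ultimately show ?thesis using x by (simp add: divide_simps mult_ac)
  qed
  finally show ?thesis .
qed

text \<open>Evenness of \<open>f\<close> symmetrises the convolution. It becomes a superposition
  over \<open>y\<close> of exactly those sums of two \<open>sinc\<close> powers that are annihilated
  under the Gaussian bound.\<close>

lemma convolution_sinc_symmetric:
  fixes f :: "real \<Rightarrow> real"
  assumes [measurable]: "f \<in> borel_measurable borel" and even: "\<And>x. f (- x) = f x" and e: "e > 0"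
    and f: "\<And>x. \<bar>f x\<bar> \<le> 1" "\<And>x. \<bar>x\<bar> \<ge> 1 \<Longrightarrow> f x = 0"
  shows "(\<integral>s. f (x - s / e) * sinc s ^ (2 * R) \<partial>lborel)
     = e / 2 * (\<integral>y. f y * (sinc (e * (x - y)) ^ (2 * R) + sinc (e * (x + y)) ^ (2 * R)) \<partial>lborel)"
proof -
  let ?I = "\<integral>y. f y * sinc (e * (x - y)) ^ (2 * R) \<partial>lborel"
  have I: "integrable lborel (\<lambda>y. f y * sinc (e * (x + \<sigma> * y)) ^ (2 * R))" for \<sigma>
  proof (rule Bochner_Integration.integrable_bound)
    show "integrable lborel (indicat_real {-1..1::real})"
      by (rule integrable_real_indicator) (simp_all add: borel_closed)
    have "\<bar>f y\<bar> * \<bar>sinc (e * (x + \<sigma> * y))\<bar> ^ (2 * R) \<le> indicat_real {-1..1::real} y" for y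
    proof (cases "\<bar>y\<bar> \<ge> 1")
      case False
      have "\<bar>f y\<bar> * \<bar>sinc (e * (x + \<sigma> * y))\<bar> ^ (2 * R) \<le> 1 * 1"
        by (intro mult_mono f power_le_one abs_sinc_le) auto
      then show ?thesis using False by (auto simp: indicator_def)
    qed (use f in auto)
    then show "AE y in lborel. norm (f y * sinc (e * (x + \<sigma> * y)) ^ (2 * R)) \<le> norm (indicat_real {-1..1::real} y)"
      by (simp only: real_norm_def abs_mult power_abs) auto
  qed measurable
  have "(\<integral>s. f (x - s / e) * sinc s ^ (2 * R) \<partial>lborel)
      = \<bar>- e\<bar> *\<^sub>R (\<integral>y. f (x - (e * x + (- e) * y) / e) * sinc (e * x + (- e) * y) ^ (2 * R) \<partial>lborel)"
    using e by (intro lborel_integral_real_affine) auto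
  also have "\<dots> = e * ?I"
  proof -
    have "e * x + (- e) * y = e * (x - y)" "x - (e * (x - y)) / e = y" for y
      using e by (simp_all add: right_diff_distrib[symmetric])
    then show ?thesis using e by (simp only: abs_minus abs_of_pos real_scaleR_def)
  qed
  finally have 1: "(\<integral>s. f (x - s / e) * sinc s ^ (2 * R) \<partial>lborel) = e * ?I" .
  have "?I = \<bar>- 1\<bar> *\<^sub>R (\<integral>y. f (0 + (- 1) * y) * sinc (e * (x - (0 + (- 1) * y))) ^ (2 * R) \<partial>lborel)"
    by (intro lborel_integral_real_affine) auto
  moreover have "x - (0 + (- 1) * y) = x + y" "f (0 + (- 1) * y) = f y" for y
    by (simp_all add: even)
  ultimately have 2: "?I = (\<integral>y. f y * sinc (e * (x + y)) ^ (2 * R) \<partial>lborel)"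
    by (simp only: abs_minus_cancel abs_one scaleR_one)
  define k where "k t = sinc t ^ (2 * R)" for t
  have "x + 1 * y = x + y" "x + (- 1) * y = x - y" for y by simp_all
  then have Ik: "integrable lborel (\<lambda>y. f y * k (e * (x - y)))" "integrable lborel (\<lambda>y. f y * k (e * (x + y)))"
    using I[of 1] I[of "-1"] by (simp_all only: k_def)
  have "(\<integral>y. f y * (k (e * (x - y)) + k (e * (x + y))) \<partial>lborel)
      = (\<integral>y. f y * k (e * (x - y)) + f y * k (e * (x + y)) \<partial>lborel)"
    by (simp only: distrib_left[of "f _"])
  also have "\<dots> = (\<integral>y. f y * k (e * (x - y)) \<partial>lborel) + (\<integral>y. f y * k (e * (x + y)) \<partial>lborel)"
    by (rule Bochner_Integration.integral_add[OF Ik])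
  also have "\<dots> = ?I + ?I" using 2 by (simp only: k_def)
  finally show ?thesis using 1 unfolding k_def by simp
qed

text \<open>Fubini moves the integral over \<open>M\<close> inside the superposition, where it
  vanishes for each \<open>y\<close>; negative \<open>y\<close> reduce to positive ones since the
  two \<open>sinc\<close> terms swap. Bandwidth \<open>e\<close> in the variable
  \<open>u / n\<close> is bandwidth \<open>e / n\<close> in \<open>u\<close>, which explains the
  hypothesis on \<open>e / n\<close>.\<close>

lemma gauss_decay_convolution_zero:
  fixes f :: "real \<Rightarrow> real"
  assumes sf: "sigma_finite_measure M"
    and [measurable]: "f \<in> borel_measurable borel" and even: "\<And>x. f (- x) = f x"
    and f: "\<And>x. \<bar>f x\<bar> \<le> 1" "\<And>x. \<bar>x\<bar> \<ge> 1 \<Longrightarrow> f x = 0"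
    and g: "poly_growth M a u c Q" and R: "2 * real R \<ge> Q + 1" "R \<ge> 1"
    and gd: "gauss_decay M a u c1 \<alpha> c2 d" and pos: "c1 > 0" "\<alpha> > 0"
    and n: "n \<ge> 1" and e: "e > 0" "9 * (real R)\<^sup>2 * (e / n)\<^sup>2 \<le> c2 * d\<^sup>2"
  shows "integrable M (\<lambda>i. a i * of_real (\<integral>s. f (u i / n - s / e) * sinc s ^ (2 * R) \<partial>lborel))"
    and "(\<integral>i. a i * of_real (\<integral>s. f (u i / n - s / e) * sinc s ^ (2 * R) \<partial>lborel) \<partial>M) = 0"
proof -
  define I where "I x = (\<integral>s. f (x - s / e) * sinc s ^ (2 * R) \<partial>lborel)" for x
  interpret pair_sigma_finite M lborel
    using sf by (simp add: pair_sigma_finite_def lborel.sigma_finite_measure_axioms)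
  have [measurable]: "a \<in> borel_measurable M" "u \<in> borel_measurable M"
    and u: "\<And>i. i \<in> space M \<Longrightarrow> 0 \<le> u i"
    using g by (auto simp: poly_growth_def)
  define G where "G x y = sinc (e * (x - y)) ^ (2 * R) + sinc (e * (x + y)) ^ (2 * R)" for x y
  define F where "F i y = a i * of_real (f y * G (u i / n) y)" for i y
  define B where "B = 2 * (4 * (1 + 1 / e)) ^ (2 * R)"
  have B: "0 \<le> B" by (auto simp: B_def zero_le_even_power simp del: power_mult)
  have Gb: "\<bar>G x y\<bar> \<le> B * (1 / (1 + x)) ^ (2 * R)" if "0 \<le> x" "\<bar>y\<bar> \<le> 1" for x y
  proof -
    have *: "\<bar>sinc (e * (x - y))\<bar> ^ (2 * R) \<le> (4 * (1 + 1 / e) / (1 + x)) ^ (2 * R)" if "\<bar>y\<bar> \<le> 1" for y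
      using sinc_dilate_bound[OF e(1) \<open>0 \<le> x\<close> that] by (intro power_mono) auto
    have "\<bar>G x y\<bar> \<le> \<bar>sinc (e * (x - y)) ^ (2 * R)\<bar> + \<bar>sinc (e * (x + y)) ^ (2 * R)\<bar>"
      unfolding G_def by (rule abs_triangle_ineq)
    also have "\<dots> \<le> (4 * (1 + 1 / e) / (1 + x)) ^ (2 * R) + (4 * (1 + 1 / e) / (1 + x)) ^ (2 * R)"
      using *[of y] *[of "- y"] that unfolding power_abs by (intro add_mono) auto
    also have "\<dots> = B * (1 / (1 + x)) ^ (2 * R)" by (simp add: B_def power_divide)
    finally show ?thesis .
  qed
  have [measurable]: "(\<lambda>(i, y). G (u i / n) y) \<in> borel_measurable (M \<Otimes>\<^sub>M lborel)"
    unfolding G_def by measurable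
  have Fm [measurable]: "(\<lambda>(i, y). F i y) \<in> borel_measurable (M \<Otimes>\<^sub>M lborel)"
    unfolding F_def by measurable
  have Fb: "norm (F i y) \<le> B * (norm (a i) * (1 / (1 + u i / n)) ^ (2 * R)) * indicator {-1..1::real} y"
    if i: "i \<in> space M" for i y
  proof (cases "\<bar>y\<bar> \<ge> 1")
    case True
    then show ?thesis using u[OF i] B n f(2)[OF True]
      by (auto simp: F_def intro!: mult_nonneg_nonneg)
  next
    case False
    have "norm (F i y) = norm (a i) * (\<bar>f y\<bar> * \<bar>G (u i / n) y\<bar>)"
      unfolding F_def norm_mult norm_of_real abs_mult ..
    also have "\<dots> \<le> norm (a i) * (1 * (B * (1 / (1 + u i / n)) ^ (2 * R)))"
      using u[OF i] n False by (intro mult_left_mono mult_mono f Gb) auto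
    also have "\<dots> = B * (norm (a i) * (1 / (1 + u i / n)) ^ (2 * R)) * indicator {-1..1::real} y"
    proof -
      have "indicator {-1..1::real} y = (1::real)" using False by (auto simp: indicator_def)
      then show ?thesis by (simp add: mult_ac)
    qed
    finally show ?thesis .
  qed
  \<comment> \<open>The integrand has compact support in \<open>y\<close> and decays in
    \<open>u\<close> uniformly there, so the growth bound gives integrability on the
    product.\<close>
  have Fint: "integrable (M \<Otimes>\<^sub>M lborel) (case_prod F)"
  proof (rule integrableI_bounded)
    show "case_prod F \<in> borel_measurable (M \<Otimes>\<^sub>M lborel)" using Fm by simp
    have "(\<integral>\<^sup>+x. ennreal (norm (case_prod F x)) \<partial>(M \<Otimes>\<^sub>M lborel)) = (\<integral>\<^sup>+i. \<integral>\<^sup>+y. ennreal (norm (F i y)) \<partial>lborel \<partial>M)"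
      by (subst lborel.nn_integral_fst[symmetric]) (auto intro: borel_measurable_norm)
    also have "\<dots> \<le> (\<integral>\<^sup>+i. \<integral>\<^sup>+y. ennreal (B * (norm (a i) * (1 / (1 + u i / n)) ^ (2 * R))) * indicator {-1..1::real} y \<partial>lborel \<partial>M)"
    proof (intro nn_integral_mono)
      fix i y assume i: "i \<in> space M"
      show "ennreal (norm (F i y)) \<le> ennreal (B * (norm (a i) * (1 / (1 + u i / n)) ^ (2 * R))) * indicator {-1..1::real} y"
        using ennreal_leI[OF Fb[OF i, of y]] by (auto simp: indicator_def)
    qed
    also have "\<dots> = (\<integral>\<^sup>+i. ennreal (B * 2) * ennreal (norm (a i) * (1 / (1 + u i / n)) ^ (2 * R)) \<partial>M)"
    proof (intro nn_integral_cong)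
      fix i
      let ?Y = "norm (a i) * (1 / (1 + u i / n)) ^ (2 * R)"
      have "(\<integral>\<^sup>+y. ennreal (B * ?Y) * indicator {-1..1::real} y \<partial>lborel) = ennreal (B * ?Y) * ennreal 2"
        by (subst nn_integral_cmult_indicator) simp_all
      also have "\<dots> = ennreal ((B * 2) * ?Y)"
        by (subst ennreal_mult''[symmetric]) (simp_all add: mult_ac)
      also have "\<dots> = ennreal (B * 2) * ennreal ?Y"
        using B by (intro ennreal_mult') simp
      finally show "(\<integral>\<^sup>+y. ennreal (B * ?Y) * indicator {-1..1::real} y \<partial>lborel) = ennreal (B * 2) * ennreal ?Y" .
    qed
    also have "\<dots> = ennreal (B * 2) * (\<integral>\<^sup>+i. ennreal (norm (a i) * (1 / (1 + u i / n)) ^ (2 * R)) \<partial>M)"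
      by (rule nn_integral_cmult) measurable
    also have "\<dots> \<le> ennreal (B * 2) * ennreal (2 ^ (2 * R) * c * n powr Q)"
      using R by (intro mult_left_mono poly_growth_decay[OF g] n) auto
    also have "\<dots> < \<infinity>" by (simp add: ennreal_mult_less_top)
    finally show "(\<integral>\<^sup>+x. ennreal (norm (case_prod F x)) \<partial>(M \<Otimes>\<^sub>M lborel)) < \<infinity>" .
  qed
  have inner: "(\<integral>i. F i y \<partial>M) = 0" for y
  proof -
    have *: "(\<integral>i. a i * of_real (G (u i / n) y) \<partial>M) = 0" if "0 \<le> y" for y
    proof -
      have e': "e * (u i / n - y) = e / n * (u i - n * y)" "e * (u i / n + y) = e / n * (u i + n * y)" for i
        using n by (simp_all add: field_simps)
      show ?thesis
        unfolding G_def e'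
        by (rule gauss_decay_band_limited[OF g R gd pos]) (use e n that in auto)
    qed
    have "(\<integral>i. a i * of_real (G (u i / n) y) \<partial>M) = 0"
    proof (cases "0 \<le> y")
      case False
      have "G x y = G x (- y)" for x by (simp only: G_def diff_minus_eq_add add_uminus_conv_diff add.commute)
      then show ?thesis using *[of "- y"] False by simp
    qed (rule *)
    then have "(\<integral>i. of_real (f y) * (a i * of_real (G (u i / n) y)) \<partial>M) = 0"
      by (simp only: integral_mult_right_zero mult_zero_right)
    then show ?thesis by (simp add: F_def mult_ac)
  qed
  have eq: "a i * of_real (I (u i / n)) = of_real (e / 2) * (\<integral>y. F i y \<partial>lborel)" for i
  proof -
    have "I (u i / n) = e / 2 * (\<integral>y. f y * G (u i / n) y \<partial>lborel)"
      unfolding I_def G_def using even f e by (intro convolution_sinc_symmetric) auto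
    moreover have "(\<integral>y. F i y \<partial>lborel) = a i * of_real (\<integral>y. f y * G (u i / n) y \<partial>lborel)"
      unfolding F_def by (simp only: integral_mult_right_zero integral_complex_of_real)
    ultimately show ?thesis by (simp only: of_real_mult mult_ac)
  qed
  have i: "integrable M (\<lambda>i. \<integral>y. F i y \<partial>lborel)"
    using integrable_fst'[OF Fint] by simp
  then show "integrable M (\<lambda>i. a i * of_real (\<integral>s. f (u i / n - s / e) * sinc s ^ (2 * R) \<partial>lborel))"
    unfolding I_def[symmetric] eq by (rule integrable_mult_right)
  have "(\<integral>i. (\<integral>y. F i y \<partial>lborel) \<partial>M) = (\<integral>y. (\<integral>i. F i y \<partial>M) \<partial>lborel)"
    using Fubini_integral[OF Fint] by simp
  then show "(\<integral>i. a i * of_real (\<integral>s. f (u i / n - s / e) * sinc s ^ (2 * R) \<partial>lborel) \<partial>M) = 0"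
    unfolding I_def[symmetric] eq integral_mult_right_zero by (simp add: inner)
qed

lemma bdiff_convolution_decay:
  fixes f :: "real \<Rightarrow> real"
  assumes [measurable]: "f \<in> borel_measurable borel"
    and f: "\<And>x. \<bar>f x\<bar> \<le> 1" "\<And>x. \<bar>x\<bar> \<ge> 1 \<Longrightarrow> f x = 0"
    and H: "H \<ge> 0" "\<And>s x. \<bar>bdiff S s f x\<bar> \<le> H * \<bar>s\<bar> ^ S"
    and m: "S \<ge> 1" "S \<le> m" "m + 2 \<le> 2 * R"
  shows "\<exists>C\<ge>0. \<forall>b\<ge>1. \<forall>x\<ge>0. \<bar>\<integral>s. bdiff S (s / b) f x * sinc s ^ (2 * R) \<partial>lborel\<bar> \<le> C * (1 / b) ^ S * (1 / (1 + x)) ^ m"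
proof -
  obtain c where c: "\<And>s f u. bdiff S s f u = (\<Sum>j\<le>S. c j * f (u - real j * s))"
    using bdiff_coeffs[of S] by blast
  define A where "A = (\<Sum>j\<le>S. \<bar>c j\<bar>)"
  have A: "A \<ge> 0" by (simp add: A_def sum_nonneg)
  define K where "K = H * 3 ^ m + A * (4 * real S) ^ m"
  have K0: "K \<ge> 0" using H A by (simp add: K_def)
  let ?k = "\<lambda>s. sinc s ^ (2 * R)"
  let ?J = "\<integral>s. (\<bar>s\<bar> ^ S * ?k s + \<bar>s\<bar> ^ m * ?k s) \<partial>lborel"
  have k0: "0 \<le> ?k s" for s by (rule zero_le_even_power) simp
  have i1: "integrable lborel (\<lambda>s. \<bar>s\<bar> ^ S * ?k s)" and i2: "integrable lborel (\<lambda>s. \<bar>s\<bar> ^ m * ?k s)"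
    using m by (auto intro!: sinc_power_moment_integrable simp del: power_mult)
  have main: "\<bar>bdiff S (s / b) f x\<bar> \<le> K * (1 / b) ^ S * (1 / (1 + x)) ^ m * (\<bar>s\<bar> ^ S + \<bar>s\<bar> ^ m)"
    if b: "b \<ge> 1" and x: "x \<ge> 0" for b x s :: real
  proof (cases "x < 2")
    case True
    have "1 \<le> 3 ^ m * (1 / (1 + x)) ^ m"
      unfolding power_mult_distrib[symmetric] using True x by (intro one_le_power) (simp add: divide_simps)
    then have "H * (\<bar>s\<bar> ^ S * (1 / b) ^ S) * 1 \<le> H * (\<bar>s\<bar> ^ S * (1 / b) ^ S) * (3 ^ m * (1 / (1 + x)) ^ m)"
      using b H(1) by (intro mult_left_mono) auto
    also have "\<dots> = (H * 3 ^ m) * ((1 / b) ^ S * (1 / (1 + x)) ^ m * \<bar>s\<bar> ^ S)" by (simp add: mult_ac)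
    also have "\<dots> \<le> K * ((1 / b) ^ S * (1 / (1 + x)) ^ m * (\<bar>s\<bar> ^ S + \<bar>s\<bar> ^ m))"
      unfolding K_def using b x H A m by (intro mult_mono) auto
    finally show ?thesis using H(2)[of "s / b" x] b by (simp add: power_divide mult_ac)
  next
    case False
    show ?thesis
    proof (cases "real S * \<bar>s\<bar> / b < x / 2")
      case True
      have "f (x - real j * (s / b)) = 0" if "j \<le> S" for j
      proof (rule f(2))
        have "real j * (s / b) \<le> real j * (\<bar>s\<bar> / b)"
          using b by (intro mult_left_mono divide_right_mono) auto
        also have "\<dots> \<le> real S * (\<bar>s\<bar> / b)" using that b by (intro mult_right_mono) auto
        also have "\<dots> < x / 2" using True by simp
        finally show "1 \<le> \<bar>x - real j * (s / b)\<bar>" using False by linarith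
      qed
      then have "bdiff S (s / b) f x = 0" unfolding c by (intro sum.neutral) simp
      then show ?thesis using K0 b x by simp
    next
      case far: False
      have "\<bar>bdiff S (s / b) f x\<bar> \<le> (\<Sum>j\<le>S. \<bar>c j * f (x - real j * (s / b))\<bar>)"
        unfolding c by (rule sum_abs)
      also have "\<dots> \<le> A" unfolding A_def abs_mult by (intro sum_mono mult_left_le f) auto
      finally have 1: "\<bar>bdiff S (s / b) f x\<bar> \<le> A * 1" by simp
      have "1 + x \<le> 2 * x" using False by simp
      also have "2 * x \<le> 4 * (real S * \<bar>s\<bar> / b)" using far by linarith
      finally have ux: "1 + x \<le> 4 * (real S * \<bar>s\<bar> / b)" .
      have "1 \<le> 4 * real S * \<bar>s\<bar> * (1 / b) * (1 / (1 + x))"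
      proof -
        have p: "0 < b" "0 < 1 + x" using x b by auto
        have "1 + x \<le> 4 * real S * \<bar>s\<bar> / b" using ux by simp
        then have "1 \<le> 4 * real S * \<bar>s\<bar> / b / (1 + x)" using p by (simp only: pos_le_divide_eq mult_1)
        then show ?thesis by simp
      qed
      then have "1 \<le> (4 * real S * \<bar>s\<bar> * (1 / b) * (1 / (1 + x))) ^ m" by (rule one_le_power)
      then have "A * 1 \<le> A * (4 * real S * \<bar>s\<bar> * (1 / b) * (1 / (1 + x))) ^ m" using A by (rule mult_left_mono)
      also have "\<dots> = (A * (4 * real S) ^ m) * ((1 / b) ^ m * (1 / (1 + x)) ^ m * \<bar>s\<bar> ^ m)"
        by (simp add: power_mult_distrib power_divide mult_ac)
      also have "\<dots> \<le> K * ((1 / b) ^ S * (1 / (1 + x)) ^ m * (\<bar>s\<bar> ^ S + \<bar>s\<bar> ^ m))"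
        unfolding K_def using b x H A m by (intro mult_mono power_decreasing) auto
      finally show ?thesis using 1 by (simp add: mult_ac)
    qed
  qed
  have "\<bar>\<integral>s. bdiff S (s / b) f x * ?k s \<partial>lborel\<bar> \<le> (K * ?J) * (1 / b) ^ S * (1 / (1 + x)) ^ m"
    if b: "b \<ge> 1" and x: "x \<ge> 0" for b x
  proof -
    let ?w = "K * (1 / b) ^ S * (1 / (1 + x)) ^ m"
    have iw: "integrable lborel (\<lambda>s. ?w * (\<bar>s\<bar> ^ S * ?k s + \<bar>s\<bar> ^ m * ?k s))"
      using i1 i2 by (intro integrable_mult_right Bochner_Integration.integrable_add)
    have bd: "\<bar>bdiff S (s / b) f x * ?k s\<bar> \<le> ?w * (\<bar>s\<bar> ^ S * ?k s + \<bar>s\<bar> ^ m * ?k s)" for s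
      using mult_right_mono[OF main[OF b x, of s] k0[of s]] k0[of s]
      unfolding abs_mult by (simp only: abs_of_nonneg distrib_right mult.assoc)
    have meas: "(\<lambda>s. bdiff S (s / b) f x * ?k s) \<in> borel_measurable lborel"
      unfolding c by measurable
    have i: "integrable lborel (\<lambda>s. bdiff S (s / b) f x * ?k s)"
      by (rule Bochner_Integration.integrable_bound[OF iw meas])
         (use bd in \<open>auto simp only: real_norm_def intro!: AE_I2 order.trans[OF bd abs_ge_self]\<close>)
    have "\<bar>\<integral>s. bdiff S (s / b) f x * ?k s \<partial>lborel\<bar> \<le> (\<integral>s. \<bar>bdiff S (s / b) f x * ?k s\<bar> \<partial>lborel)"
      by (rule integral_abs_bound)
    also have "\<dots> \<le> (\<integral>s. ?w * (\<bar>s\<bar> ^ S * ?k s + \<bar>s\<bar> ^ m * ?k s) \<partial>lborel)"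
      by (intro integral_mono integrable_abs i iw bd)
    also have "\<dots> = ?w * ?J" by (rule integral_mult_right_zero)
    finally show ?thesis by (simp only: mult_ac)
  qed
  moreover have "0 \<le> K * ?J"
    using K0 k0 by (intro mult_nonneg_nonneg Bochner_Integration.integral_nonneg add_nonneg_nonneg) auto
  ultimately show ?thesis by blast
qed

text \<open>Integrating \<open>bdiff S (s / b) f x\<close> against \<open>sinc s ^ (2 * R)\<close>
  gives \<open>k0 * f x\<close> plus convolutions \<open>I j\<close> of bandwidth
  \<open>b / j\<close>. All of these are annihilated when \<open>b\<close> is a small multiple of
  \<open>n * d\<close>, so the integral of \<open>f\<close> is \<open>1 / k0\<close> times that of
  the remainder \<open>G\<close>, which has order \<open>b^(-S)\<close>. The constant is fixed
  before the measure, the distance and \<open>n\<close>, hence it is uniform over all pairs of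
  points.\<close>

lemma gauss_decay_tauberian:
  fixes f :: "real \<Rightarrow> real"
  assumes [measurable]: "f \<in> borel_measurable borel" and even: "\<And>x. f (- x) = f x"
    and f: "\<And>x. \<bar>f x\<bar> \<le> 1" "\<And>x. \<bar>x\<bar> \<ge> 1 \<Longrightarrow> f x = 0"
    and H: "H \<ge> 0" "\<And>s x. \<bar>bdiff S s f x\<bar> \<le> H * \<bar>s\<bar> ^ S" and S: "S \<ge> 1"
    and pos: "c \<ge> 0" "Q > 0" "c1 > 0" "\<alpha> > 0" "c2 > 0"
  shows "\<exists>C\<ge>0. \<forall>(M :: 'i measure) a u d n. sigma_finite_measure M \<and> poly_growth M a u c Q \<and>
      gauss_decay M a u c1 \<alpha> c2 d \<and> 0 \<le> d \<and> 1 \<le> n \<longrightarrow>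
      norm (\<integral>i. a i * of_real (f (u i / n)) \<partial>M) \<le> C * n powr Q \<and>
      norm (\<integral>i. a i * of_real (f (u i / n)) \<partial>M) * (n * d) ^ S \<le> C * n powr Q"
proof -
  \<comment> \<open>The exponent \<open>m\<close> has to exceed \<open>Q + 1\<close>, so that the
    growth bound controls \<open>G\<close>, and \<open>S\<close>, so that far nodes cost no decay in
    \<open>b\<close>; \<open>R = m + 2\<close> leaves room for the \<open>m\<close>-th moment of the
    kernel.\<close>
  define m where "m = max S (nat \<lceil>Q\<rceil> + 1)"
  define R where "R = m + 2"
  have m: "S \<le> m" "real m \<ge> Q + 1" unfolding m_def by (simp, linarith)
  have R: "R \<ge> 1" "2 * real R \<ge> Q + 1" "m + 2 \<le> 2 * R" using m by (auto simp: R_def)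
  define k0 where "k0 = (\<integral>s. sinc s ^ (2 * R) \<partial>lborel)"
  have k0: "k0 > 0" unfolding k0_def by (rule sinc_power_integral_pos[OF R(1)])
  obtain w where w: "w 0 = (1::real)" "\<And>s f u. bdiff S s f u = (\<Sum>j\<le>S. w j * f (u - real j * s))"
    using bdiff_coeffs[of S] by blast
  obtain C0 where C0: "C0 \<ge> 0" "\<And>b x. b \<ge> 1 \<Longrightarrow> x \<ge> 0 \<Longrightarrow>
      \<bar>\<integral>s. bdiff S (s / b) f x * sinc s ^ (2 * R) \<partial>lborel\<bar> \<le> C0 * (1 / b) ^ S * (1 / (1 + x)) ^ m"
    using bdiff_convolution_decay[of f H S m R] f H S m(1) R(3) by auto
  \<comment> \<open>The largest admissible choice: for \<open>b = \<delta> * n * d\<close> the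
    bandwidth condition \<open>9 R^2 (b / n)^2 \<le> c2 d^2\<close> is an equality.\<close>
  define \<delta> where "\<delta> = sqrt c2 / (3 * real R)"
  have \<delta>: "\<delta> > 0" "9 * (real R)\<^sup>2 * \<delta>\<^sup>2 = c2" using pos R by (auto simp: \<delta>_def power_divide power_mult_distrib)
  define C1 where "C1 = 2 ^ m * (2 ^ m * c)"
  define C2 where "C2 = C0 * (2 ^ m * c) / k0"
  define C where "C = max C1 (max (C1 / \<delta> ^ S) (C2 / \<delta> ^ S))"
  have C1: "C1 \<ge> 0" using pos by (simp add: C1_def)
  show ?thesis
  proof (intro exI[of _ C] conjI allI impI)
    show "0 \<le> C" using C1 by (simp add: C_def)
  next
    fix M :: "'i measure" and a u d and n :: real
    assume "sigma_finite_measure M \<and> poly_growth M a u c Q \<and> gauss_decay M a u c1 \<alpha> c2 d \<and> 0 \<le> d \<and> 1 \<le> n"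
    then have sf: "sigma_finite_measure M" and g: "poly_growth M a u c Q"
      and gd: "gauss_decay M a u c1 \<alpha> c2 d" and d: "0 \<le> d" and n: "1 \<le> n" by auto
    have [measurable]: "a \<in> borel_measurable M" "u \<in> borel_measurable M"
      and u: "\<And>i. i \<in> space M \<Longrightarrow> 0 \<le> u i"
      using g by (auto simp: poly_growth_def)
    let ?X = "norm (\<integral>i. a i * of_real (f (u i / n)) \<partial>M)"
    have fb: "norm (complex_of_real (f x)) \<le> 2 ^ m * (1 / (1 + x)) ^ m" if "x \<ge> 0" for x
    proof (cases "\<bar>x\<bar> \<ge> 1")
      case False
      have "1 \<le> (2 * (1 / (1 + x))) ^ m"
        using False that by (intro one_le_power) (simp add: divide_simps)
      then show ?thesis using f(1)[of x] unfolding power_mult_distrib by simp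
    qed (use f(2) that in simp)
    have X1: "?X \<le> C1 * n powr Q" and iF: "integrable M (\<lambda>i. a i * of_real (f (u i / n)))"
      using poly_growth_integrable[OF g m(2) n, where f="\<lambda>i. of_real (f (u i / n))" and K="2 ^ m"] fb u n
      by (simp_all add: C1_def)
    have "C1 * n powr Q \<le> C * n powr Q" by (intro mult_right_mono) (simp_all add: C_def)
    with X1 show "?X \<le> C * n powr Q" by linarith
    define b where "b = \<delta> * (n * d)"
    have nd: "n * d = b / \<delta>" "0 \<le> n * d" using \<delta> n d by (auto simp: b_def)
    show "?X * (n * d) ^ S \<le> C * n powr Q"
    proof (cases "b \<ge> 1")
      case False
      \<comment> \<open>For \<open>b < 1\<close> the product \<open>n * d\<close> is bounded, and
        the estimate without decay already suffices.\<close>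
      then have "(n * d) ^ S \<le> (1 / \<delta>) ^ S"
        using nd \<delta>(1) unfolding nd(1) by (intro power_mono divide_right_mono) auto
      then have "?X * (n * d) ^ S \<le> (C1 * n powr Q) * (1 / \<delta>) ^ S"
        using X1 C1 nd(2) by (intro mult_mono) auto
      also have "\<dots> = (C1 / \<delta> ^ S) * n powr Q" by (simp add: power_divide)
      also have "\<dots> \<le> C * n powr Q" by (intro mult_right_mono) (simp_all add: C_def)
      finally show ?thesis .
    next
      case b: True
      define I where "I j x = (\<integral>s. f (x - s / (b / real j)) * sinc s ^ (2 * R) \<partial>lborel)" for j x
      define G where "G x = (\<integral>s. bdiff S (s / b) f x * sinc s ^ (2 * R) \<partial>lborel)" for x
      have ik: "integrable lborel (\<lambda>s. f (x - z * s) * sinc s ^ (2 * R))" for x z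
      proof (rule Bochner_Integration.integrable_bound[OF sinc_power_integrable[OF R(1)]])
        show "AE s in lborel. norm (f (x - z * s) * sinc s ^ (2 * R)) \<le> norm (sinc s ^ (2 * R))"
          unfolding norm_mult by (intro AE_I2 mult_left_le_one_le) (auto simp: f)
      qed measurable
      have bs: "bdiff S t f x = f x + (\<Sum>j\<in>{1..S}. w j * f (x - real j * t))" for t x
        unfolding w(2) atMost_atLeast0 by (subst sum.atLeast_Suc_atMost) (simp_all add: w(1))
      have G: "G x = f x * k0 + (\<Sum>j\<in>{1..S}. w j * I j x)" for x
      proof -
        have e1: "x - real j * (s / b) = x - real j / b * s" "x - s / (b / real j) = x - real j / b * s" for j s
          by simp_all
        have e2: "bdiff S (s / b) f x * sinc s ^ (2 * R) = f (x - 0 * s) * sinc s ^ (2 * R)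
            + (\<Sum>j\<in>{1..S}. w j * (f (x - real j / b * s) * sinc s ^ (2 * R)))" for s
          unfolding bs e1 by (simp only: distrib_right sum_distrib_right mult.assoc mult_zero_left diff_zero)
        have "G x = (\<integral>s. f (x - 0 * s) * sinc s ^ (2 * R) \<partial>lborel)
          + (\<Sum>j\<in>{1..S}. w j * (\<integral>s. f (x - real j / b * s) * sinc s ^ (2 * R) \<partial>lborel))"
          unfolding G_def e2
          by (subst Bochner_Integration.integral_add, rule ik, intro Bochner_Integration.integrable_sum integrable_mult_right ik,
              subst Bochner_Integration.integral_sum, intro integrable_mult_right ik, simp only: integral_mult_right_zero)
        then show ?thesis
          unfolding I_def e1 k0_def by (simp only: mult_zero_left diff_zero integral_mult_right_zero)
      qed
      have I0: "integrable M (\<lambda>i. a i * of_real (I j (u i / n)))" "(\<integral>i. a i * of_real (I j (u i / n)) \<partial>M) = 0"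
        if j: "j \<in> {1..S}" for j
      proof -
        have e: "b / real j > 0" "9 * (real R)\<^sup>2 * (b / real j / n)\<^sup>2 \<le> c2 * d\<^sup>2"
        proof -
          show "b / real j > 0" using b j by auto
          have "b / real j / n \<le> \<delta> * d"
          proof -
            have "b / real j \<le> b / 1" using b j by (intro divide_left_mono) auto
            then have "b / real j / n \<le> b / 1 / n" using n by (intro divide_right_mono) auto
            also have "b / 1 / n = \<delta> * d" using n by (simp add: b_def)
            finally show ?thesis .
          qed
          then have "(b / real j / n)\<^sup>2 \<le> (\<delta> * d)\<^sup>2" using b j n by (intro power_mono) auto
          then have "9 * (real R)\<^sup>2 * (b / real j / n)\<^sup>2 \<le> 9 * (real R)\<^sup>2 * (\<delta> * d)\<^sup>2" by (intro mult_left_mono) auto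
          then show "9 * (real R)\<^sup>2 * (b / real j / n)\<^sup>2 \<le> c2 * d\<^sup>2"
            unfolding \<delta>(2)[symmetric] by (simp add: power_mult_distrib mult_ac)
        qed
        note z = gauss_decay_convolution_zero[OF sf assms(1) even f(1) _ g R(2,1) gd pos(3,4) n e]
        show "integrable M (\<lambda>i. a i * of_real (I j (u i / n)))"
          unfolding I_def by (rule z(1)) (rule f(2))
        show "(\<integral>i. a i * of_real (I j (u i / n)) \<partial>M) = 0"
          unfolding I_def by (rule z(2)) (rule f(2))
      qed
      have Gm [measurable]: "G \<in> borel_measurable borel"
        unfolding G_def w(2) by measurable
      have "(\<integral>i. a i * of_real (G (u i / n)) \<partial>M) = (\<integral>i. of_real k0 * (a i * of_real (f (u i / n)))
          + (\<Sum>j\<in>{1..S}. of_real (w j) * (a i * of_real (I j (u i / n)))) \<partial>M)"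
      proof (intro Bochner_Integration.integral_cong refl)
        fix i
        show "a i * of_real (G (u i / n)) = of_real k0 * (a i * of_real (f (u i / n)))
          + (\<Sum>j\<in>{1..S}. of_real (w j) * (a i * of_real (I j (u i / n))))"
          unfolding G of_real_add of_real_sum of_real_mult distrib_left sum_distrib_left
          by (intro arg_cong2[where f="(+)"] sum.cong refl) (simp_all only: mult_ac)
      qed
      also have "\<dots> = of_real k0 * (\<integral>i. a i * of_real (f (u i / n)) \<partial>M)
          + (\<Sum>j\<in>{1..S}. of_real (w j) * (\<integral>i. a i * of_real (I j (u i / n)) \<partial>M))"
        by (subst Bochner_Integration.integral_add, intro integrable_mult_right iF,
            intro Bochner_Integration.integrable_sum integrable_mult_right I0(1), assumption,
            subst Bochner_Integration.integral_sum, intro integrable_mult_right I0(1), assumption,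
            simp only: integral_mult_right_zero)
      also have "\<dots> = of_real k0 * (\<integral>i. a i * of_real (f (u i / n)) \<partial>M)" using I0(2) by simp
      finally have eq: "(\<integral>i. a i * of_real (G (u i / n)) \<partial>M) = of_real k0 * (\<integral>i. a i * of_real (f (u i / n)) \<partial>M)" .
      have "norm (\<integral>i. a i * of_real (G (u i / n)) \<partial>M) \<le> C0 * (1 / b) ^ S * (2 ^ m * c * n powr Q)"
      proof (rule poly_growth_integrable(2)[OF g m(2) n])
        show "(\<lambda>i. complex_of_real (G (u i / n))) \<in> borel_measurable M" by measurable
        show "norm (complex_of_real (G (u i / n))) \<le> C0 * (1 / b) ^ S * (1 / (1 + u i / n)) ^ m"
          if "i \<in> space M" for i
          using C0(2)[OF b, of "u i / n"] u[OF that] n unfolding G_def norm_of_real by simp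
      qed (use C0(1) b in simp)
      then have "k0 * ?X \<le> C0 * (1 / b) ^ S * (2 ^ m * c * n powr Q)"
        unfolding eq norm_mult using k0 by simp
      then have "?X * k0 \<le> C0 * (1 / b) ^ S * (2 ^ m * c * n powr Q)" by (simp only: mult.commute)
      then have "?X \<le> C0 * (1 / b) ^ S * (2 ^ m * c * n powr Q) / k0"
        using k0 by (simp only: pos_le_divide_eq)
      also have "\<dots> = C2 * n powr Q * (1 / b) ^ S" by (simp add: C2_def)
      finally have "?X \<le> C2 * n powr Q * (1 / b) ^ S" .
      then have "?X * (n * d) ^ S \<le> (C2 * n powr Q * (1 / b) ^ S) * (b / \<delta>) ^ S"
        unfolding nd(1) using b \<delta> by (intro mult_right_mono) auto
      also have "\<dots> = (C2 / \<delta> ^ S) * n powr Q" using b by (simp add: power_divide)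
      also have "\<dots> \<le> C * n powr Q" by (intro mult_right_mono) (simp_all add: C_def)
      finally show ?thesis .
    qed
  qed
qed

section \<open>Lebesgue spaces\<close>

lemma ennreal_exponent:
  fixes p :: ennreal
  assumes "1 \<le> p" "p \<noteq> \<infinity>"
  shows "1 \<le> enn2real p" "enn2real (1 / p) = 1 / enn2real p"
proof -
  obtain r where r: "p = ennreal r" "0 \<le> r" using assms(2) by (cases p) auto
  have "1 \<le> r" using assms(1) r by (simp add: ennreal_1[symmetric] del: ennreal_1)
  moreover have "1 / ennreal r = ennreal (1 / r)"
    using \<open>1 \<le> r\<close> divide_ennreal[of 1 r] by simp
  ultimately show "1 \<le> enn2real p" "enn2real (1 / p) = 1 / enn2real p"
    using r by simp_all
qed

text \<open>Convexity on the open half-line gives the case \<open>x > 0\<close>; the endpoint 0 is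
  treated by hand because the functions in question may vanish. Both Minkowski's inequality and the
  weighted Hoelder inequality rest on this tangent.\<close>

lemma powr_above_tangent:
  fixes x t r :: real
  assumes r: "1 \<le> r" and x: "0 \<le> x" and t: "0 < t"
  shows "t powr r + r * t powr (r - 1) * (x - t) \<le> x powr r"
proof (cases "x = 0")
  case True
  have "t powr (r - 1) * t = t powr r" using t powr_add[of t "r - 1" 1] by simp
  then have "t powr r + r * t powr (r - 1) * (x - t) = (1 - r) * t powr r"
    using True by (simp add: algebra_simps)
  also have "\<dots> \<le> 0" using r by (simp add: mult_nonpos_nonneg)
  finally show ?thesis using True by simp
next
  case False
  have "r * t powr (r - 1) * (x - t) \<le> x powr r - t powr r"
  proof (rule convex_on_imp_above_tangent[of "{0<..}"])
    show "convex_on {0<..} (\<lambda>x. x powr r)" using r by (rule powr_convex)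
    show "((\<lambda>x. x powr r) has_field_derivative r * t powr (r - 1)) (at t within {0<..})"
      using has_real_derivative_powr[OF t] by (rule has_field_derivative_at_within)
    show "t \<in> interior {0<..}" using t by (simp add: interior_open open_greaterThan)
  qed (use x False in simp_all)
  then show ?thesis by simp
qed

lemma powr_convex_combination:
  fixes x y \<mu> r :: real
  assumes r: "1 \<le> r" and xy: "0 \<le> x" "0 \<le> y" and \<mu>: "0 \<le> \<mu>" "\<mu> \<le> 1"
  shows "(\<mu> * x + (1 - \<mu>) * y) powr r \<le> \<mu> * x powr r + (1 - \<mu>) * y powr r"
proof (cases "\<mu> * x + (1 - \<mu>) * y = 0")
  case False
  define t where "t = \<mu> * x + (1 - \<mu>) * y"
  have t: "0 < t" using False xy \<mu> by (simp add: t_def order_less_le)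
  have "\<mu> * (t powr r + r * t powr (r - 1) * (x - t)) + (1 - \<mu>) * (t powr r + r * t powr (r - 1) * (y - t))
      \<le> \<mu> * x powr r + (1 - \<mu>) * y powr r"
    using \<mu> powr_above_tangent[OF r xy(1) t] powr_above_tangent[OF r xy(2) t]
    by (intro add_mono mult_left_mono) auto
  moreover have "\<mu> * (t powr r + r * t powr (r - 1) * (x - t)) + (1 - \<mu>) * (t powr r + r * t powr (r - 1) * (y - t))
      = t powr r + r * t powr (r - 1) * (\<mu> * x + (1 - \<mu>) * y - t)" by (simp add: algebra_simps)
  ultimately show ?thesis by (simp add: t_def)
next
  case True
  then show ?thesis using \<mu> by (simp only: powr_0) (intro add_nonneg_nonneg mult_nonneg_nonneg, auto)
qed

lemma Lp_norm_nonneg: "0 \<le> Lp_norm M p f"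
  by (simp add: Lp_norm_def)

text \<open>For \<open>p < \<infinity>\<close> the bound is expressed by a nonnegative integral, so that no
  integrability has to be established beforehand.\<close>

lemma Lp_norm_le_iff:
  assumes p: "1 \<le> p" and B: "0 \<le> B"
  shows "f \<in> Lp_space M p \<and> Lp_norm M p f \<le> B \<longleftrightarrow> f \<in> borel_measurable M \<and>
    (if p = \<infinity> then AE x in M. norm (f x) \<le> B
     else (\<integral>\<^sup>+x. ennreal (norm (f x) powr enn2real p) \<partial>M) \<le> ennreal (B powr enn2real p))"
proof (cases "f \<in> borel_measurable M")
  case [measurable]: True
  show ?thesis
  proof (cases "p = \<infinity>")
    case True
    let ?e = "esssup M (\<lambda>x. ennreal (norm (f x)))"
    have m: "(\<lambda>x. ennreal (norm (f x))) \<in> borel_measurable M" by measurable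
    have "f \<in> Lp_space M p \<and> Lp_norm M p f \<le> B \<longleftrightarrow> ?e < \<infinity> \<and> enn2real ?e \<le> B"
      using True by (simp add: Lp_space_def Lp_norm_def)
    also have "\<dots> \<longleftrightarrow> ?e \<le> ennreal B"
      using B by (cases ?e) (auto simp: top_unique)
    also have "\<dots> \<longleftrightarrow> (AE x in M. norm (f x) \<le> B)"
    proof
      assume e: "?e \<le> ennreal B"
      have "AE x in M. ennreal (norm (f x)) \<le> ?e" by (rule esssup_AE)
      then show "AE x in M. norm (f x) \<le> B"
      proof (rule AE_mp, intro AE_I2 impI)
        fix x assume "ennreal (norm (f x)) \<le> ?e"
        then have "ennreal (norm (f x)) \<le> ennreal B" using e by (rule order.trans)
        then show "norm (f x) \<le> B" using B by (simp add: ennreal_le_iff)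
      qed
    next
      assume "AE x in M. norm (f x) \<le> B"
      then show "?e \<le> ennreal B"
        by (intro esssup_I m) (auto intro: ennreal_leI)
    qed
    finally show ?thesis using True by simp
  next
    case False
    define r where "r = enn2real p"
    have r: "1 \<le> r" "enn2real (1 / p) = 1 / r" using ennreal_exponent[OF p False] by (auto simp: r_def)
    let ?g = "\<lambda>x. norm (f x) powr r"
    have "f \<in> Lp_space M p \<and> Lp_norm M p f \<le> B \<longleftrightarrow> integrable M ?g \<and> (\<integral>x. ?g x \<partial>M) powr (1 / r) \<le> B"
      using False r by (simp add: Lp_space_def Lp_norm_def r_def)
    also have "\<dots> \<longleftrightarrow> integrable M ?g \<and> (\<integral>x. ?g x \<partial>M) \<le> B powr r"
    proof -
      have i: "0 \<le> (\<integral>x. ?g x \<partial>M)" by (intro Bochner_Integration.integral_nonneg) auto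
      have "(\<integral>x. ?g x \<partial>M) powr (1 / r) \<le> B \<longleftrightarrow> (\<integral>x. ?g x \<partial>M) \<le> B powr r"
      proof
        assume "(\<integral>x. ?g x \<partial>M) powr (1 / r) \<le> B"
        then have "((\<integral>x. ?g x \<partial>M) powr (1 / r)) powr r \<le> B powr r" using r by (intro powr_mono2) auto
        then show "(\<integral>x. ?g x \<partial>M) \<le> B powr r" using r i by (simp add: powr_powr)
      next
        assume "(\<integral>x. ?g x \<partial>M) \<le> B powr r"
        then have "(\<integral>x. ?g x \<partial>M) powr (1 / r) \<le> (B powr r) powr (1 / r)" using r i by (intro powr_mono2) auto
        then show "(\<integral>x. ?g x \<partial>M) powr (1 / r) \<le> B" using r B by (simp add: powr_powr)
      qed
      then show ?thesis by simp
    qed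
    also have "\<dots> \<longleftrightarrow> (\<integral>\<^sup>+x. ennreal (?g x) \<partial>M) \<le> ennreal (B powr r)"
    proof
      assume *: "integrable M ?g \<and> (\<integral>x. ?g x \<partial>M) \<le> B powr r"
      then have "(\<integral>\<^sup>+x. ennreal (?g x) \<partial>M) = ennreal (\<integral>x. ?g x \<partial>M)"
        by (intro nn_integral_eq_integral) auto
      then show "(\<integral>\<^sup>+x. ennreal (?g x) \<partial>M) \<le> ennreal (B powr r)" using * by (simp add: ennreal_leI)
    next
      assume *: "(\<integral>\<^sup>+x. ennreal (?g x) \<partial>M) \<le> ennreal (B powr r)"
      have i: "integrable M ?g"
      proof (rule integrableI_bounded)
        show "(\<integral>\<^sup>+x. ennreal (norm (?g x)) \<partial>M) < \<infinity>"
          using * by (auto intro: le_less_trans simp: less_top)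
      qed measurable
      have "(\<integral>\<^sup>+x. ennreal (?g x) \<partial>M) = ennreal (\<integral>x. ?g x \<partial>M)"
        by (intro nn_integral_eq_integral i) auto
      with * i show "integrable M ?g \<and> (\<integral>x. ?g x \<partial>M) \<le> B powr r" by simp
    qed
    finally show ?thesis using False by (simp add: r_def)
  qed
next
  case False
  then show ?thesis by (simp add: Lp_space_def)
qed

lemma Lp_space_measurable: "f \<in> Lp_space M p \<Longrightarrow> f \<in> borel_measurable M"
  by (simp add: Lp_space_def)

lemma Lp_space_AE_le:
  "f \<in> Lp_space M \<infinity> \<Longrightarrow> AE x in M. norm (f x) \<le> Lp_norm M \<infinity> f"
  using Lp_norm_le_iff[of \<infinity> "Lp_norm M \<infinity> f" f M] by (simp add: Lp_norm_nonneg)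

lemma Lp_space_nn_integral_le:
  assumes "1 \<le> p" "p \<noteq> \<infinity>" "f \<in> Lp_space M p" "Lp_norm M p f \<le> B"
  shows "(\<integral>\<^sup>+x. ennreal (norm (f x) powr enn2real p) \<partial>M) \<le> ennreal (B powr enn2real p)"
  using Lp_norm_le_iff[of p B f M] assms order_trans[OF Lp_norm_nonneg[of M p f]] by simp

lemma Lp_norm_cong_norm:
  assumes "f \<in> borel_measurable M" "g \<in> Lp_space M p" "\<And>x. x \<in> space M \<Longrightarrow> norm (f x) = norm (g x)"
  shows "f \<in> Lp_space M p" "Lp_norm M p f = Lp_norm M p g"
proof -
  have e: "esssup M (\<lambda>x. ennreal (norm (f x))) = esssup M (\<lambda>x. ennreal (norm (g x)))"
    using assms by (intro esssup_AE_cong) (auto simp: Lp_space_def)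
  have i: "integrable M (\<lambda>x. norm (f x) powr r) \<longleftrightarrow> integrable M (\<lambda>x. norm (g x) powr r)"
      "(\<integral>x. norm (f x) powr r \<partial>M) = (\<integral>x. norm (g x) powr r \<partial>M)" for r
    using assms(3) by (auto intro!: Bochner_Integration.integrable_cong Bochner_Integration.integral_cong)
  show "f \<in> Lp_space M p" using assms(1,2) by (auto simp: Lp_space_def e i split: if_splits)
  show "Lp_norm M p f = Lp_norm M p g" by (simp add: Lp_norm_def e i)
qed

text \<open>Minkowski's inequality by convexity: the sum of the moduli is \<open>A + B\<close> times
  the convex combination of \<open>norm f / A\<close> and \<open>norm g / B\<close> with weights
  \<open>A / (A + B)\<close> and \<open>B / (A + B)\<close>. The norms are first enlarged by
  \<open>e > 0\<close>, so that no divisor vanishes for null functions.\<close>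

lemma Lp_add:
  assumes p: "1 \<le> p" and f: "f \<in> Lp_space M p" and g: "g \<in> Lp_space M p"
  shows "(\<lambda>x. f x + g x) \<in> Lp_space M p" "Lp_norm M p (\<lambda>x. f x + g x) \<le> Lp_norm M p f + Lp_norm M p g"
proof -
  have [measurable]: "f \<in> borel_measurable M" "g \<in> borel_measurable M"
    using f g by (auto simp: Lp_space_def)
  let ?A = "Lp_norm M p f" and ?B = "Lp_norm M p g"
  have *: "(\<lambda>x. f x + g x) \<in> Lp_space M p \<and> Lp_norm M p (\<lambda>x. f x + g x) \<le> (?A + e) + (?B + e)" if e: "e > 0" for e
  proof -
    define A B where "A = ?A + e" and "B = ?B + e"
    have AB: "A > 0" "B > 0" using e Lp_norm_nonneg[of M p f] Lp_norm_nonneg[of M p g] by (auto simp: A_def B_def)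
    have fA: "f \<in> Lp_space M p \<and> ?A \<le> A" and gB: "g \<in> Lp_space M p \<and> ?B \<le> B"
      using f g e by (auto simp: A_def B_def)
    have "(\<lambda>x. f x + g x) \<in> Lp_space M p \<and> Lp_norm M p (\<lambda>x. f x + g x) \<le> A + B"
    proof (cases "p = \<infinity>")
      case True
      have "AE x in M. norm (f x) \<le> A" "AE x in M. norm (g x) \<le> B"
        using Lp_norm_le_iff[OF p, of A f M] fA Lp_norm_le_iff[OF p, of B g M] gB AB True by auto
      then have "AE x in M. norm (f x + g x) \<le> A + B"
        by eventually_elim (rule norm_triangle_mono)
      moreover have "(\<lambda>x. f x + g x) \<in> borel_measurable M" by measurable
      ultimately show ?thesis using Lp_norm_le_iff[OF p, of "A + B" "\<lambda>x. f x + g x" M] AB True by simp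
    next
      case False
      define r where "r = enn2real p"
      have r: "1 \<le> r" using ennreal_exponent[OF p False] by (auto simp: r_def)
      define \<mu> where "\<mu> = A / (A + B)"
      have \<mu>: "0 \<le> \<mu>" "\<mu> \<le> 1" "1 - \<mu> = B / (A + B)" using AB by (auto simp: \<mu>_def field_simps)
      have F: "(\<integral>\<^sup>+x. ennreal (norm (f x) powr r) \<partial>M) \<le> ennreal (A powr r)"
        and G: "(\<integral>\<^sup>+x. ennreal (norm (g x) powr r) \<partial>M) \<le> ennreal (B powr r)"
        using Lp_space_nn_integral_le[OF p False] fA gB by (auto simp: r_def)
      have pt: "norm (f x + g x) powr r \<le> (A + B) powr r * \<mu> / A powr r * norm (f x) powr r
          + (A + B) powr r * (1 - \<mu>) / B powr r * norm (g x) powr r" for x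
      proof -
        have "norm (f x + g x) powr r \<le> (norm (f x) + norm (g x)) powr r"
          using r by (intro powr_mono2 norm_triangle_ineq) auto
        also have "norm (f x) + norm (g x) = (A + B) * (\<mu> * (norm (f x) / A) + (1 - \<mu>) * (norm (g x) / B))"
        proof -
          have "(A + B) * (A / (A + B) * (X / A) + B / (A + B) * (Y / B)) = X + Y" for X Y
            using AB by (simp add: distrib_left)
          then show ?thesis unfolding \<mu>(3) by (simp add: \<mu>_def)
        qed
        also have "\<dots> powr r = (A + B) powr r * (\<mu> * (norm (f x) / A) + (1 - \<mu>) * (norm (g x) / B)) powr r"
          using AB \<mu> by (intro powr_mult)
        also have "\<dots> \<le> (A + B) powr r * (\<mu> * (norm (f x) / A) powr r + (1 - \<mu>) * (norm (g x) / B) powr r)"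
          using AB \<mu> r by (intro mult_left_mono powr_convex_combination) auto
        also have "\<dots> = (A + B) powr r * \<mu> / A powr r * norm (f x) powr r
          + (A + B) powr r * (1 - \<mu>) / B powr r * norm (g x) powr r"
          using AB by (simp add: powr_divide distrib_left)
        finally show ?thesis .
      qed
      have c: "0 \<le> (A + B) powr r * \<mu> / A powr r" "0 \<le> (A + B) powr r * (1 - \<mu>) / B powr r"
        using AB \<mu> by auto
      have "(\<integral>\<^sup>+x. ennreal (norm (f x + g x) powr r) \<partial>M)
        \<le> (\<integral>\<^sup>+x. ennreal ((A + B) powr r * \<mu> / A powr r) * ennreal (norm (f x) powr r)
          + ennreal ((A + B) powr r * (1 - \<mu>) / B powr r) * ennreal (norm (g x) powr r) \<partial>M)"
      proof (intro nn_integral_mono)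
        fix x
        show "ennreal (norm (f x + g x) powr r) \<le> ennreal ((A + B) powr r * \<mu> / A powr r) * ennreal (norm (f x) powr r)
          + ennreal ((A + B) powr r * (1 - \<mu>) / B powr r) * ennreal (norm (g x) powr r)"
          using ennreal_leI[OF pt[of x]] unfolding ennreal_mult'[OF c(1), symmetric] ennreal_mult'[OF c(2), symmetric]
          by (subst ennreal_plus[symmetric]) (simp_all only: mult_nonneg_nonneg c powr_ge_zero)
      qed
      also have "\<dots> = ennreal ((A + B) powr r * \<mu> / A powr r) * (\<integral>\<^sup>+x. ennreal (norm (f x) powr r) \<partial>M)
          + ennreal ((A + B) powr r * (1 - \<mu>) / B powr r) * (\<integral>\<^sup>+x. ennreal (norm (g x) powr r) \<partial>M)"
        by (simp add: nn_integral_add nn_integral_cmult)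
      also have "\<dots> \<le> ennreal ((A + B) powr r * \<mu> / A powr r) * ennreal (A powr r)
          + ennreal ((A + B) powr r * (1 - \<mu>) / B powr r) * ennreal (B powr r)"
        by (intro add_mono mult_left_mono F G) auto
      also have "\<dots> = ennreal ((A + B) powr r * \<mu> / A powr r * A powr r + (A + B) powr r * (1 - \<mu>) / B powr r * B powr r)"
        unfolding ennreal_mult'[OF c(1), symmetric] ennreal_mult'[OF c(2), symmetric]
        by (subst ennreal_plus) (simp_all only: mult_nonneg_nonneg c powr_ge_zero)
      also have "\<dots> = ennreal ((A + B) powr r)"
      proof -
        have "(A + B) powr r * \<mu> / A powr r * A powr r + (A + B) powr r * (1 - \<mu>) / B powr r * B powr r
            = (A + B) powr r * \<mu> + (A + B) powr r * (1 - \<mu>)"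
          using AB by simp
        also have "\<dots> = (A + B) powr r" by (simp add: algebra_simps)
        finally show ?thesis by (rule arg_cong)
      qed
      finally have "(\<integral>\<^sup>+x. ennreal (norm (f x + g x) powr r) \<partial>M) \<le> ennreal ((A + B) powr r)" .
      moreover have "(\<lambda>x. f x + g x) \<in> borel_measurable M" by measurable
      ultimately show ?thesis
        using Lp_norm_le_iff[OF p, of "A + B" "\<lambda>x. f x + g x" M] AB False by (simp add: r_def)
    qed
    then show ?thesis by (simp add: A_def B_def)
  qed
  show "(\<lambda>x. f x + g x) \<in> Lp_space M p" using *[of 1] by simp
  show "Lp_norm M p (\<lambda>x. f x + g x) \<le> ?A + ?B"
  proof (rule field_le_epsilon)
    fix e :: real assume "e > 0"
    then show "Lp_norm M p (\<lambda>x. f x + g x) \<le> ?A + ?B + e" using *[of "e / 2"] by simp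
  qed
qed

lemma Lp_uminus:
  assumes "g \<in> Lp_space M p"
  shows "(\<lambda>x. - g x) \<in> Lp_space M p" "Lp_norm M p (\<lambda>x. - g x) = Lp_norm M p g"
proof -
  have m: "(\<lambda>x. - g x) \<in> borel_measurable M" using Lp_space_measurable[OF assms] by measurable
  show "(\<lambda>x. - g x) \<in> Lp_space M p" by (rule Lp_norm_cong_norm(1)[OF m assms]) simp
  show "Lp_norm M p (\<lambda>x. - g x) = Lp_norm M p g" by (rule Lp_norm_cong_norm(2)[OF m assms]) simp
qed

lemma Lp_diff:
  assumes "1 \<le> p" "f \<in> Lp_space M p" "g \<in> Lp_space M p"
  shows "(\<lambda>x. f x - g x) \<in> Lp_space M p" "Lp_norm M p (\<lambda>x. f x - g x) \<le> Lp_norm M p f + Lp_norm M p g"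
  using Lp_add[OF assms(1,2) Lp_uminus(1)[OF assms(3)]] Lp_uminus(2)[OF assms(3)] by simp_all

lemma Lp_zero: "1 \<le> p \<Longrightarrow> (\<lambda>x. 0) \<in> Lp_space M p \<and> Lp_norm M p (\<lambda>x. 0) = 0"
  using Lp_norm_le_iff[of p 0 "\<lambda>x. 0" M] Lp_norm_nonneg[of M p "\<lambda>x. 0"] by (auto simp: order_antisym)

section \<open>Completeness\<close>

lemma Lp_telescope:
  assumes p: "1 \<le> p" and s: "\<And>n. s n \<in> Lp_space M p" and n: "n \<le> N"
    and b: "\<And>m. m \<ge> n \<Longrightarrow> Lp_norm M p (\<lambda>x. s (Suc m) x - s m x) \<le> b m"
  shows "Lp_norm M p (\<lambda>x. s N x - s n x) \<le> (\<Sum>m=n..<N. b m)"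
  using n
proof (induction N rule: dec_induct)
  case base
  then show ?case using Lp_zero[OF p, of M] by simp
next
  case (step k)
  have "Lp_norm M p (\<lambda>x. (s (Suc k) x - s k x) + (s k x - s n x))
      \<le> Lp_norm M p (\<lambda>x. s (Suc k) x - s k x) + Lp_norm M p (\<lambda>x. s k x - s n x)"
    by (intro Lp_add(2) Lp_diff(1) p s)
  then show ?case using step b[of k] by simp
qed

lemma Lp_fatou:
  assumes p: "1 \<le> p" and B: "0 \<le> B" and s: "\<And>n. s n \<in> Lp_space M p" "\<And>n. Lp_norm M p (s n) \<le> B"
    and [measurable]: "f \<in> borel_measurable M" and lim: "AE x in M. (\<lambda>n. s n x) \<longlonglongrightarrow> f x"
  shows "f \<in> Lp_space M p \<and> Lp_norm M p f \<le> B"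
proof (cases "p = \<infinity>")
  case True
  have "AE x in M. norm (s n x) \<le> B" for n
    using s Lp_norm_le_iff[OF p B, of "s n" M] True by simp
  then have "AE x in M. \<forall>n. norm (s n x) \<le> B" by (simp add: AE_all_countable)
  with lim have "AE x in M. norm (f x) \<le> B"
    by eventually_elim (auto intro: LIMSEQ_le_const2 tendsto_norm)
  then show ?thesis using Lp_norm_le_iff[OF p B, of f M] True by simp
next
  case False
  define r where "r = enn2real p"
  have r: "1 \<le> r" using ennreal_exponent[OF p False] by (auto simp: r_def)
  have [measurable]: "s n \<in> borel_measurable M" for n using s by (auto simp: Lp_space_def)
  have "(\<integral>\<^sup>+x. ennreal (norm (f x) powr r) \<partial>M) = (\<integral>\<^sup>+x. liminf (\<lambda>n. ennreal (norm (s n x) powr r)) \<partial>M)"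
  proof (intro nn_integral_cong_AE)
    show "AE x in M. ennreal (norm (f x) powr r) = liminf (\<lambda>n. ennreal (norm (s n x) powr r))"
      using lim
    proof eventually_elim
      case (elim x)
      have "(\<lambda>n. ennreal (norm (s n x) powr r)) \<longlonglongrightarrow> ennreal (norm (f x) powr r)"
        using r by (intro tendsto_ennrealI tendsto_powr2 tendsto_norm elim tendsto_const) auto
      from lim_imp_Liminf[OF sequentially_bot this] show ?case ..
    qed
  qed
  also have "\<dots> \<le> liminf (\<lambda>n. \<integral>\<^sup>+x. ennreal (norm (s n x) powr r) \<partial>M)"
    by (intro nn_integral_liminf) measurable
  also have "\<dots> \<le> liminf (\<lambda>n::nat. ennreal (B powr r))"
    using Lp_space_nn_integral_le[OF p False s] by (intro Liminf_mono) (auto simp: r_def)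
  also have "\<dots> = ennreal (B powr r)" by (simp add: Liminf_const)
  finally show ?thesis using Lp_norm_le_iff[OF p B, of f M] False by (simp add: r_def)
qed

text \<open>By Minkowski the partial sums \<open>H N\<close> of the moduli have norms below
  \<open>suminf b\<close>; monotone convergence then makes the supremum of their \<open>r\<close>-th
  powers finite almost everywhere.\<close>

lemma Lp_absolutely_convergent_AE:
  assumes p: "1 \<le> p" and g: "\<And>n::nat. g n \<in> Lp_space M p"
    and b: "\<And>n. Lp_norm M p (g n) \<le> b n" "summable b"
  shows "AE x in M. summable (\<lambda>n. norm (g n x))"
proof -
  have [measurable]: "g n \<in> borel_measurable M" for n using g by (auto simp: Lp_space_def)
  have b0: "0 \<le> b n" for n using order_trans[OF Lp_norm_nonneg b(1)] .
  show ?thesis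
  proof (cases "p = \<infinity>")
    case True
    have "AE x in M. norm (g n x) \<le> b n" for n
      using g b Lp_norm_le_iff[OF p b0, of "g n" M n] True by simp
    then have "AE x in M. \<forall>n. norm (g n x) \<le> b n" by (simp add: AE_all_countable)
    then show ?thesis
      by eventually_elim (auto intro!: summable_comparison_test'[OF b(2)])
  next
    case False
    define r where "r = enn2real p"
    have r: "1 \<le> r" using ennreal_exponent[OF p False] by (auto simp: r_def)
    define H where "H N x = (\<Sum>n<N. norm (g n x))" for N x
    have H0: "0 \<le> H N x" for N x by (simp add: H_def sum_nonneg)
    have [measurable]: "H N \<in> borel_measurable M" for N unfolding H_def by measurable
    have HL: "(\<lambda>x. of_real (H N x)) \<in> Lp_space M p \<and> Lp_norm M p (\<lambda>x. of_real (H N x)) \<le> (\<Sum>n<N. b n)" for N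
    proof (induction N)
      case 0
      then show ?case using Lp_zero[OF p, of M] by (simp add: H_def)
    next
      case (Suc N)
      have n: "(\<lambda>x. of_real (norm (g N x))) \<in> Lp_space M p" "Lp_norm M p (\<lambda>x. of_real (norm (g N x))) = Lp_norm M p (g N)"
        by (intro Lp_norm_cong_norm[OF _ g[of N]]; simp)+
      show ?case using Lp_add[OF p Suc[THEN conjunct1] n(1)] Suc n(2) b(1)[of N] by (simp add: H_def)
    qed
    define T where "T = suminf b"
    have T: "(\<integral>\<^sup>+x. ennreal (H N x powr r) \<partial>M) \<le> ennreal (T powr r)" for N
    proof -
      have "(\<Sum>n<N. b n) \<le> T" unfolding T_def by (intro sum_le_suminf b) (auto simp: b0)
      then show ?thesis
        using Lp_space_nn_integral_le[OF p False HL[of N, THEN conjunct1], of T] HL[of N] H0[of N] by (simp add: r_def)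
    qed
    have "(\<integral>\<^sup>+x. (SUP N. ennreal (H N x powr r)) \<partial>M) = (SUP N. \<integral>\<^sup>+x. ennreal (H N x powr r) \<partial>M)"
      using H0 r by (intro nn_integral_monotone_convergence_SUP incseq_SucI le_funI ennreal_leI powr_mono2)
        (auto simp: H_def sum_nonneg)
    also have "\<dots> \<le> ennreal (T powr r)" by (intro SUP_least T)
    finally have "(\<integral>\<^sup>+x. (SUP N. ennreal (H N x powr r)) \<partial>M) \<noteq> \<infinity>" by (auto simp: top_unique)
    then have "AE x in M. (SUP N. ennreal (H N x powr r)) \<noteq> \<infinity>"
      by (intro nn_integral_PInf_AE) measurable
    then show ?thesis
    proof eventually_elim
      case (elim x)
      then obtain K where K: "0 \<le> K" "(SUP N. ennreal (H N x powr r)) = ennreal K"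
        by (cases "SUP N. ennreal (H N x powr r)") auto
      have "H N x \<le> 1 + K" for N
      proof -
        have "ennreal (H N x powr r) \<le> ennreal K" unfolding K(2)[symmetric] by (rule SUP_upper) simp
        then have "H N x powr r \<le> K" using K(1) by simp
        \<comment> \<open>As \<open>r \<ge> 1\<close>, this turns a bound on the powers into a bound
          on the partial sums without taking roots.\<close>
        moreover have "H N x \<le> 1 + H N x powr r"
        proof (cases "H N x \<le> 1")
          case False
          then have "H N x powr 1 \<le> H N x powr r" using r by (intro powr_mono) auto
          then show ?thesis using False by simp
        qed (simp add: add_increasing2)
        ultimately show ?thesis by linarith
      qed
      then show ?case
        by (intro summableI_nonneg_bounded[where x="1 + K"]) (auto simp: H_def)
    qed
  qed
qed

text \<open>Riesz-Fischer in a form that keeps the rate. The sequence converges almost everywhere,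
  and the value of \<open>lim\<close> on the exceptional null set is irrelevant; Fatou transfers the
  telescoped bound to the limit.\<close>

lemma Lp_complete:
  assumes p: "1 \<le> p" and s: "\<And>n. s n \<in> Lp_space M p"
    and b: "\<And>n. Lp_norm M p (\<lambda>x. s (Suc n) x - s n x) \<le> b n" "summable b"
  shows "\<exists>F\<in>Lp_space M p. \<forall>n. Lp_norm M p (\<lambda>x. F x - s n x) \<le> (\<Sum>m. b (m + n))"
proof -
  have [measurable]: "s n \<in> borel_measurable M" for n using s by (auto simp: Lp_space_def)
  have b0: "0 \<le> b n" for n using order_trans[OF Lp_norm_nonneg b(1)] .
  define F where "F x = lim (\<lambda>n. s n x)" for x
  have [measurable]: "F \<in> borel_measurable M" unfolding F_def by (rule borel_measurable_lim_metric) measurable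
  have "AE x in M. summable (\<lambda>n. norm (s (Suc n) x - s n x))"
    by (rule Lp_absolutely_convergent_AE[OF p Lp_diff(1)[OF p s s] b])
  then have lim: "AE x in M. (\<lambda>n. s n x) \<longlonglongrightarrow> F x"
  proof eventually_elim
    case (elim x)
    have "summable (\<lambda>n. s (Suc n) x - s n x)" using elim by (rule summable_norm_cancel)
    then have "(\<lambda>n. \<Sum>k<n. s (Suc k) x - s k x) \<longlonglongrightarrow> (\<Sum>n. s (Suc n) x - s n x)"
      by (rule summable_LIMSEQ)
    then have "(\<lambda>n. (s n x - s 0 x) + s 0 x) \<longlonglongrightarrow> (\<Sum>n. s (Suc n) x - s n x) + s 0 x"
      unfolding sum_lessThan_telescope[of "\<lambda>k. s k x"] by (intro tendsto_add tendsto_const)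
    then have "convergent (\<lambda>n. s n x)" by (simp add: convergentI)
    then show ?case by (simp add: F_def convergent_LIMSEQ_iff)
  qed
  have tail: "summable (\<lambda>m. b (m + n))" for n using b(2) by (simp add: summable_iff_shift)
  have Fs: "(\<lambda>x. F x - s n x) \<in> Lp_space M p \<and> Lp_norm M p (\<lambda>x. F x - s n x) \<le> (\<Sum>m. b (m + n))" for n
  proof (rule Lp_fatou[OF p, where s="\<lambda>k x. s (k + n) x - s n x"])
    show "0 \<le> (\<Sum>m. b (m + n))" by (intro suminf_nonneg tail) (auto simp: b0)
    show "(\<lambda>x. s (k + n) x - s n x) \<in> Lp_space M p" for k by (intro Lp_diff p s)
    show "Lp_norm M p (\<lambda>x. s (k + n) x - s n x) \<le> (\<Sum>m. b (m + n))" for k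
    proof -
      have "Lp_norm M p (\<lambda>x. s (k + n) x - s n x) \<le> (\<Sum>m=n..<k + n. b m)"
        by (rule Lp_telescope[where s=s, OF p s _ b(1)]) simp
      also have "\<dots> = (\<Sum>m<k. b (m + n))"
        using sum.shift_bounds_nat_ivl[of b 0 n k] by (simp add: atLeast0LessThan)
      also have "\<dots> \<le> (\<Sum>m. b (m + n))" by (intro sum_le_suminf tail) (auto simp: b0)
      finally show ?thesis .
    qed
    show "AE x in M. (\<lambda>k. s (k + n) x - s n x) \<longlonglongrightarrow> F x - s n x"
      using lim by eventually_elim (intro tendsto_diff tendsto_const LIMSEQ_ignore_initial_segment)
  qed measurable
  have "(\<lambda>x. (F x - s 0 x) + s 0 x) \<in> Lp_space M p"
    using Fs[of 0] by (intro Lp_add p s) auto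
  then have "F \<in> Lp_space M p" by simp
  then show ?thesis using Fs by blast
qed

lemma Lp_spaceI_bounded_integrable:
  assumes p: "1 \<le> p" and f: "integrable M f" and B: "\<And>x. x \<in> space M \<Longrightarrow> norm (f x) \<le> B"
  shows "f \<in> Lp_space M p"
proof (cases "p = \<infinity>")
  case True
  have "f \<in> Lp_space M p \<and> Lp_norm M p f \<le> max 0 B"
    using Lp_norm_le_iff[OF p, of "max 0 B" f M] f B True by (fastforce intro: AE_I2)
  then show ?thesis ..
next
  case False
  define r where "r = enn2real p"
  have r: "1 \<le> r" using ennreal_exponent[OF p False] by (auto simp: r_def)
  have [measurable]: "f \<in> borel_measurable M" using f by auto
  have "integrable M (\<lambda>x. norm (f x) powr r)"
  proof (rule Bochner_Integration.integrable_bound)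
    show "integrable M (\<lambda>x. B powr (r - 1) * norm (f x))" using f by simp
    show "AE x in M. norm (norm (f x) powr r) \<le> norm (B powr (r - 1) * norm (f x))"
    proof (intro AE_I2)
      fix x assume x: "x \<in> space M"
      show "norm (norm (f x) powr r) \<le> norm (B powr (r - 1) * norm (f x))"
      proof (cases "f x = 0")
        case False
        have "norm (f x) powr r = norm (f x) powr (r - 1) * norm (f x)"
          using False powr_add[of "norm (f x)" "r - 1" 1] by simp
        also have "\<dots> \<le> B powr (r - 1) * norm (f x)"
          using r B[OF x] by (intro mult_right_mono powr_mono2) auto
        finally show ?thesis by simp
      qed simp
    qed
  qed measurable
  then show ?thesis using False by (simp add: Lp_space_def r_def)
qed

section \<open>Schur's test and localized kernels\<close>

lemma norm_integral_le_nn_integral: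
  fixes f :: "'a \<Rightarrow> 'b :: {banach, second_countable_topology}"
  shows "ennreal (norm (\<integral>x. f x \<partial>M)) \<le> (\<integral>\<^sup>+x. ennreal (norm (f x)) \<partial>M)"
proof (cases "integrable M f")
  case True
  then show ?thesis by (rule integral_norm_bound_ennreal)
qed (simp add: not_integrable_integral_eq)

text \<open>In place of conjugate exponents the tangent to the \<open>r\<close>-th power at
  \<open>t\<close> is integrated against \<open>g\<close>; the choice \<open>t^r = a' / K\<close>
  balances the two terms. The number \<open>a'\<close> is taken strictly above the integral
  \<open>a\<close>, so that \<open>t > 0\<close> even when \<open>a = 0\<close>, and then decreases
  to \<open>a\<close>.\<close>

lemma Holder_weighted:
  fixes f g :: "'a \<Rightarrow> real"
  assumes [measurable]: "f \<in> borel_measurable M" "g \<in> borel_measurable M"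
    and nn: "\<And>y. 0 \<le> f y" "\<And>y. 0 \<le> g y" and r: "1 \<le> r" and K: "0 < K"
    and gK: "(\<integral>\<^sup>+y. ennreal (g y) \<partial>M) \<le> ennreal K"
    and x: "0 \<le> x" "ennreal x \<le> (\<integral>\<^sup>+y. ennreal (g y * f y) \<partial>M)"
  shows "ennreal (x powr r) \<le> ennreal (K powr (r - 1)) * (\<integral>\<^sup>+y. ennreal (g y * f y powr r) \<partial>M)"
proof (cases "\<integral>\<^sup>+y. ennreal (g y * f y powr r) \<partial>M")
  case (real a)
  have *: "x powr r \<le> K powr (r - 1) * a'" if a': "a' > a" for a'
  proof -
    have a'0: "a' > 0" using a' real by linarith
    define t where "t = (a' / K) powr (1 / r)"
    have t: "t > 0" "t powr r = a' / K" using a'0 K r by (auto simp: t_def powr_powr)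
    have pt: "f y \<le> (1 - 1 / r) * t + t powr (1 - r) / r * f y powr r" for y
    proof -
      have "t powr (r - 1) * f y \<le> t powr (r - 1) * t + (f y powr r - t powr r) / r"
        using powr_above_tangent[OF r nn(1)[of y] t(1)] r by (simp add: field_simps)
      also have "t powr (r - 1) * t = t powr r" using t powr_add[of t "r - 1" 1] by simp
      finally have "t powr (r - 1) * f y \<le> (1 - 1 / r) * t powr r + f y powr r / r"
        using r by (simp add: field_simps)
      then have "t powr (1 - r) * (t powr (r - 1) * f y) \<le> t powr (1 - r) * ((1 - 1 / r) * t powr r + f y powr r / r)"
        by (intro mult_left_mono) auto
      moreover have "t powr (1 - r) * (t powr (r - 1) * f y) = f y"
        using t by (simp add: mult.assoc[symmetric] powr_add[symmetric])
      moreover have "t powr (1 - r) * t powr r = t" using t(1) by (simp add: powr_add[symmetric])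
      then have "t powr (1 - r) * ((1 - 1 / r) * t powr r + f y powr r / r) = (1 - 1 / r) * t + t powr (1 - r) / r * f y powr r"
        by (simp add: distrib_left mult_ac)
      ultimately show ?thesis by simp
    qed
    have c: "0 \<le> (1 - 1 / r) * t" "0 \<le> t powr (1 - r) / r" using t r by (auto simp: divide_le_eq)
    have "ennreal x \<le> (\<integral>\<^sup>+y. ennreal ((1 - 1 / r) * t) * ennreal (g y) + ennreal (t powr (1 - r) / r) * ennreal (g y * f y powr r) \<partial>M)"
    proof (rule order.trans[OF x(2)], intro nn_integral_mono)
      fix y
      have "g y * f y \<le> g y * ((1 - 1 / r) * t + t powr (1 - r) / r * f y powr r)"
        using pt nn by (intro mult_left_mono)
      also have "\<dots> = (1 - 1 / r) * t * g y + t powr (1 - r) / r * (g y * f y powr r)"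
        by (simp only: distrib_left mult_ac)
      finally show "ennreal (g y * f y) \<le> ennreal ((1 - 1 / r) * t) * ennreal (g y) + ennreal (t powr (1 - r) / r) * ennreal (g y * f y powr r)"
        unfolding ennreal_mult'[OF c(1), symmetric] ennreal_mult'[OF c(2), symmetric]
        by (subst ennreal_plus[symmetric]) (simp_all only: mult_nonneg_nonneg nn c powr_ge_zero ennreal_leI)
    qed
    also have "\<dots> = ennreal ((1 - 1 / r) * t) * (\<integral>\<^sup>+y. ennreal (g y) \<partial>M) + ennreal (t powr (1 - r) / r) * (\<integral>\<^sup>+y. ennreal (g y * f y powr r) \<partial>M)"
      by (subst nn_integral_add, measurable, subst nn_integral_cmult, measurable, subst nn_integral_cmult, measurable)
    also have "\<dots> \<le> ennreal ((1 - 1 / r) * t) * ennreal K + ennreal (t powr (1 - r) / r) * ennreal a'"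
      using gK real a' by (intro add_mono mult_left_mono) (auto intro: ennreal_leI)
    also have "\<dots> = ennreal ((1 - 1 / r) * t * K + t powr (1 - r) / r * a')"
      unfolding ennreal_mult'[OF c(1), symmetric] ennreal_mult'[OF c(2), symmetric]
      using c K a'0 by (subst ennreal_plus) (simp_all only: mult_nonneg_nonneg less_imp_le)
    also have "\<dots> = ennreal (t * K)"
    proof -
      have "t powr (1 - r) * a' = t powr (1 - r) * (t powr r * K)" using t K by simp
      also have "\<dots> = t * K" using t(1) by (simp add: mult.assoc[symmetric] powr_add[symmetric])
      finally have "t powr (1 - r) / r * a' = t * K / r" by simp
      then show ?thesis using r by (simp add: algebra_simps)
    qed
    finally have "x \<le> t * K" using t K by (simp add: ennreal_le_iff)
    then have "x powr r \<le> (t * K) powr r" using x r by (intro powr_mono2) auto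
    also have "\<dots> = a' / K * K powr r" using t K by (simp add: powr_mult)
    also have "\<dots> = K powr (r - 1) * a'" using K by (simp add: powr_diff)
    finally show ?thesis .
  qed
  have "x powr r \<le> K powr (r - 1) * a"
  proof (rule field_le_epsilon)
    fix e :: real assume e: "e > 0"
    have "x powr r \<le> K powr (r - 1) * (a + e / K powr (r - 1))" using e K by (intro *) simp
    then show "x powr r \<le> K powr (r - 1) * a + e" using K by (simp add: distrib_left)
  qed
  then show ?thesis unfolding real(2) by (subst ennreal_mult'[symmetric]) (auto intro: ennreal_leI)
next
  case top
  then show ?thesis using K by (simp add: ennreal_mult_top)
qed

text \<open>Weighted Hoelder in \<open>y\<close> costs \<open>K1 ^ (r - 1)\<close>; after exchanging
  the integrals the columns cost \<open>K2\<close>, and the \<open>r\<close>-th root gives the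
  stated exponents. For \<open>p = \<infinity>\<close> the rows alone suffice, since
  \<open>K2\<close> then has exponent 0.\<close>

lemma schur_test_Lp:
  fixes \<Phi> :: "'a \<Rightarrow> 'b \<Rightarrow> complex"
  assumes sf: "sigma_finite_measure M1" "sigma_finite_measure M2"
    and \<Phi> [measurable]: "case_prod \<Phi> \<in> borel_measurable (M1 \<Otimes>\<^sub>M M2)"
    and row: "\<And>x. x \<in> space M1 \<Longrightarrow> (\<integral>\<^sup>+y. ennreal (norm (\<Phi> x y)) \<partial>M2) \<le> ennreal K1"
    and col: "\<And>y. y \<in> space M2 \<Longrightarrow> (\<integral>\<^sup>+x. ennreal (norm (\<Phi> x y)) \<partial>M1) \<le> ennreal K2"
    and K: "0 < K1" "0 < K2" and p: "1 \<le> p" and f: "f \<in> Lp_space M2 p"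
    and T: "\<And>x. x \<in> space M1 \<Longrightarrow> T x = (\<integral>y. \<Phi> x y * f y \<partial>M2)"
  shows "T \<in> Lp_space M1 p \<and>
    Lp_norm M1 p T \<le> K1 powr (1 - enn2real (1 / p)) * K2 powr enn2real (1 / p) * Lp_norm M2 p f"
proof -
  interpret M1: sigma_finite_measure M1 by (rule sf)
  interpret M2: sigma_finite_measure M2 by (rule sf)
  interpret pair_sigma_finite M1 M2 ..
  have fm [measurable]: "f \<in> borel_measurable M2" using f by (rule Lp_space_measurable)
  have "(\<lambda>x. \<integral>y. \<Phi> x y * f y \<partial>M2) \<in> borel_measurable M1" by measurable
  then have Tm [measurable]: "T \<in> borel_measurable M1" using T by (subst measurable_cong)
  have Tle: "ennreal (norm (T x)) \<le> (\<integral>\<^sup>+y. ennreal (norm (\<Phi> x y) * norm (f y)) \<partial>M2)" if "x \<in> space M1" for x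
    unfolding T[OF that] norm_mult[symmetric] by (rule norm_integral_le_nn_integral)
  let ?N = "Lp_norm M2 p f"
  have N: "0 \<le> ?N" by (rule Lp_norm_nonneg)
  show ?thesis
  proof (cases "p = \<infinity>")
    case True
    have fA: "AE y in M2. norm (f y) \<le> ?N" using f Lp_space_AE_le True by blast
    have "norm (T x) \<le> K1 * ?N" if x: "x \<in> space M1" for x
    proof -
      have [measurable]: "(\<lambda>y. \<Phi> x y) \<in> borel_measurable M2" using x by measurable
      have "ennreal (norm (T x)) \<le> (\<integral>\<^sup>+y. ennreal (norm (\<Phi> x y)) * ennreal ?N \<partial>M2)"
      proof (rule order.trans[OF Tle[OF x]], rule nn_integral_mono_AE)
        show "AE y in M2. ennreal (norm (\<Phi> x y) * norm (f y)) \<le> ennreal (norm (\<Phi> x y)) * ennreal ?N"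
          using fA by eventually_elim (simp add: ennreal_mult'[symmetric] ennreal_leI mult_left_mono)
      qed
      also have "\<dots> = (\<integral>\<^sup>+y. ennreal (norm (\<Phi> x y)) \<partial>M2) * ennreal ?N" by (rule nn_integral_multc) measurable
      also have "\<dots> \<le> ennreal K1 * ennreal ?N" by (intro mult_right_mono row x) auto
      finally show ?thesis using K N by (simp add: ennreal_mult'[symmetric])
    qed
    then have "AE x in M1. norm (T x) \<le> K1 * ?N" by (intro AE_I2)
    then have "T \<in> Lp_space M1 p \<and> Lp_norm M1 p T \<le> K1 * ?N"
      using Lp_norm_le_iff[OF p, of "K1 * ?N" T M1] K N Tm True by simp
    then show ?thesis using True K by simp
  next
    case False
    define r where "r = enn2real p"
    have r: "1 \<le> r" "enn2real (1 / p) = 1 / r" using ennreal_exponent[OF p False] by (auto simp: r_def)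
    have fN: "(\<integral>\<^sup>+y. ennreal (norm (f y) powr r) \<partial>M2) \<le> ennreal (?N powr r)"
      using Lp_space_nn_integral_le[OF p False f order.refl] by (simp add: r_def)
    have "(\<integral>\<^sup>+x. ennreal (norm (T x) powr r) \<partial>M1)
       \<le> (\<integral>\<^sup>+x. ennreal (K1 powr (r - 1)) * (\<integral>\<^sup>+y. ennreal (norm (\<Phi> x y) * norm (f y) powr r) \<partial>M2) \<partial>M1)"
    proof (intro nn_integral_mono)
      fix x assume x: "x \<in> space M1"
      have [measurable]: "(\<lambda>y. \<Phi> x y) \<in> borel_measurable M2" using x by measurable
      show "ennreal (norm (T x) powr r) \<le> ennreal (K1 powr (r - 1)) * (\<integral>\<^sup>+y. ennreal (norm (\<Phi> x y) * norm (f y) powr r) \<partial>M2)"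
        by (rule Holder_weighted[OF _ _ _ _ r(1) K(1) row[OF x] _ Tle[OF x]]) auto
    qed
    also have "\<dots> = ennreal (K1 powr (r - 1)) * (\<integral>\<^sup>+x. \<integral>\<^sup>+y. ennreal (norm (\<Phi> x y) * norm (f y) powr r) \<partial>M2 \<partial>M1)"
      by (rule nn_integral_cmult) measurable
    also have "\<dots> = ennreal (K1 powr (r - 1)) * (\<integral>\<^sup>+y. \<integral>\<^sup>+x. ennreal (norm (\<Phi> x y) * norm (f y) powr r) \<partial>M1 \<partial>M2)"
      by (subst Fubini'[symmetric]) simp_all
    also have "\<dots> \<le> ennreal (K1 powr (r - 1)) * (\<integral>\<^sup>+y. ennreal K2 * ennreal (norm (f y) powr r) \<partial>M2)"
    proof (intro mult_left_mono nn_integral_mono)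
      fix y assume y: "y \<in> space M2"
      have [measurable]: "(\<lambda>x. \<Phi> x y) \<in> borel_measurable M1" using y by measurable
      have "(\<integral>\<^sup>+x. ennreal (norm (\<Phi> x y) * norm (f y) powr r) \<partial>M1) = (\<integral>\<^sup>+x. ennreal (norm (\<Phi> x y)) \<partial>M1) * ennreal (norm (f y) powr r)"
        by (simp add: ennreal_mult' nn_integral_multc)
      also have "\<dots> \<le> ennreal K2 * ennreal (norm (f y) powr r)" by (intro mult_right_mono col y) auto
      finally show "(\<integral>\<^sup>+x. ennreal (norm (\<Phi> x y) * norm (f y) powr r) \<partial>M1) \<le> ennreal K2 * ennreal (norm (f y) powr r)" .
    qed auto
    also have "\<dots> = ennreal (K1 powr (r - 1)) * (ennreal K2 * (\<integral>\<^sup>+y. ennreal (norm (f y) powr r) \<partial>M2))"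
      by (subst nn_integral_cmult) simp_all
    also have "\<dots> \<le> ennreal (K1 powr (r - 1)) * (ennreal K2 * ennreal (?N powr r))"
      by (intro mult_left_mono fN) auto
    also have "\<dots> = ennreal (K1 powr (r - 1) * (K2 * ?N powr r))"
      using K by (simp add: ennreal_mult'[symmetric])
    also have "\<dots> = ennreal ((K1 powr (1 - 1 / r) * K2 powr (1 / r) * ?N) powr r)"
    proof -
      have "(1 - 1 / r) * r = r - 1" using r by (simp add: algebra_simps)
      then have "(K1 powr (1 - 1 / r) * K2 powr (1 / r) * ?N) powr r = K1 powr (r - 1) * (K2 * ?N powr r)"
        using K N r by (simp add: powr_mult powr_powr mult_ac)
      then show ?thesis by simp
    qed
    finally show ?thesis
      using Lp_norm_le_iff[OF p, of "K1 powr (1 - 1 / r) * K2 powr (1 / r) * ?N" T M1] K N False Tm r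
      by (simp add: r_def)
  qed
qed

text \<open>On the shell where \<open>n * d z\<close> is between \<open>2^(k-1)\<close> and
  \<open>2^k\<close> the integrand is at most \<open>2^S Y 2^(-k S)\<close>, while the enclosing
  ball has measure of order \<open>2^(k q) n^(-q)\<close>. Since \<open>S > q\<close>, the geometric
  ratio \<open>2^(q - S)\<close> is below 1. The innermost ball uses the bound without
  decay.\<close>

lemma nn_integral_shell_bound:
  fixes d :: "'a \<Rightarrow> real" and g :: "'a \<Rightarrow> complex"
  assumes [measurable]: "g \<in> borel_measurable M"
    and d: "\<And>z. z \<in> space M \<Longrightarrow> 0 \<le> d z"
    and balls: "\<And>r. r > 0 \<Longrightarrow> {z \<in> space M. d z \<le> r} \<in> sets M \<and> emeasure M {z \<in> space M. d z \<le> r} \<le> ennreal (c * r powr q)"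
    and c: "0 \<le> c" and S: "real S > q" and n: "n \<ge> 1" and Y: "0 \<le> Y"
    and g: "\<And>z. z \<in> space M \<Longrightarrow> norm (g z) \<le> Y" "\<And>z. z \<in> space M \<Longrightarrow> norm (g z) * (n * d z) ^ S \<le> Y"
  shows "(\<integral>\<^sup>+z. ennreal (norm (g z)) \<partial>M) \<le> ennreal (2 ^ S * c / (1 - 2 powr (q - real S)) * Y * n powr (- q))"
proof -
  define B where "B k = {z \<in> space M. d z \<le> 2 ^ k / n}" for k :: nat
  have Bm [measurable]: "B k \<in> sets M" and Be: "emeasure M (B k) \<le> ennreal (c * (2 ^ k / n) powr q)" for k
    using balls[of "2 ^ k / n"] n by (auto simp: B_def)
  define \<theta> where "\<theta> = 2 powr (q - real S)"
  have \<theta>: "0 \<le> \<theta>" "\<theta> < 1" using S powr_less_mono[of "q - real S" 0 2] by (auto simp: \<theta>_def)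
  have pt: "ennreal (norm (g z)) \<le> (\<Sum>k. ennreal (Y * 2 ^ S * (1 / 2 ^ S) ^ k) * indicator (B k) z)" if z: "z \<in> space M" for z
  proof -
    have ex: "\<exists>k::nat. n * d z \<le> 2 ^ k" using real_arch_pow[of 2 "n * d z"] by (auto intro: less_imp_le)
    define k where "k = (LEAST k::nat. n * d z \<le> 2 ^ k)"
    have k: "n * d z \<le> 2 ^ k" unfolding k_def using ex by (rule LeastI_ex)
    then have zB: "z \<in> B k" using z n by (simp add: B_def pos_le_divide_eq mult.commute)
    have "norm (g z) \<le> Y * 2 ^ S * (1 / 2 ^ S) ^ k"
    proof (cases k)
      case 0
      have "Y * 1 \<le> Y * 2 ^ S" using Y by (intro mult_left_mono) auto
      then show ?thesis using g(1)[OF z] 0 by simp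
    next
      case (Suc j)
      then have "\<not> n * d z \<le> 2 ^ j" using not_less_Least[of j "\<lambda>k. n * d z \<le> 2 ^ k"] k_def by auto
      then have "(2 ^ j) ^ S \<le> (n * d z) ^ S" by (intro power_mono) auto
      then have "norm (g z) * (2 ^ j) ^ S \<le> Y" using g(2)[OF z] by (meson mult_left_mono norm_ge_zero order.trans)
      then have "norm (g z) \<le> Y / (2 ^ j) ^ S" by (simp add: pos_le_divide_eq)
      also have "\<dots> = Y * 2 ^ S * (1 / 2 ^ S) ^ k"
        unfolding Suc by (simp add: power_divide power_mult[symmetric] mult.commute)
      finally show ?thesis .
    qed
    then have *: "ennreal (norm (g z)) \<le> ennreal (Y * 2 ^ S * (1 / 2 ^ S) ^ k) * indicator (B k) z"
      using zB by (simp add: ennreal_leI)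
    define F where "F k = ennreal (Y * 2 ^ S * (1 / 2 ^ S) ^ k) * indicator (B k) z" for k
    have "F k \<le> (\<Sum>k. F k)" using sum_le_suminf[of F "{k}"] by simp
    with * show ?thesis unfolding F_def by (rule order.trans)
  qed
  have "(\<integral>\<^sup>+z. ennreal (norm (g z)) \<partial>M) \<le> (\<integral>\<^sup>+z. (\<Sum>k. ennreal (Y * 2 ^ S * (1 / 2 ^ S) ^ k) * indicator (B k) z) \<partial>M)"
    by (intro nn_integral_mono pt)
  also have "\<dots> = (\<Sum>k. ennreal (Y * 2 ^ S * (1 / 2 ^ S) ^ k) * emeasure M (B k))"
    by (subst nn_integral_suminf) (simp_all add: nn_integral_cmult_indicator)
  also have "\<dots> \<le> (\<Sum>k. ennreal ((2 ^ S * c * Y * n powr (- q)) * \<theta> ^ k))"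
  proof (intro suminf_le allI)
    fix k
    have "ennreal (Y * 2 ^ S * (1 / 2 ^ S) ^ k) * emeasure M (B k) \<le> ennreal (Y * 2 ^ S * (1 / 2 ^ S) ^ k) * ennreal (c * (2 ^ k / n) powr q)"
      by (intro mult_left_mono Be) auto
    also have "\<dots> = ennreal (Y * 2 ^ S * (1 / 2 ^ S) ^ k * (c * (2 ^ k / n) powr q))"
      using Y by (intro ennreal_mult'[symmetric]) auto
    also have "Y * 2 ^ S * (1 / 2 ^ S) ^ k * (c * (2 ^ k / n) powr q) = (2 ^ S * c * Y * n powr (- q)) * \<theta> ^ k"
    proof -
      have "(1 / 2 ^ S) ^ k = (2::real) powr (- real S * real k)"
        by (simp add: power_one_over powr_minus powr_realpow[symmetric] powr_powr inverse_eq_divide)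
      moreover have "(2 ^ k / n) powr q = 2 powr (q * real k) * n powr (- q)"
        using n by (simp add: powr_divide powr_realpow[symmetric] powr_powr powr_minus_divide mult.commute)
      moreover have "\<theta> ^ k = 2 powr (- real S * real k) * 2 powr (q * real k)"
        by (simp add: \<theta>_def powr_realpow[symmetric] powr_powr powr_add[symmetric] algebra_simps)
      ultimately show ?thesis by (simp only: mult_ac)
    qed
    finally show "ennreal (Y * 2 ^ S * (1 / 2 ^ S) ^ k) * emeasure M (B k) \<le> ennreal ((2 ^ S * c * Y * n powr (- q)) * \<theta> ^ k)" .
  qed auto
  also have "\<dots> = ennreal (\<Sum>k. (2 ^ S * c * Y * n powr (- q)) * \<theta> ^ k)"
    using \<theta> c Y by (intro suminf_ennreal2 summable_mult summable_geometric) auto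
  also have "\<dots> = ennreal (2 ^ S * c / (1 - 2 powr (q - real S)) * Y * n powr (- q))"
    using \<theta> by (subst suminf_mult) (simp_all add: summable_geometric suminf_geometric \<theta>_def[symmetric])
  finally show ?thesis .
qed

section \<open>The operators of two systems\<close>

text \<open>A low pass filter vanishes from 1 on, so restricting to \<open>l j k < n\<close> loses
  nothing and makes the sum finite.\<close>

definition joint_kernel ::
    "'a system \<Rightarrow> 'b system \<Rightarrow> (nat \<Rightarrow> nat \<Rightarrow> complex) \<Rightarrow> (nat \<Rightarrow> nat \<Rightarrow> real) \<Rightarrow>
     (real \<Rightarrow> real) \<Rightarrow> real \<Rightarrow> 'a \<Rightarrow> 'b \<Rightarrow> complex" where
  "joint_kernel \<Xi>1 \<Xi>2 A l h n x1 x2 =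
     (\<Sum>(j, k) | l j k < n. of_real (h (l j k / n)) * A j k * phi \<Xi>1 j x1 * cnj (phi \<Xi>2 k x2))"

lemma borel_measurable_cnj [measurable (raw)]:
  "f \<in> borel_measurable M \<Longrightarrow> (\<lambda>x. cnj (f x)) \<in> borel_measurable M"
  by (rule measurable_compose[OF _ borel_measurable_continuous_onI]) (auto intro: continuous_intros)

lemma low_pass_filter_measurable:
  assumes "low_pass_filter h"
  shows "h \<in> borel_measurable borel"
proof -
  have anti: "antimono_on {0..} h" and even: "\<And>u. h (- u) = h u"
    using assms by (auto simp: low_pass_filter_def)
  have "mono (\<lambda>x. - h (max 0 x))"
    using anti by (intro monoI) (auto simp: monotone_on_def)
  then have "(\<lambda>x. - h (max 0 x)) \<in> borel_measurable borel" by (rule borel_measurable_mono)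
  then have "(\<lambda>x. - (- h (max 0 x))) \<in> borel_measurable borel" by (rule borel_measurable_uminus)
  then have [measurable]: "(\<lambda>x. h (max 0 x)) \<in> borel_measurable borel" by simp
  have "(\<lambda>x. h (max 0 \<bar>x\<bar>)) \<in> borel_measurable borel"
    by (rule measurable_compose[of "\<lambda>x. \<bar>x\<bar>" borel borel "\<lambda>x. h (max 0 x)"]) measurable
  moreover have "h (max 0 \<bar>x\<bar>) = h x" for x using even[of x] by (cases "x \<ge> 0") auto
  ultimately show ?thesis by simp
qed

lemma integral_count_space_finite_subset:
  fixes f :: "'i \<Rightarrow> complex"
  assumes "finite B" "\<And>i. i \<notin> B \<Longrightarrow> f i = 0"
  shows "(\<integral>i. f i \<partial>count_space UNIV) = (\<Sum>i\<in>B. f i)"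
proof -
  have "{i \<in> UNIV. f i \<noteq> 0} \<subseteq> B" using assms(2) by auto
  then have "finite {i \<in> UNIV. f i \<noteq> 0}" using assms(1) by (rule finite_subset)
  then have "(\<integral>i. f i \<partial>count_space UNIV) = (\<Sum>i | i \<in> UNIV \<and> f i \<noteq> 0. f i)"
    by (rule lebesgue_integral_count_space_finite_support)
  also have "\<dots> = (\<Sum>i\<in>B. f i)"
    using assms by (intro sum.mono_neutral_left) auto
  finally show ?thesis .
qed

definition joint_coeff ::
    "'a system \<Rightarrow> 'b system \<Rightarrow> (nat \<Rightarrow> nat \<Rightarrow> complex) \<Rightarrow> 'a \<Rightarrow> 'b \<Rightarrow> nat \<times> nat \<Rightarrow> complex" where
  "joint_coeff \<Xi>1 \<Xi>2 A x1 x2 = (\<lambda>(j, k). A j k * phi \<Xi>1 j x1 * cnj (phi \<Xi>2 k x2))"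

lemma joint_kernel_eq_integral:
  assumes fin: "finite {(j, k). l j k < n}" and h: "low_pass_filter h" and n: "n > 0" and l: "\<forall>j k. 0 \<le> l j k"
  shows "joint_kernel \<Xi>1 \<Xi>2 A l h n x1 x2 =
     (\<integral>i. joint_coeff \<Xi>1 \<Xi>2 A x1 x2 i * of_real (h (case_prod l i / n)) \<partial>count_space UNIV)"
proof -
  have "(\<integral>i. joint_coeff \<Xi>1 \<Xi>2 A x1 x2 i * of_real (h (case_prod l i / n)) \<partial>count_space UNIV)
    = (\<Sum>i\<in>{(j, k). l j k < n}. joint_coeff \<Xi>1 \<Xi>2 A x1 x2 i * of_real (h (case_prod l i / n)))"
  proof (rule integral_count_space_finite_subset[OF fin])
    fix i assume "i \<notin> {(j, k). l j k < n}"
    then have "1 \<le> \<bar>case_prod l i / n\<bar>" using n by (auto simp: split_beta)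
    then have "h (case_prod l i / n) = 0" using h by (auto simp: low_pass_filter_def)
    then show "joint_coeff \<Xi>1 \<Xi>2 A x1 x2 i * of_real (h (case_prod l i / n)) = 0" by simp
  qed
  then show ?thesis
    unfolding joint_kernel_def by (auto simp: joint_coeff_def split_beta mult_ac intro!: sum.cong)
qed

lemma joint_gaussian_bound_growth:
  assumes G: "joint_gaussian_bound \<Xi>1 \<Xi>2 d12 A l Q"
  shows "\<exists>c\<ge>0. \<forall>x1\<in>space (meas \<Xi>1). \<forall>x2\<in>space (meas \<Xi>2).
    poly_growth (count_space UNIV) (joint_coeff \<Xi>1 \<Xi>2 A x1 x2) (case_prod l) c Q"
proof -
  have Q: "Q > 0" and l: "\<forall>j k. 0 \<le> l j k" and fin: "\<And>u. u > 0 \<Longrightarrow> finite {(j, k). l j k < u}"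
    using G by (auto simp: joint_gaussian_bound_def Let_def)
  obtain c where c: "c > 0" "\<And>n x1 x2. (n::real) \<ge> 2 \<Longrightarrow> x1 \<in> space (meas \<Xi>1) \<Longrightarrow> x2 \<in> space (meas \<Xi>2) \<Longrightarrow>
      (\<Sum>(j, k) | l j k < n. norm (A j k * phi \<Xi>1 j x1 * cnj (phi \<Xi>2 k x2))) \<le> c * n powr Q"
  proof -
    have "\<exists>c>0. \<forall>n::real. n \<ge> 2 \<longrightarrow> (\<forall>x1\<in>space (meas \<Xi>1). \<forall>x2\<in>space (meas \<Xi>2).
        (\<Sum>(j, k) | l j k < n. norm (A j k * phi \<Xi>1 j x1 * cnj (phi \<Xi>2 k x2))) \<le> c * n powr Q)"
      using G unfolding joint_gaussian_bound_def Let_def by (elim conjE)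
    then show thesis
    proof (elim exE conjE)
      fix c assume c: "0 < c" and H: "\<forall>n::real. n \<ge> 2 \<longrightarrow> (\<forall>x1\<in>space (meas \<Xi>1). \<forall>x2\<in>space (meas \<Xi>2).
        (\<Sum>(j, k) | l j k < n. norm (A j k * phi \<Xi>1 j x1 * cnj (phi \<Xi>2 k x2))) \<le> c * n powr Q)"
      show thesis by (rule that[OF c H[rule_format]])
    qed
  qed
  show ?thesis
  proof (intro exI[of _ c] conjI ballI)
    fix x1 x2 assume x: "x1 \<in> space (meas \<Xi>1)" "x2 \<in> space (meas \<Xi>2)"
    let ?a = "joint_coeff \<Xi>1 \<Xi>2 A x1 x2"
    have "(\<integral>\<^sup>+i. ennreal (norm (?a i)) * indicator {i. case_prod l i < n} i \<partial>count_space UNIV) \<le> ennreal (c * n powr Q)"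
      if n: "n \<ge> 2" for n :: real
    proof -
      let ?B = "{(j, k). l j k < n}"
      have B: "finite ?B" using n by (intro fin) simp
      have "(\<integral>\<^sup>+i. ennreal (norm (?a i)) * indicator {i. case_prod l i < n} i \<partial>count_space UNIV)
          = (\<Sum>i\<in>?B. ennreal (norm (?a i)) * indicator {i. case_prod l i < n} i)"
        by (rule nn_integral_count_space'[OF B]) (auto simp: indicator_def)
      also have "\<dots> = (\<Sum>i\<in>?B. ennreal (norm (?a i)))" by (intro sum.cong) (auto simp: indicator_def)
      also have "\<dots> = ennreal (\<Sum>i\<in>?B. norm (?a i))" by (rule sum_ennreal) simp
      also have "\<dots> \<le> ennreal (c * n powr Q)"
        using c(2)[OF n x] by (intro ennreal_leI) (simp add: joint_coeff_def split_beta)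
      finally show ?thesis .
    qed
    then show "poly_growth (count_space UNIV) ?a (case_prod l) c Q"
      using c(1) Q l by (auto simp: poly_growth_def)
  qed (use c in simp)
qed

text \<open>The heat kernel is a limit of partial sums over real thresholds. Polynomial growth makes
  the full sum absolutely convergent, and dominated convergence identifies it with an integral over
  \<open>count_space\<close>, the form in which the Tauberian theorem takes it.\<close>

lemma joint_gaussian_bound_decay:
  assumes G: "joint_gaussian_bound \<Xi>1 \<Xi>2 d12 A l Q"
  shows "\<exists>\<alpha>>0. \<exists>c1>0. \<exists>c2>0. \<forall>x1\<in>space (meas \<Xi>1). \<forall>x2\<in>space (meas \<Xi>2).
    gauss_decay (count_space UNIV) (joint_coeff \<Xi>1 \<Xi>2 A x1 x2) (case_prod l) c1 \<alpha> c2 (d12 x1 x2)"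
proof -
  have Q: "Q > 0" and l: "\<forall>j k. 0 \<le> l j k" and fin: "\<And>u. u > 0 \<Longrightarrow> finite {(j, k). l j k < u}"
    using G by (auto simp: joint_gaussian_bound_def Let_def)
  obtain c where g: "\<And>x1 x2. x1 \<in> space (meas \<Xi>1) \<Longrightarrow> x2 \<in> space (meas \<Xi>2) \<Longrightarrow>
      poly_growth (count_space UNIV) (joint_coeff \<Xi>1 \<Xi>2 A x1 x2) (case_prod l) c Q"
    using joint_gaussian_bound_growth[OF G] by blast
  obtain \<alpha> c1 c2 where c: "\<alpha> > 0" "c1 > 0" "c2 > 0"
    "\<And>t x1 x2. 0 < t \<Longrightarrow> t \<le> 1 \<Longrightarrow> x1 \<in> space (meas \<Xi>1) \<Longrightarrow> x2 \<in> space (meas \<Xi>2) \<Longrightarrow>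
       norm (joint_heat_kernel \<Xi>1 \<Xi>2 A l t x1 x2) \<le> c1 * t powr (- \<alpha>) * exp (- c2 * (d12 x1 x2)\<^sup>2 / t)"
  proof -
    have "\<exists>c>0. \<exists>c1>0. \<exists>c2>0. \<forall>t. 0 < t \<and> t \<le> 1 \<longrightarrow> (\<forall>x1\<in>space (meas \<Xi>1). \<forall>x2\<in>space (meas \<Xi>2).
          norm (joint_heat_kernel \<Xi>1 \<Xi>2 A l t x1 x2) \<le> c1 * t powr (- c) * exp (- c2 * (d12 x1 x2)\<^sup>2 / t))"
      using G unfolding joint_gaussian_bound_def Let_def by (elim conjE)
    then show thesis
    proof (elim exE conjE)
      fix c c1 c2 assume c: "0 < c" "0 < c1" "0 < c2"
        and H: "\<forall>t. 0 < t \<and> t \<le> 1 \<longrightarrow> (\<forall>x1\<in>space (meas \<Xi>1). \<forall>x2\<in>space (meas \<Xi>2).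
          norm (joint_heat_kernel \<Xi>1 \<Xi>2 A l t x1 x2) \<le> c1 * t powr (- c) * exp (- c2 * (d12 x1 x2)\<^sup>2 / t))"
      show thesis by (rule that[OF c H[rule_format, OF conjI]])
    qed
  qed
  have heat: "joint_heat_kernel \<Xi>1 \<Xi>2 A l t x1 x2 =
      (\<integral>i. joint_coeff \<Xi>1 \<Xi>2 A x1 x2 i * of_real (exp (- (case_prod l i)\<^sup>2 * t)) \<partial>count_space UNIV)"
    if t: "0 < t" and x: "x1 \<in> space (meas \<Xi>1)" "x2 \<in> space (meas \<Xi>2)" for t x1 x2
  proof -
    let ?a = "joint_coeff \<Xi>1 \<Xi>2 A x1 x2"
    let ?f = "\<lambda>i. ?a i * of_real (exp (- (case_prod l i)\<^sup>2 * t))"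
    \<comment> \<open>The exponential is split into \<open>m\<close> equal factors, each decaying
      with order 2, so that the total order \<open>2 * m\<close> exceeds
      \<open>Q + 1\<close>.\<close>
    define m where "m = nat \<lceil>Q\<rceil> + 1"
    have m: "m > 0" by (simp add: m_def)
    have "Q + 1 \<le> real m" unfolding m_def by linarith
    then have m2: "Q + 1 \<le> real (2 * m)" by simp
    have int: "integrable (count_space UNIV) ?f"
    proof (rule poly_growth_integrable(1)[OF g[OF x] m2 order.refl])
      fix i
      let ?u = "case_prod l i"
      have u: "0 \<le> ?u" using l by (simp add: split_beta)
      have "exp (- ?u\<^sup>2 * t) = exp (- ?u\<^sup>2 * (t / real m)) ^ m"
        using m by (simp add: exp_of_nat_mult[symmetric])
      also have "\<dots> \<le> ((((t / real m) powr (- 1) + 2) * (1 / (1 + ?u))) ^ 2) ^ m"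
        using t m u by (intro power_mono gauss_le_decay) auto
      also have "\<dots> = ((t / real m) powr (- 1) + 2) ^ (2 * m) * (1 / (1 + ?u / 1)) ^ (2 * m)"
        by (simp only: power_mult power_mult_distrib div_by_1)
      finally show "norm (complex_of_real (exp (- ?u\<^sup>2 * t))) \<le> ((t / real m) powr (- 1) + 2) ^ (2 * m) * (1 / (1 + ?u / 1)) ^ (2 * m)"
        by (simp only: norm_of_real abs_exp_cancel)
    qed auto
    have "((\<lambda>n. \<integral>i. ?f i * of_real (indicator {i. case_prod l i < n} i) \<partial>count_space UNIV) \<longlongrightarrow> (\<integral>i. ?f i \<partial>count_space UNIV)) at_top"
    proof (rule integral_dominated_convergence_at_top[where w="\<lambda>i. norm (?f i)"])
      show "AE i in count_space UNIV. ((\<lambda>n. ?f i * of_real (indicator {i. case_prod l i < n} i)) \<longlongrightarrow> ?f i) at_top"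
      proof (intro AE_I2 tendsto_eventually)
        fix i
        show "\<forall>\<^sub>F n in at_top. ?f i * of_real (indicator {i. case_prod l i < n} i) = ?f i"
          using eventually_gt_at_top[of "case_prod l i"] by eventually_elim (simp add: indicator_def)
      qed
      show "\<forall>\<^sub>F n in at_top. AE i in count_space UNIV. norm (?f i * of_real (indicator {i. case_prod l i < n} i)) \<le> norm (?f i)"
        by (intro always_eventually allI AE_I2) (auto simp: indicator_def)
    qed (use int in auto)
    moreover have "\<forall>\<^sub>F n in at_top. (\<integral>i. ?f i * of_real (indicator {i. case_prod l i < n} i) \<partial>count_space UNIV)
        = joint_kernel_sum \<Xi>1 \<Xi>2 A l t x1 x2 n"
      using eventually_gt_at_top[of 0]
    proof eventually_elim
      case (elim n)
      have "(\<integral>i. ?f i * of_real (indicator {i. case_prod l i < n} i) \<partial>count_space UNIV)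
          = (\<Sum>i\<in>{(j, k). l j k < n}. ?f i * of_real (indicator {i. case_prod l i < n} i))"
        by (rule integral_count_space_finite_subset[OF fin[OF elim]]) (auto simp: indicator_def)
      also have "\<dots> = joint_kernel_sum \<Xi>1 \<Xi>2 A l t x1 x2 n"
        unfolding joint_kernel_sum_def
        by (intro sum.cong refl) (auto simp: joint_coeff_def indicator_def mult_ac)
      finally show ?case .
    qed
    ultimately have "(joint_kernel_sum \<Xi>1 \<Xi>2 A l t x1 x2 \<longlongrightarrow> (\<integral>i. ?f i \<partial>count_space UNIV)) at_top"
      by (rule Lim_transform_eventually)
    then show ?thesis unfolding joint_heat_kernel_def by (intro tendsto_Lim) simp_all
  qed
  have "gauss_decay (count_space UNIV) (joint_coeff \<Xi>1 \<Xi>2 A x1 x2) (case_prod l) c1 \<alpha> c2 (d12 x1 x2)"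
    if x: "x1 \<in> space (meas \<Xi>1)" "x2 \<in> space (meas \<Xi>2)" for x1 x2
    unfolding gauss_decay_def using c(4)[OF _ _ x] heat[OF _ x] by simp
  then show ?thesis using c by blast
qed

text \<open>The growth and Gaussian constants do not depend on the points, so the Tauberian theorem,
  applied to each pair separately with \<open>d = d12 x1 x2\<close>, gives one constant for all. It
  is raised by 1 to be positive.\<close>

lemma joint_kernel_localized:
  assumes G: "joint_gaussian_bound \<Xi>1 \<Xi>2 d12 A l Q" and h: "low_pass_filter h" "sufficiently_smooth q1 q2 Q h"
    and jd: "joint_distance \<Xi>1 \<Xi>2 d12" and q1: "q1 > 0"
  shows "\<exists>S C. real S > max q1 q2 \<and> C > 0 \<and> (\<forall>n\<ge>1. \<forall>x1\<in>space (meas \<Xi>1). \<forall>x2\<in>space (meas \<Xi>2).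
     norm (joint_kernel \<Xi>1 \<Xi>2 A l h n x1 x2) \<le> C * n powr Q \<and>
     norm (joint_kernel \<Xi>1 \<Xi>2 A l h n x1 x2) * (n * d12 x1 x2) ^ S \<le> C * n powr Q)"
proof -
  have Q: "Q > 0" and l: "\<forall>j k. 0 \<le> l j k" and fin: "\<And>u. u > 0 \<Longrightarrow> finite {(j, k). l j k < u}"
    using G by (auto simp: joint_gaussian_bound_def Let_def)
  obtain c where g: "c \<ge> 0" "\<And>x1 x2. x1 \<in> space (meas \<Xi>1) \<Longrightarrow> x2 \<in> space (meas \<Xi>2) \<Longrightarrow>
      poly_growth (count_space UNIV) (joint_coeff \<Xi>1 \<Xi>2 A x1 x2) (case_prod l) c Q"
    using joint_gaussian_bound_growth[OF G] by blast
  obtain \<alpha> c1 c2 where gd: "\<alpha> > 0" "c1 > 0" "c2 > 0" "\<And>x1 x2. x1 \<in> space (meas \<Xi>1) \<Longrightarrow> x2 \<in> space (meas \<Xi>2) \<Longrightarrow>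
      gauss_decay (count_space UNIV) (joint_coeff \<Xi>1 \<Xi>2 A x1 x2) (case_prod l) c1 \<alpha> c2 (d12 x1 x2)"
    using joint_gaussian_bound_decay[OF G] by blast
  obtain S H where S: "real S > max q1 q2" "H \<ge> 0" "\<And>s u. \<bar>bdiff S s h u\<bar> \<le> H * \<bar>s\<bar> ^ S"
    using sufficiently_smooth_bdiff[OF h(2,1) Q q1] by blast
  have S1: "S \<ge> 1" using S(1) q1 by (cases S) auto
  have hp: "\<And>x. h (- x) = h x" "\<And>x. \<bar>h x\<bar> \<le> 1" "\<And>x. \<bar>x\<bar> \<ge> 1 \<Longrightarrow> h x = 0"
    using h(1) by (auto simp: low_pass_filter_def)
  obtain C where C: "C \<ge> 0" "\<And>(M :: (nat \<times> nat) measure) a u d n. sigma_finite_measure M \<and> poly_growth M a u c Q \<and>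
      gauss_decay M a u c1 \<alpha> c2 d \<and> 0 \<le> d \<and> 1 \<le> n \<Longrightarrow>
      norm (\<integral>i. a i * of_real (h (u i / n)) \<partial>M) \<le> C * n powr Q \<and>
      norm (\<integral>i. a i * of_real (h (u i / n)) \<partial>M) * (n * d) ^ S \<le> C * n powr Q"
    using gauss_decay_tauberian[where ?'i="nat \<times> nat", of h H S c Q c1 \<alpha> c2]
      low_pass_filter_measurable[OF h(1)] hp S(2,3) S1 g(1) Q gd(1-3) by blast
  show ?thesis
  proof (intro exI[of _ S] exI[of _ "C + 1"] conjI allI impI ballI)
    fix n :: real and x1 x2 assume n: "1 \<le> n" and x: "x1 \<in> space (meas \<Xi>1)" "x2 \<in> space (meas \<Xi>2)"
    have "0 \<le> d12 x1 x2" using jd x by (auto simp: joint_distance_def Let_def)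
    then have *: "norm (joint_kernel \<Xi>1 \<Xi>2 A l h n x1 x2) \<le> C * n powr Q \<and>
       norm (joint_kernel \<Xi>1 \<Xi>2 A l h n x1 x2) * (n * d12 x1 x2) ^ S \<le> C * n powr Q"
      using n joint_kernel_eq_integral[OF fin h(1) _ l, of n \<Xi>1 \<Xi>2 A x1 x2]
        C(2)[of "count_space UNIV" "joint_coeff \<Xi>1 \<Xi>2 A x1 x2" "case_prod l" "d12 x1 x2" n] g(2)[OF x] gd(4)[OF x]
        sigma_finite_measure_count_space by auto
    moreover have "C * n powr Q \<le> (C + 1) * n powr Q" by (simp add: distrib_right)
    ultimately show "norm (joint_kernel \<Xi>1 \<Xi>2 A l h n x1 x2) \<le> (C + 1) * n powr Q"
      "norm (joint_kernel \<Xi>1 \<Xi>2 A l h n x1 x2) * (n * d12 x1 x2) ^ S \<le> (C + 1) * n powr Q" by auto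
  qed (use S C in auto)
qed

section \<open>Fourier coefficients and the integral form of the operators\<close>

lemma phi_props:
  assumes "admissible \<Xi>"
  shows "sigma_finite_measure (meas \<Xi>)" "phi \<Xi> k \<in> borel_measurable (meas \<Xi>)" "integrable (meas \<Xi>) (phi \<Xi> k)"
    "\<exists>B. \<forall>x\<in>space (meas \<Xi>). norm (phi \<Xi> k x) \<le> B" "finite {k. lam \<Xi> k < n}"
proof -
  show "sigma_finite_measure (meas \<Xi>)" and i: "integrable (meas \<Xi>) (phi \<Xi> k)"
    using assms by (auto simp: admissible_def Let_def)
  then show "phi \<Xi> k \<in> borel_measurable (meas \<Xi>)" by auto
  have "bounded (phi \<Xi> k ` space (meas \<Xi>))" using assms by (auto simp: admissible_def Let_def)
  then show "\<exists>B. \<forall>x\<in>space (meas \<Xi>). norm (phi \<Xi> k x) \<le> B" by (auto simp: bounded_iff)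
  have "filterlim (lam \<Xi>) at_top sequentially" using assms by (auto simp: admissible_def Let_def)
  then have "\<forall>\<^sub>F k in sequentially. n \<le> lam \<Xi> k" by (simp add: filterlim_at_top)
  then obtain N where "\<And>k. k \<ge> N \<Longrightarrow> n \<le> lam \<Xi> k" by (auto simp: eventually_sequentially)
  then have "{k. lam \<Xi> k < n} \<subseteq> {..<N}" by (force simp: not_le[symmetric])
  then show "finite {k. lam \<Xi> k < n}" by (rule finite_subset) simp
qed

text \<open>Each \<open>phi \<Xi> k\<close> is both bounded and integrable, so for finite
  \<open>p\<close> the inequality \<open>norm f \<le> 1 + norm f powr r\<close> does the work of
  Hoelder's inequality without a conjugate exponent.\<close>

lemma Lp_times_phi_integrable:
  assumes adm: "admissible \<Xi>" and p: "1 \<le> p" and f: "f \<in> Lp_space (meas \<Xi>) p"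
  shows "integrable (meas \<Xi>) (\<lambda>x. f x * cnj (phi \<Xi> k x))"
proof -
  have [measurable]: "f \<in> borel_measurable (meas \<Xi>)" "phi \<Xi> k \<in> borel_measurable (meas \<Xi>)"
    using Lp_space_measurable[OF f] phi_props(2)[OF adm] by auto
  have i: "integrable (meas \<Xi>) (phi \<Xi> k)" by (rule phi_props(3)[OF adm])
  have m: "(\<lambda>x. f x * cnj (phi \<Xi> k x)) \<in> borel_measurable (meas \<Xi>)" by measurable
  show ?thesis
  proof (cases "p = \<infinity>")
    case True
    have "AE x in meas \<Xi>. norm (f x) \<le> Lp_norm (meas \<Xi>) p f" using f Lp_space_AE_le True by blast
    then have "AE x in meas \<Xi>. norm (f x * cnj (phi \<Xi> k x)) \<le> norm (of_real (Lp_norm (meas \<Xi>) p f) * phi \<Xi> k x)"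
      by eventually_elim (simp add: norm_mult Lp_norm_nonneg mult_right_mono)
    then show ?thesis
      by (intro Bochner_Integration.integrable_bound[OF _ m, of "\<lambda>x. of_real (Lp_norm (meas \<Xi>) p f) * phi \<Xi> k x"])
         (use i in auto)
  next
    case False
    define r where "r = enn2real p"
    have r: "1 \<le> r" using ennreal_exponent[OF p False] by (auto simp: r_def)
    have ir: "integrable (meas \<Xi>) (\<lambda>x. norm (f x) powr r)" using f False by (simp add: Lp_space_def r_def)
    obtain B where B: "\<And>x. x \<in> space (meas \<Xi>) \<Longrightarrow> norm (phi \<Xi> k x) \<le> B" using phi_props(4)[OF adm] by blast
    show ?thesis
    proof (rule Bochner_Integration.integrable_bound[OF _ m])
      show "integrable (meas \<Xi>) (\<lambda>x. norm (phi \<Xi> k x) + B * norm (f x) powr r)" using i ir by auto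
      show "AE x in meas \<Xi>. norm (f x * cnj (phi \<Xi> k x)) \<le> norm (norm (phi \<Xi> k x) + B * norm (f x) powr r)"
      proof (intro AE_I2)
        fix x assume x: "x \<in> space (meas \<Xi>)"
        have "norm (f x) \<le> 1 + norm (f x) powr r"
        proof (cases "norm (f x) \<le> 1")
          case False
          then have "norm (f x) powr 1 \<le> norm (f x) powr r" using r by (intro powr_mono) auto
          then show ?thesis using False by simp
        qed (simp add: add_increasing2)
        then have "norm (f x) * norm (phi \<Xi> k x) \<le> (1 + norm (f x) powr r) * norm (phi \<Xi> k x)" by (intro mult_right_mono) auto
        also have "\<dots> \<le> norm (phi \<Xi> k x) + B * norm (f x) powr r"
          using B[OF x] mult_right_mono[OF B[OF x], of "norm (f x) powr r"] by (simp add: algebra_simps)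
        also have "\<dots> \<le> norm (norm (phi \<Xi> k x) + B * norm (f x) powr r)" by simp
        finally show "norm (f x * cnj (phi \<Xi> k x)) \<le> norm (norm (phi \<Xi> k x) + B * norm (f x) powr r)"
          by (simp add: norm_mult)
      qed
    qed
  qed
qed

lemma sigma_op_finite_sum:
  assumes fin: "finite {(j, k). l j k < n}" and h: "low_pass_filter h" and n: "n > 0"
  shows "sigma_op \<Xi>1 \<Xi>2 A l h n f x = (\<Sum>(j, k) | l j k < n. of_real (h (l j k / n)) * A j k * fourier_coeff \<Xi>2 f k * phi \<Xi>1 j x)"
proof -
  let ?g = "\<lambda>(j, k). of_real (h (l j k / n)) * A j k * fourier_coeff \<Xi>2 f k * phi \<Xi>1 j x"
  have "sigma_op \<Xi>1 \<Xi>2 A l h n f x = (\<Sum>\<^sub>\<infinity>i\<in>{(j, k). l j k < n}. ?g i)"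
    unfolding sigma_op_def
  proof (rule infsum_cong_neutral)
    fix i assume "i \<in> UNIV - {(j, k). l j k < n}"
    then have "h (l (fst i) (snd i) / n) = 0"
      using h n by (auto simp: low_pass_filter_def split_beta)
    then show "?g i = 0" by (simp add: split_beta)
  qed auto
  then show ?thesis using fin by simp
qed

lemma sigma_op_eq_integral:
  assumes adm: "admissible \<Xi>2" and fin: "finite {(j, k). l j k < n}" and h: "low_pass_filter h" and n: "n > 0"
    and p: "1 \<le> p" and f: "f \<in> Lp_space (meas \<Xi>2) p"
  shows "sigma_op \<Xi>1 \<Xi>2 A l h n f x = (\<integral>y. joint_kernel \<Xi>1 \<Xi>2 A l h n x y * f y \<partial>meas \<Xi>2)"
proof -
  have "(\<integral>y. joint_kernel \<Xi>1 \<Xi>2 A l h n x y * f y \<partial>meas \<Xi>2)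
      = (\<integral>y. (\<Sum>i\<in>{(j, k). l j k < n}. (of_real (h (case_prod l i / n)) * case_prod A i * phi \<Xi>1 (fst i) x) * (f y * cnj (phi \<Xi>2 (snd i) y))) \<partial>meas \<Xi>2)"
    unfolding joint_kernel_def sum_distrib_right
    by (intro Bochner_Integration.integral_cong sum.cong refl) (auto simp: mult_ac)
  also have "\<dots> = (\<Sum>i\<in>{(j, k). l j k < n}. (of_real (h (case_prod l i / n)) * case_prod A i * phi \<Xi>1 (fst i) x) * fourier_coeff \<Xi>2 f (snd i))"
    unfolding fourier_coeff_def
    by (subst Bochner_Integration.integral_sum, intro integrable_mult_right Lp_times_phi_integrable[OF adm p f])
       (simp only: integral_mult_right_zero)
  also have "\<dots> = sigma_op \<Xi>1 \<Xi>2 A l h n f x"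
    unfolding sigma_op_finite_sum[OF fin h n] by (intro sum.cong refl) (auto simp: mult_ac)
  finally show ?thesis ..
qed

text \<open>The shell bound gives rows of order \<open>n^(Q - q2)\<close> and columns of order
  \<open>n^(Q - q1)\<close>. Schur's test combines them with the weights \<open>1 - 1/p\<close> and
  \<open>1/p\<close>, and the resulting exponent is \<kappa>.\<close>

lemma sigma_op_bounded:
  fixes \<Xi>1 :: "'a system" and \<Xi>2 :: "'b system"
  assumes adm: "admissible \<Xi>1" "admissible \<Xi>2" and jd: "joint_distance \<Xi>1 \<Xi>2 d12"
    and G: "joint_gaussian_bound \<Xi>1 \<Xi>2 d12 A l Q" and h: "low_pass_filter h" "sufficiently_smooth q1 q2 Q h"
    and reg: "joint_regular \<Xi>1 \<Xi>2 d12 q1 q2" and p: "1 \<le> p"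
    and \<kappa>: "\<kappa> = Q - q2 - (q1 - q2) * enn2real (1 / p)"
  shows "\<exists>C>0. \<forall>n\<ge>1. \<forall>f\<in>Lp_space (meas \<Xi>2) p. sigma_op \<Xi>1 \<Xi>2 A l h n f \<in> Lp_space (meas \<Xi>1) p \<and>
     Lp_norm (meas \<Xi>1) p (sigma_op \<Xi>1 \<Xi>2 A l h n f) \<le> C * n powr \<kappa> * Lp_norm (meas \<Xi>2) p f"
proof -
  have fin: "\<And>u. u > 0 \<Longrightarrow> finite {(j, k). l j k < u}"
    using G by (auto simp: joint_gaussian_bound_def Let_def)
  have q: "q1 > 0" "q2 > 0" using reg by (auto simp: joint_regular_def)
  obtain c where c: "c > 0"
    "\<And>x2 r. x2 \<in> space (meas \<Xi>2) \<Longrightarrow> r > 0 \<Longrightarrow> joint_ball21 \<Xi>1 d12 x2 r \<in> sets (meas \<Xi>1) \<and>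
          emeasure (meas \<Xi>1) (joint_ball21 \<Xi>1 d12 x2 r) \<le> ennreal (c * r powr q1)"
    "\<And>x1 r. x1 \<in> space (meas \<Xi>1) \<Longrightarrow> r > 0 \<Longrightarrow> joint_ball12 \<Xi>2 d12 x1 r \<in> sets (meas \<Xi>2) \<and>
          emeasure (meas \<Xi>2) (joint_ball12 \<Xi>2 d12 x1 r) \<le> ennreal (c * r powr q2)"
    using reg unfolding joint_regular_def by blast
  obtain S C0 where S: "real S > max q1 q2" and C0: "C0 > 0"
    "\<And>n x1 x2. n \<ge> 1 \<Longrightarrow> x1 \<in> space (meas \<Xi>1) \<Longrightarrow> x2 \<in> space (meas \<Xi>2) \<Longrightarrow>
     norm (joint_kernel \<Xi>1 \<Xi>2 A l h n x1 x2) \<le> C0 * n powr Q \<and>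
     norm (joint_kernel \<Xi>1 \<Xi>2 A l h n x1 x2) * (n * d12 x1 x2) ^ S \<le> C0 * n powr Q"
    using joint_kernel_localized[OF G h jd q(1)] by blast
  have d: "0 \<le> d12 x1 x2" if "x1 \<in> space (meas \<Xi>1)" "x2 \<in> space (meas \<Xi>2)" for x1 x2
    using jd that by (auto simp: joint_distance_def Let_def)
  \<comment> \<open>One formula serves rows (\<open>q = q2\<close>) and columns
    (\<open>q = q1\<close>); \<open>S > max q1 q2\<close> makes both denominators positive.\<close>
  define D where "D q = 2 ^ S * c / (1 - 2 powr (q - real S)) * C0" for q
  have D: "D q > 0" if "q < real S" for q
    using that c(1) C0(1) powr_less_mono[of "q - real S" 0 2] by (auto simp: D_def)
  have ip: "0 \<le> enn2real (1 / p)" "enn2real (1 / p) \<le> 1"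
  proof -
    show "enn2real (1 / p) \<le> 1"
    proof (cases "p = \<infinity>")
      case False
      then show ?thesis using ennreal_exponent[OF p False] by simp
    qed simp
  qed simp
  define C where "C = D q2 powr (1 - enn2real (1 / p)) * D q1 powr enn2real (1 / p)"
  have main: "sigma_op \<Xi>1 \<Xi>2 A l h n f \<in> Lp_space (meas \<Xi>1) p \<and>
     Lp_norm (meas \<Xi>1) p (sigma_op \<Xi>1 \<Xi>2 A l h n f) \<le> C * n powr \<kappa> * Lp_norm (meas \<Xi>2) p f"
    if n: "n \<ge> 1" and f: "f \<in> Lp_space (meas \<Xi>2) p" for n f
  proof -
    let ?\<Phi> = "joint_kernel \<Xi>1 \<Xi>2 A l h n"
    have [measurable]: "phi \<Xi>1 k \<in> borel_measurable (meas \<Xi>1)" "phi \<Xi>2 k \<in> borel_measurable (meas \<Xi>2)" for k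
      using phi_props(2) adm by auto
    have \<Phi>m [measurable]: "case_prod ?\<Phi> \<in> borel_measurable (meas \<Xi>1 \<Otimes>\<^sub>M meas \<Xi>2)"
      unfolding joint_kernel_def split_beta by measurable
    have row: "(\<integral>\<^sup>+y. ennreal (norm (?\<Phi> x y)) \<partial>meas \<Xi>2) \<le> ennreal (D q2 * n powr (Q - q2))"
      if x: "x \<in> space (meas \<Xi>1)" for x
    proof -
      have [measurable]: "?\<Phi> x \<in> borel_measurable (meas \<Xi>2)"
        unfolding joint_kernel_def[abs_def] split_beta by measurable
      have "(\<integral>\<^sup>+y. ennreal (norm (?\<Phi> x y)) \<partial>meas \<Xi>2) \<le>
          ennreal (2 ^ S * c / (1 - 2 powr (q2 - real S)) * (C0 * n powr Q) * n powr (- q2))"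
        by (rule nn_integral_shell_bound[where d="d12 x"])
           (use x d c(1) c(3)[OF x] C0 S n in \<open>auto simp: joint_ball12_def\<close>)
      also have "2 ^ S * c / (1 - 2 powr (q2 - real S)) * (C0 * n powr Q) * n powr (- q2) = D q2 * n powr (Q - q2)"
        by (simp add: D_def powr_diff powr_minus divide_inverse)
      finally show ?thesis .
    qed
    have col: "(\<integral>\<^sup>+x. ennreal (norm (?\<Phi> x y)) \<partial>meas \<Xi>1) \<le> ennreal (D q1 * n powr (Q - q1))"
      if y: "y \<in> space (meas \<Xi>2)" for y
    proof -
      have [measurable]: "(\<lambda>x. ?\<Phi> x y) \<in> borel_measurable (meas \<Xi>1)"
        unfolding joint_kernel_def[abs_def] split_beta by measurable
      have "(\<integral>\<^sup>+x. ennreal (norm (?\<Phi> x y)) \<partial>meas \<Xi>1) \<le>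
          ennreal (2 ^ S * c / (1 - 2 powr (q1 - real S)) * (C0 * n powr Q) * n powr (- q1))"
        by (rule nn_integral_shell_bound[where d="\<lambda>x. d12 x y"])
           (use y d c(1) c(2)[OF y] C0 S n in \<open>auto simp: joint_ball21_def\<close>)
      also have "2 ^ S * c / (1 - 2 powr (q1 - real S)) * (C0 * n powr Q) * n powr (- q1) = D q1 * n powr (Q - q1)"
        by (simp add: D_def powr_diff powr_minus divide_inverse)
      finally show ?thesis .
    qed
    have K: "0 < D q2 * n powr (Q - q2)" "0 < D q1 * n powr (Q - q1)"
      using D[of q1] D[of q2] S n by auto
    have "sigma_op \<Xi>1 \<Xi>2 A l h n f \<in> Lp_space (meas \<Xi>1) p \<and>
      Lp_norm (meas \<Xi>1) p (sigma_op \<Xi>1 \<Xi>2 A l h n f) \<le>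
       (D q2 * n powr (Q - q2)) powr (1 - enn2real (1 / p)) * (D q1 * n powr (Q - q1)) powr enn2real (1 / p) * Lp_norm (meas \<Xi>2) p f"
      using n by (intro schur_test_Lp[OF phi_props(1)[OF adm(1)] phi_props(1)[OF adm(2)] \<Phi>m row col K p f]
         sigma_op_eq_integral[OF adm(2) fin h(1) _ p f]) auto
    moreover have "(D q2 * n powr (Q - q2)) powr (1 - enn2real (1 / p)) * (D q1 * n powr (Q - q1)) powr enn2real (1 / p) = C * n powr \<kappa>"
    proof -
      have "(Q - q2) * (1 - enn2real (1 / p)) + (Q - q1) * enn2real (1 / p) = \<kappa>"
        unfolding \<kappa> by (simp add: algebra_simps)
      then have "n powr \<kappa> = n powr ((Q - q2) * (1 - enn2real (1 / p))) * n powr ((Q - q1) * enn2real (1 / p))"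
        by (metis powr_add)
      then show ?thesis using D[of q1] D[of q2] S n by (simp add: C_def powr_mult powr_powr mult_ac)
    qed
    ultimately show ?thesis by simp
  qed
  have "C > 0" using D[of q1] D[of q2] S by (auto simp: C_def)
  then show ?thesis using main by blast
qed

section \<open>Convergence and Besov spaces\<close>

lemma Pi_space_Lp:
  assumes adm: "admissible \<Xi>" and p: "1 \<le> p" and P: "P \<in> Pi_space \<Xi> n"
  shows "P \<in> Lp_space (meas \<Xi>) p"
proof -
  obtain a where P: "P = (\<lambda>x. \<Sum>k | lam \<Xi> k < n. a k * phi \<Xi> k x)"
    using P by (auto simp: Pi_space_def)
  have "\<forall>k. \<exists>B. \<forall>x\<in>space (meas \<Xi>). norm (phi \<Xi> k x) \<le> B" using phi_props(4)[OF adm] by blast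
  then obtain B where B: "\<And>k x. x \<in> space (meas \<Xi>) \<Longrightarrow> norm (phi \<Xi> k x) \<le> B k" by metis
  show ?thesis
  proof (rule Lp_spaceI_bounded_integrable[OF p, where B="\<Sum>k | lam \<Xi> k < n. norm (a k) * B k"])
    show "integrable (meas \<Xi>) P" unfolding P
      by (intro Bochner_Integration.integrable_sum integrable_mult_right phi_props(3)[OF adm])
    show "norm (P x) \<le> (\<Sum>k | lam \<Xi> k < n. norm (a k) * B k)" if "x \<in> space (meas \<Xi>)" for x
      unfolding P by (intro sum_norm_le) (simp add: norm_mult mult_left_mono B[OF that])
  qed
qed

lemma Pi_space_zero: "(\<lambda>x. 0) \<in> Pi_space \<Xi> n"
  unfolding Pi_space_def by (rule range_eqI[of _ _ "\<lambda>k. 0"]) simp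

lemma Pi_space_mono:
  assumes adm: "admissible \<Xi>" and "n \<le> n'"
  shows "Pi_space \<Xi> n \<subseteq> Pi_space \<Xi> n'"
proof
  fix P assume "P \<in> Pi_space \<Xi> n"
  then obtain a where P: "P = (\<lambda>x. \<Sum>k | lam \<Xi> k < n. a k * phi \<Xi> k x)"
    by (auto simp: Pi_space_def)
  have "P = (\<lambda>x. \<Sum>k | lam \<Xi> k < n'. (if lam \<Xi> k < n then a k else 0) * phi \<Xi> k x)"
    unfolding P using assms(2) by (intro ext sum.mono_neutral_cong_left phi_props(5)[OF adm]) auto
  then show "P \<in> Pi_space \<Xi> n'"
    unfolding Pi_space_def by (rule range_eqI[of _ _ "\<lambda>k. if lam \<Xi> k < n then a k else 0"])
qed

section \<open>Errors of best approximation\<close>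

lemma approx_err_bdd: "bdd_below ((\<lambda>P. Lp_norm (meas \<Xi>) p (\<lambda>x. g x - P x)) ` Pi_space \<Xi> n)"
  by (intro bdd_belowI[of _ 0]) (auto simp: Lp_norm_nonneg)

lemma approx_err_nonneg: "0 \<le> approx_err \<Xi> p n g"
  unfolding approx_err_def using Pi_space_zero by (intro cINF_greatest) (auto simp: Lp_norm_nonneg)

lemma approx_err_le: "P \<in> Pi_space \<Xi> n \<Longrightarrow> approx_err \<Xi> p n g \<le> Lp_norm (meas \<Xi>) p (\<lambda>x. g x - P x)"
  unfolding approx_err_def by (intro cINF_lower approx_err_bdd)

lemma approx_err_le_norm: "approx_err \<Xi> p n g \<le> Lp_norm (meas \<Xi>) p g"
  using approx_err_le[OF Pi_space_zero] by simp

lemma approx_err_antimono: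
  assumes "admissible \<Xi>" "n \<le> n'"
  shows "approx_err \<Xi> p n' g \<le> approx_err \<Xi> p n g"
  unfolding approx_err_def
  by (rule cINF_superset_mono[OF _ approx_err_bdd Pi_space_mono[OF assms]]) (use Pi_space_zero in auto)

lemma approx_err_approximant:
  assumes "e > 0"
  obtains P where "P \<in> Pi_space \<Xi> n" "Lp_norm (meas \<Xi>) p (\<lambda>x. g x - P x) < approx_err \<Xi> p n g + e"
proof -
  have "(INF P\<in>Pi_space \<Xi> n. Lp_norm (meas \<Xi>) p (\<lambda>x. g x - P x)) < approx_err \<Xi> p n g + e"
    using assms by (simp add: approx_err_def)
  then show thesis
    by (subst (asm) cINF_less_iff[OF _ approx_err_bdd]) (use Pi_space_zero that in auto)
qed

lemma sigma_op_diff: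
  assumes adm: "admissible \<Xi>2" and fin: "finite {(j, k). l j k < n}" and h: "low_pass_filter h" and n: "n > 0"
    and p: "1 \<le> p" and f: "f \<in> Lp_space (meas \<Xi>2) p" "g \<in> Lp_space (meas \<Xi>2) p"
  shows "sigma_op \<Xi>1 \<Xi>2 A l h n (\<lambda>y. f y - g y) x = sigma_op \<Xi>1 \<Xi>2 A l h n f x - sigma_op \<Xi>1 \<Xi>2 A l h n g x"
proof -
  have fc: "fourier_coeff \<Xi>2 (\<lambda>y. f y - g y) k = fourier_coeff \<Xi>2 f k - fourier_coeff \<Xi>2 g k" for k
    unfolding fourier_coeff_def left_diff_distrib
    by (intro Bochner_Integration.integral_diff Lp_times_phi_integrable[OF adm p] f)
  then show ?thesis
    unfolding sigma_op_finite_sum[OF fin h n] sum_subtractf[symmetric]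
    by (intro sum.cong refl) (auto simp: fc algebra_simps)
qed

lemma sigma_op_increment_bound:
  fixes \<Xi>1 :: "'a system" and \<Xi>2 :: "'b system"
  assumes adm: "admissible \<Xi>1" "admissible \<Xi>2" and jd: "joint_distance \<Xi>1 \<Xi>2 d12"
    and G: "joint_gaussian_bound \<Xi>1 \<Xi>2 d12 A l Q" and h: "low_pass_filter h" "sufficiently_smooth q1 q2 Q h"
    and reg: "joint_regular \<Xi>1 \<Xi>2 d12 q1 q2" and p: "1 \<le> p"
    and \<kappa>: "\<kappa> = Q - q2 - (q1 - q2) * enn2real (1 / p)"
    and hyp: "\<exists>c>0. \<forall>n::real. n \<ge> 1 \<longrightarrow> (\<forall>P\<in>Pi_space \<Xi>2 n. \<forall>m::nat. m \<ge> 1 \<longrightarrow>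
           Lp_norm (meas \<Xi>1) p
             (\<lambda>x. sigma_op \<Xi>1 \<Xi>2 A l h (2 ^ (m + 1)) P x - sigma_op \<Xi>1 \<Xi>2 A l h (2 ^ m) P x)
           \<le> c * 2 powr (- real m * \<beta>) * n powr \<kappa> * Lp_norm (meas \<Xi>2) p P)"
  shows "\<exists>C>0. \<forall>f\<in>Lp_space (meas \<Xi>2) p. \<forall>m. sigma_op \<Xi>1 \<Xi>2 A l h (2 ^ m) f \<in> Lp_space (meas \<Xi>1) p \<and>
     Lp_norm (meas \<Xi>1) p (\<lambda>x. sigma_op \<Xi>1 \<Xi>2 A l h (2 ^ Suc m) f x - sigma_op \<Xi>1 \<Xi>2 A l h (2 ^ m) f x)
     \<le> C * (2 powr (real m * \<kappa>) * approx_err \<Xi>2 p (2 ^ m) f + 2 powr (real m * (\<kappa> - \<beta>)) * Lp_norm (meas \<Xi>2) p f)"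
proof -
  let ?\<sigma> = "\<lambda>m. sigma_op \<Xi>1 \<Xi>2 A l h (2 ^ m)"
  let ?N1 = "Lp_norm (meas \<Xi>1) p" and ?N2 = "Lp_norm (meas \<Xi>2) p"
  have fin: "\<And>u. u > 0 \<Longrightarrow> finite {(j, k). l j k < u}"
    using G by (auto simp: joint_gaussian_bound_def Let_def)
  obtain C1 where C1: "C1 > 0" "\<And>n f. n \<ge> 1 \<Longrightarrow> f \<in> Lp_space (meas \<Xi>2) p \<Longrightarrow> sigma_op \<Xi>1 \<Xi>2 A l h n f \<in> Lp_space (meas \<Xi>1) p"
     "\<And>n f. n \<ge> 1 \<Longrightarrow> f \<in> Lp_space (meas \<Xi>2) p \<Longrightarrow> ?N1 (sigma_op \<Xi>1 \<Xi>2 A l h n f) \<le> C1 * n powr \<kappa> * ?N2 f"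
    using sigma_op_bounded[OF adm jd G h reg p \<kappa>] by blast
  obtain c where c: "c > 0" "\<And>n P m. (n::real) \<ge> 1 \<Longrightarrow> P \<in> Pi_space \<Xi>2 n \<Longrightarrow> m \<ge> 1 \<Longrightarrow>
      ?N1 (\<lambda>x. ?\<sigma> (m + 1) P x - ?\<sigma> m P x) \<le> c * 2 powr (- real m * \<beta>) * n powr \<kappa> * ?N2 P"
    using hyp by blast
  have pw: "(2 ^ m :: real) powr \<kappa> = 2 powr (real m * \<kappa>)" for m :: nat
    by (simp add: powr_realpow[symmetric] powr_powr)
  define D where "D = C1 * (2 powr \<kappa> + 1)"
  have D: "D > 0" using C1 by (simp add: D_def add_pos_pos)
  have L: "?\<sigma> m f \<in> Lp_space (meas \<Xi>1) p" if "f \<in> Lp_space (meas \<Xi>2) p" for f m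
    using C1(2)[OF _ that, of "2 ^ m"] by simp
  have rough: "?N1 (\<lambda>x. ?\<sigma> (Suc m) f x - ?\<sigma> m f x) \<le> D * 2 powr (real m * \<kappa>) * ?N2 f"
    if f: "f \<in> Lp_space (meas \<Xi>2) p" for f m
  proof -
    have "?N1 (\<lambda>x. ?\<sigma> (Suc m) f x - ?\<sigma> m f x) \<le> ?N1 (?\<sigma> (Suc m) f) + ?N1 (?\<sigma> m f)"
      by (intro Lp_diff(2) p L f)
    also have "\<dots> \<le> C1 * (2 ^ Suc m) powr \<kappa> * ?N2 f + C1 * (2 ^ m) powr \<kappa> * ?N2 f"
      by (intro add_mono C1(3) f one_le_power) simp_all
    also have "\<dots> = D * 2 powr (real m * \<kappa>) * ?N2 f"
      unfolding pw D_def by (simp add: powr_add distrib_right distrib_left)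
    finally show ?thesis .
  qed
  have main: "?N1 (\<lambda>x. ?\<sigma> (Suc m) f x - ?\<sigma> m f x)
     \<le> (D + 2 * c) * (2 powr (real m * \<kappa>) * approx_err \<Xi>2 p (2 ^ m) f + 2 powr (real m * (\<kappa> - \<beta>)) * ?N2 f)"
    (is "?L \<le> _ * (?a * ?E + ?b * _)") if f: "f \<in> Lp_space (meas \<Xi>2) p" for f m
  proof (cases "m = 0")
    case True
    \<comment> \<open>The hypothesis starts at \<open>m = 1\<close>; here the term with \<open>\<parallel>f\<parallel>\<close> absorbs the increment.\<close>
    have "?L \<le> D * ?N2 f" using rough[OF f, of m] True by simp
    also have "\<dots> \<le> (D + 2 * c) * (?a * ?E + ?b * ?N2 f)"
      using True D c(1) Lp_norm_nonneg[of "meas \<Xi>2" p f] approx_err_nonneg[of \<Xi>2 p "2 ^ m" f]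
      by (intro mult_mono) auto
    finally show ?thesis .
  next
    case False
    \<comment> \<open>The infimum in \<open>approx_err\<close> need not be attained, hence the slack
      \<open>e\<close>. The degree of \<open>P\<close> is tied to the index by
      \<open>n = 2 ^ m\<close>, so the two powers in the hypothesis merge into
      \<open>2^(m (\<kappa> - \<beta>))\<close>.\<close>
    have Eps: "?L \<le> D * ?a * (?E + e) + c * ?b * (2 * ?N2 f + e)" if e: "e > 0" for e
    proof -
      obtain P where P: "P \<in> Pi_space \<Xi>2 (2 ^ m)" "?N2 (\<lambda>x. f x - P x) < ?E + e"
        using approx_err_approximant[OF e] .
      have PL: "P \<in> Lp_space (meas \<Xi>2) p" by (rule Pi_space_Lp[OF adm(2) p P(1)])
      have fP: "(\<lambda>x. f x - P x) \<in> Lp_space (meas \<Xi>2) p" by (rule Lp_diff(1)[OF p f PL])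
      have "?N2 (\<lambda>x. f x - (f x - P x)) \<le> ?N2 f + ?N2 (\<lambda>x. f x - P x)" by (rule Lp_diff(2)[OF p f fP])
      \<comment> \<open>The error is at most the norm of \<open>f\<close>, because 0 is an
        admissible approximant; this keeps the norm of \<open>P\<close> under control.\<close>
      then have NP: "?N2 P \<le> 2 * ?N2 f + e" using P(2) approx_err_le_norm[of \<Xi>2 p "2 ^ m" f] by simp
      have split: "(\<lambda>x. ?\<sigma> (Suc m) f x - ?\<sigma> m f x) = (\<lambda>x. (?\<sigma> (Suc m) (\<lambda>y. f y - P y) x - ?\<sigma> m (\<lambda>y. f y - P y) x)
          + (?\<sigma> (Suc m) P x - ?\<sigma> m P x))"
      proof -
        have "?\<sigma> k (\<lambda>y. f y - P y) x = ?\<sigma> k f x - ?\<sigma> k P x" for k x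
          by (intro sigma_op_diff[OF adm(2) fin h(1) _ p f PL]) simp_all
        then show ?thesis by (intro ext) (simp only:, simp)
      qed
      have "?L \<le> ?N1 (\<lambda>x. ?\<sigma> (Suc m) (\<lambda>y. f y - P y) x - ?\<sigma> m (\<lambda>y. f y - P y) x) + ?N1 (\<lambda>x. ?\<sigma> (Suc m) P x - ?\<sigma> m P x)"
        unfolding split by (intro Lp_add(2) Lp_diff(1) p L fP PL)
      also have "\<dots> \<le> D * ?a * ?N2 (\<lambda>y. f y - P y) + c * 2 powr (- real m * \<beta>) * (2 ^ m) powr \<kappa> * ?N2 P"
        using False c(2)[OF _ P(1), of m] by (intro add_mono rough fP) simp_all
      also have "c * 2 powr (- real m * \<beta>) * (2 ^ m) powr \<kappa> * ?N2 P = c * ?b * ?N2 P"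
        unfolding pw by (simp add: powr_add[symmetric] algebra_simps)
      also have "D * ?a * ?N2 (\<lambda>y. f y - P y) + c * ?b * ?N2 P \<le> D * ?a * (?E + e) + c * ?b * (2 * ?N2 f + e)"
        using P(2) NP D c(1) by (intro add_mono mult_left_mono) auto
      finally show ?thesis .
    qed
    have "?L \<le> D * ?a * ?E + 2 * c * ?b * ?N2 f"
    proof (rule field_le_epsilon)
      fix e :: real assume e: "e > 0"
      \<comment> \<open>This is the total coefficient of the slack, so the slack
        \<open>e / z\<close> contributes exactly \<open>e\<close>.\<close>
      define z where "z = D * ?a + c * ?b"
      have z: "z > 0" using D c(1) by (simp add: z_def add_pos_pos)
      have "?L \<le> D * ?a * (?E + e / z) + c * ?b * (2 * ?N2 f + e / z)" using e z by (intro Eps) simp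
      also have "\<dots> = D * ?a * ?E + 2 * c * ?b * ?N2 f + z * (e / z)"
        unfolding z_def by (simp only: distrib_left distrib_right mult_ac add_ac)
      finally show "?L \<le> D * ?a * ?E + 2 * c * ?b * ?N2 f + e" using z by simp
    qed
    also have "\<dots> = D * (?a * ?E) + (2 * c) * (?b * ?N2 f)" by (simp only: mult_ac)
    also have "\<dots> \<le> (D + 2 * c) * (?a * ?E) + (D + 2 * c) * (?b * ?N2 f)"
      using D c(1) approx_err_nonneg[of \<Xi>2 p "2 ^ m" f] Lp_norm_nonneg[of "meas \<Xi>2" p f]
      by (intro add_mono mult_right_mono) auto
    also have "\<dots> = (D + 2 * c) * (?a * ?E + ?b * ?N2 f)" by (simp only: distrib_left)
    finally show ?thesis .
  qed
  show ?thesis using D c(1) L main by (intro exI[of _ "D + 2 * c"]) auto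
qed

text \<open>A limit in the mean is determined only up to null sets, so the bound is proved for every
  limit \<open>F\<close>, and not just for the constructed one: \<open>F\<close> is compared with
  \<open>s N\<close>, and \<open>N\<close> tends to infinity.\<close>

lemma Lp_limit_exists_and_bound:
  assumes p: "1 \<le> p" and s: "\<And>n. s n \<in> Lp_space M p"
    and b: "\<And>n. Lp_norm M p (\<lambda>x. s (Suc n) x - s n x) \<le> b n" "summable b"
  shows "\<exists>F. Lp_limit M p s F"
    and "Lp_limit M p s F \<Longrightarrow> Lp_norm M p (\<lambda>x. F x - s n x) \<le> (\<Sum>m. b (m + n))"
proof -
  have b0: "0 \<le> b n" for n using order_trans[OF Lp_norm_nonneg b(1)] .
  obtain H where H: "H \<in> Lp_space M p" "\<And>n. Lp_norm M p (\<lambda>x. H x - s n x) \<le> (\<Sum>m. b (m + n))"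
    using Lp_complete[OF p s b] by blast
  have "(\<lambda>n. suminf b - (\<Sum>i<n. b i)) \<longlonglongrightarrow> suminf b - suminf b"
    by (intro tendsto_diff tendsto_const summable_LIMSEQ b(2))
  then have "(\<lambda>n. \<Sum>m. b (m + n)) \<longlonglongrightarrow> 0"
    using suminf_minus_initial_segment[OF b(2)] by simp
  then have "(\<lambda>n. Lp_norm M p (\<lambda>x. H x - s n x)) \<longlonglongrightarrow> 0"
    by (rule Lim_null_comparison[rotated]) (use H(2) in \<open>simp add: Lp_norm_nonneg\<close>)
  then show "\<exists>F. Lp_limit M p s F" using H(1) s by (auto simp: Lp_limit_def)
  assume lim: "Lp_limit M p s F"
  have tail: "summable (\<lambda>m. b (m + n))" using b(2) by (simp add: summable_iff_shift)
  have "(\<lambda>N. Lp_norm M p (\<lambda>x. F x - s N x) + (\<Sum>m. b (m + n))) \<longlonglongrightarrow> 0 + (\<Sum>m. b (m + n))"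
    using lim by (intro tendsto_add tendsto_const) (simp add: Lp_limit_def)
  moreover have "\<exists>N0. \<forall>N\<ge>N0. Lp_norm M p (\<lambda>x. F x - s n x) \<le> Lp_norm M p (\<lambda>x. F x - s N x) + (\<Sum>m. b (m + n))"
  proof (intro exI[of _ n] allI impI)
    fix N assume N: "n \<le> N"
    have FL: "F \<in> Lp_space M p" using lim by (simp add: Lp_limit_def)
    have "Lp_norm M p (\<lambda>x. (F x - s N x) + (s N x - s n x)) \<le> Lp_norm M p (\<lambda>x. F x - s N x) + Lp_norm M p (\<lambda>x. s N x - s n x)"
      by (intro Lp_add(2) Lp_diff(1) p s FL)
    moreover have "Lp_norm M p (\<lambda>x. s N x - s n x) \<le> (\<Sum>m=n..<N. b m)"
      by (rule Lp_telescope[where s=s, OF p s N b(1)])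
    moreover have "(\<Sum>m=n..<N. b m) = (\<Sum>m<N - n. b (m + n))"
      using sum.shift_bounds_nat_ivl[of b 0 n "N - n"] N by (simp add: atLeast0LessThan)
    moreover have "(\<Sum>m<N - n. b (m + n)) \<le> (\<Sum>m. b (m + n))" by (intro sum_le_suminf tail) (auto simp: b0)
    ultimately show "Lp_norm M p (\<lambda>x. F x - s n x) \<le> Lp_norm M p (\<lambda>x. F x - s N x) + (\<Sum>m. b (m + n))" by simp
  qed
  ultimately have "Lp_norm M p (\<lambda>x. F x - s n x) \<le> 0 + (\<Sum>m. b (m + n))"
    by (rule LIMSEQ_le_const)
  then show "Lp_norm M p (\<lambda>x. F x - s n x) \<le> (\<Sum>m. b (m + n))" by simp
qed

text \<open>If \<open>l j k < n\<close>, then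
  \<open>lam \<Xi>1 j \<le> \<alpha> * l j k < \<alpha> * n\<close>. Grouping the finite double sum
  by its first index therefore gives an element of the span.\<close>

lemma sigma_op_in_Pi_space:
  assumes adm: "admissible \<Xi>1" and fin: "finite {(j, k). l j k < n}" and h: "low_pass_filter h" and n: "n > 0"
    and \<alpha>: "\<alpha> > 0" "\<forall>j k. \<alpha> * l j k \<ge> lam \<Xi>1 j"
  shows "sigma_op \<Xi>1 \<Xi>2 A l h n f \<in> Pi_space \<Xi>1 (\<alpha> * n)"
proof -
  let ?F = "{(j, k). l j k < n}" and ?J = "{j. lam \<Xi>1 j < \<alpha> * n}"
  define w where "w i = of_real (h (case_prod l i / n)) * case_prod A i * fourier_coeff \<Xi>2 f (snd i)" for i
  define a where "a j = (\<Sum>i | i \<in> ?F \<and> fst i = j. w i)" for j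
  have sub: "fst ` ?F \<subseteq> ?J"
  proof clarify
    fix j k assume "l j k < n"
    then have "\<alpha> * l j k < \<alpha> * n" using \<alpha>(1) by simp
    then show "lam \<Xi>1 (fst (j, k)) < \<alpha> * n" using \<alpha>(2)[rule_format, of j k] by simp
  qed
  have "sigma_op \<Xi>1 \<Xi>2 A l h n f x = (\<Sum>j\<in>?J. a j * phi \<Xi>1 j x)" for x
  proof -
    have "sigma_op \<Xi>1 \<Xi>2 A l h n f x = (\<Sum>i\<in>?F. w i * phi \<Xi>1 (fst i) x)"
      unfolding sigma_op_finite_sum[OF fin h n] by (intro sum.cong refl) (auto simp: w_def)
    also have "\<dots> = (\<Sum>j\<in>?J. \<Sum>i | i \<in> ?F \<and> fst i = j. w i * phi \<Xi>1 (fst i) x)"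
      by (rule sum.group[OF fin phi_props(5)[OF adm] sub, symmetric])
    also have "\<dots> = (\<Sum>j\<in>?J. a j * phi \<Xi>1 j x)"
      unfolding a_def sum_distrib_right by (intro sum.cong refl) auto
    finally show ?thesis .
  qed
  then show ?thesis unfolding Pi_space_def by auto
qed

text \<open>Discrete Hardy inequality. For every exponent \<open>r > 0\<close>, also below \<open>1\<close>, half of the
  geometric decay is spent on replacing the \<open>\<ell>\<^sup>1\<close> sum by an \<open>\<ell>\<^sup>r\<close> sum.\<close>

lemma summable_geometric_tail_powr:
  fixes e :: "nat \<Rightarrow> real"
  assumes e: "\<And>n. 0 \<le> e n" and r: "r > 0" and q: "0 < q" "q < 1"
    and sum: "summable (\<lambda>n. e n powr r)"
  shows "summable (\<lambda>n. (\<Sum>m. q ^ m * e (m + n)) powr r)"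
proof -
  define T where "T = (\<Sum>n. e n powr r)"
  have eT: "(\<Sum>n<N. e (m + n) powr r) \<le> T" for m N
  proof -
    have "(\<Sum>n<N. e (m + n) powr r) = (\<Sum>n=m..<N + m. e n powr r)"
      using sum.shift_bounds_nat_ivl[of "\<lambda>n. e n powr r" 0 m N] by (simp add: atLeast0LessThan add.commute)
    also have "\<dots> \<le> T" unfolding T_def by (intro sum_le_suminf sum) auto
    finally show ?thesis .
  qed
  define \<theta> where "\<theta> = q powr (r / 2)"
  have \<theta>: "0 < \<theta>" "\<theta> < 1" using q r powr_less_mono2[of "r / 2" q 1] by (auto simp: \<theta>_def)
  \<comment> \<open>A single term of \<open>W n\<close> already bounds
    \<open>s ^ m * e (m + n)\<close>, where \<open>\<theta> ^ m = (s ^ m) powr r\<close>. This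
    pointwise comparison replaces Hoelder's inequality and is valid for every \<open>r > 0\<close>;
    the remaining factor \<open>s ^ m\<close> is summable.\<close>
  define W where "W n = (\<Sum>m. \<theta> ^ m * e (m + n) powr r)" for n
  have e1: "e n powr r \<le> T" for n using eT[where m=n and N=1] by simp
  have T0: "0 \<le> T" using e1[of 0] by (meson order_trans powr_ge_zero)
  have Ws: "summable (\<lambda>m. \<theta> ^ m * e (m + n) powr r)" for n
    by (rule summable_comparison_test'[where g="\<lambda>m. \<theta> ^ m * T" and N=0])
       (use \<theta> e1 in \<open>auto intro!: summable_mult2 summable_geometric mult_left_mono simp: abs_mult\<close>)
  have W0: "0 \<le> W n" for n unfolding W_def using \<theta> by (intro suminf_nonneg Ws) auto
  define s where "s = sqrt q"
  have s: "0 < s" "s < 1" "s * s = q" using q by (auto simp: s_def)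
  have W_ge: "s ^ m * e (m + n) \<le> W n powr (1 / r)" for m n
  proof -
    have "\<theta> ^ m * e (m + n) powr r = (\<Sum>k\<in>{m}. \<theta> ^ k * e (k + n) powr r)" by simp
    also have "\<dots> \<le> W n" unfolding W_def using \<theta> by (intro sum_le_suminf Ws) auto
    finally have "(\<theta> ^ m * e (m + n) powr r) powr (1 / r) \<le> W n powr (1 / r)"
      using \<theta> r by (intro powr_mono2) auto
    moreover have "\<theta> ^ m = (s ^ m) powr r"
      using q s by (simp add: \<theta>_def s_def powr_realpow[symmetric] powr_powr powr_half_sqrt[symmetric] mult_ac)
    then have "(\<theta> ^ m * e (m + n) powr r) powr (1 / r) = s ^ m * e (m + n)"
      using s e r by (simp add: powr_mult powr_powr)
    ultimately show ?thesis by simp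
  qed
  have bound: "(\<Sum>m. q ^ m * e (m + n)) powr r \<le> (1 / (1 - s)) powr r * W n" for n
  proof -
    have le: "q ^ m * e (m + n) \<le> s ^ m * W n powr (1 / r)" for m
      using mult_left_mono[OF W_ge[of m n], of "s ^ m"] s by (simp add: power_mult_distrib[symmetric] mult.assoc[symmetric])
    have ss: "summable (\<lambda>m. s ^ m * W n powr (1 / r))" using s by (intro summable_mult2 summable_geometric) simp
    have qs: "summable (\<lambda>m. q ^ m * e (m + n))"
      by (rule summable_comparison_test'[OF ss, of 0]) (use le q e in auto)
    have "(\<Sum>m. q ^ m * e (m + n)) \<le> (\<Sum>m. s ^ m * W n powr (1 / r))" by (intro suminf_le le qs ss)
    also have "\<dots> = 1 / (1 - s) * W n powr (1 / r)"
      using s by (subst suminf_mult2[symmetric]) (auto intro: summable_geometric simp: suminf_geometric)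
    finally have "(\<Sum>m. q ^ m * e (m + n)) powr r \<le> (1 / (1 - s) * W n powr (1 / r)) powr r"
      using r q e by (intro powr_mono2 suminf_nonneg qs) auto
    also have "\<dots> = (1 / (1 - s)) powr r * W n" using s r W0[of n] by (simp add: powr_mult powr_powr powr_divide)
    finally show ?thesis .
  qed
  \<comment> \<open>Exchanging the sums suffices, since every block of consecutive terms of
    \<open>e n powr r\<close> is at most the full sum \<open>T\<close>.\<close>
  have "summable W"
  proof (rule summableI_nonneg_bounded[where x="T / (1 - \<theta>)"])
    fix N
    have "(\<Sum>n<N. W n) = (\<Sum>m. \<Sum>n<N. \<theta> ^ m * e (m + n) powr r)"
      unfolding W_def by (rule suminf_sum[symmetric]) (rule Ws)
    also have "\<dots> \<le> (\<Sum>m. \<theta> ^ m * T)"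
    proof (intro suminf_le)
      show "(\<Sum>n<N. \<theta> ^ m * e (m + n) powr r) \<le> \<theta> ^ m * T" for m
        unfolding sum_distrib_left[symmetric] using \<theta> by (intro mult_left_mono eT) auto
      show "summable (\<lambda>m. \<Sum>n<N. \<theta> ^ m * e (m + n) powr r)" by (intro summable_sum Ws)
      show "summable (\<lambda>m. \<theta> ^ m * T)" using \<theta> by (intro summable_mult2 summable_geometric) simp
    qed
    also have "\<dots> = T / (1 - \<theta>)"
      using \<theta> by (subst suminf_mult2[symmetric]) (auto intro: summable_geometric simp: suminf_geometric)
    finally show "(\<Sum>n<N. W n) \<le> T / (1 - \<theta>)" .
  qed (rule W0)
  then have "summable (\<lambda>n. (1 / (1 - s)) powr r * W n)" by (rule summable_mult)
  then show ?thesis by (rule summable_comparison_test'[where N=0]) (use bound in simp)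
qed

lemma approx_err_tendsto_zero:
  assumes adm: "admissible \<Xi>" and lim: "(\<lambda>j::nat. approx_err \<Xi> p (2 ^ j) g) \<longlonglongrightarrow> 0"
  shows "((\<lambda>n::real. approx_err \<Xi> p n g) \<longlongrightarrow> 0) at_top"
proof (rule tendstoI)
  fix e :: real assume "e > 0"
  then have "\<forall>\<^sub>F j in sequentially. approx_err \<Xi> p (2 ^ j) g < e" using lim by (rule order_tendstoD(2)[rotated])
  then obtain j where j: "approx_err \<Xi> p (2 ^ j) g < e" by (auto simp: eventually_sequentially)
  show "\<forall>\<^sub>F n in at_top. dist (approx_err \<Xi> p n g) 0 < e"
    using eventually_ge_at_top[of "2 ^ j"]
  proof eventually_elim
    case (elim n)
    then show ?case using approx_err_antimono[OF adm elim, of p g] approx_err_nonneg[of \<Xi> p n g] j by simp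
  qed
qed

text \<open>The embedding into the case \<open>\<rho> = \<infinity>\<close>: the terms of a
  convergent series are bounded.\<close>

lemma besov_bounded:
  assumes "f \<in> besov \<Xi> p \<rho> \<gamma>" and "0 < \<rho>"
  shows "\<exists>W\<ge>0. \<forall>j. 2 powr (\<gamma> * real j) * approx_err \<Xi> p (2 ^ j) f \<le> W"
proof (cases "\<rho> = \<infinity>")
  case True
  then obtain W where "\<And>j. 2 powr (\<gamma> * real j) * approx_err \<Xi> p (2 ^ j) f \<le> W"
    using assms by (auto simp: besov_def bdd_above_def)
  then show ?thesis by (intro exI[of _ "max 0 W"]) (auto simp: le_max_iff_disj)
next
  case False
  define r where "r = enn2real \<rho>"
  have r: "r > 0" using assms(2) False by (simp add: r_def enn2real_positive_iff less_top)
  define e where "e j = 2 powr (\<gamma> * real j) * approx_err \<Xi> p (2 ^ j) f" for j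
  have e0: "0 \<le> e j" for j by (simp add: e_def approx_err_nonneg)
  have "summable (\<lambda>j. e j powr r)"
    using assms(1) False by (simp add: besov_def e_def r_def powr_mult approx_err_nonneg powr_powr mult_ac)
  then have "Bseq (\<lambda>j. e j powr r)" by (rule convergent_imp_Bseq[OF convergentI[OF summable_LIMSEQ_zero]])
  then obtain B where B: "B > 0" "\<And>j. e j powr r \<le> B" by (auto simp: Bseq_def)
  have "e j \<le> B powr (1 / r)" for j
  proof -
    have "(e j powr r) powr (1 / r) \<le> B powr (1 / r)" using B r by (intro powr_mono2) auto
    then show ?thesis using e0[of j] r by (simp add: powr_powr)
  qed
  then show ?thesis by (intro exI[of _ "B powr (1 / r)"]) (auto simp: e_def)
qed

text \<open>Multiplication by \<open>2^(\<delta> n)\<close> with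
  \<open>\<delta> = \<gamma> - \<kappa>\<close> turns the series in the bound into a tail
  \<open>X n\<close> of the Besov sequence \<open>e\<close> with ratio
  \<open>q = 2^(-\<delta>)\<close>, which the discrete Hardy inequality controls, and the norm term
  into \<open>N * q' ^ n\<close> with \<open>q' = 2^(\<gamma> - \<beta>)\<close>. Thus
  \<open>\<kappa> < \<gamma>\<close> and \<open>\<gamma> < \<beta>\<close> are responsible for one
  term each.\<close>

lemma besov_of_dyadic_bound:
  assumes adm: "admissible \<Xi>1" and f: "f \<in> besov \<Xi>2 p \<rho> \<gamma>" and \<rho>: "0 < \<rho>"
    and \<gamma>: "\<kappa> < \<gamma>" "\<gamma> < \<beta>" and F: "F \<in> Lp_space (meas \<Xi>1) p" and C: "C > 0" and N: "0 \<le> N"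
    and bound: "\<And>n. approx_err \<Xi>1 p (2 ^ (n + a)) F \<le>
      C * ((\<Sum>m. 2 powr (real (m + n) * \<kappa>) * approx_err \<Xi>2 p (2 ^ (m + n)) f) + 2 powr (real n * (\<kappa> - \<beta>)) * N)"
  shows "F \<in> besov \<Xi>1 p \<rho> (\<gamma> - \<kappa>)"
proof -
  define \<delta> where "\<delta> = \<gamma> - \<kappa>"
  define q q' where "q = 2 powr (- \<delta>)" and "q' = 2 powr (\<gamma> - \<beta>)"
  have q: "0 < q" "q < 1" "0 < q'" "q' < 1"
    using \<gamma> powr_less_mono[of "- \<delta>" 0 2] powr_less_mono[of "\<gamma> - \<beta>" 0 2] by (auto simp: q_def q'_def \<delta>_def)
  define e where "e j = 2 powr (\<gamma> * real j) * approx_err \<Xi>2 p (2 ^ j) f" for j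
  define g where "g j = 2 powr (\<delta> * real j) * approx_err \<Xi>1 p (2 ^ j) F" for j
  have e0: "0 \<le> e j" and g0: "0 \<le> g j" for j by (auto simp: e_def g_def approx_err_nonneg)
  obtain W where W: "W \<ge> 0" "\<And>j. e j \<le> W" using besov_bounded[OF f \<rho>] unfolding e_def by blast
  have qs: "summable (\<lambda>m. q ^ m * e (m + n))" for n
    by (rule summable_comparison_test'[where g="\<lambda>m. q ^ m * W" and N=0])
       (use q W e0 in \<open>auto intro!: summable_mult2 summable_geometric mult_left_mono simp: abs_mult\<close>)
  define X where "X n = (\<Sum>m. q ^ m * e (m + n))" for n
  have X0: "0 \<le> X n" for n unfolding X_def using q e0 by (intro suminf_nonneg qs) auto
  have XW: "X n \<le> W / (1 - q)" for n
  proof -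
    have "X n \<le> (\<Sum>m. q ^ m * W)"
      unfolding X_def using q W by (intro suminf_le qs summable_mult2 summable_geometric mult_left_mono) auto
    also have "\<dots> = W / (1 - q)"
      using q by (subst suminf_mult2[symmetric]) (auto intro: summable_geometric simp: suminf_geometric)
    finally show ?thesis .
  qed
  define K where "K = C * 2 powr (\<delta> * real a)"
  have K: "K > 0" using C by (simp add: K_def)
  have gX: "g (n + a) \<le> K * (X n + N * q' ^ n)" for n
  proof -
    have "2 powr (\<delta> * real n) * (\<Sum>m. 2 powr (real (m + n) * \<kappa>) * approx_err \<Xi>2 p (2 ^ (m + n)) f) = X n"
    proof -
      have t: "q ^ m * e (m + n) = 2 powr (\<delta> * real n) * (2 powr (real (m + n) * \<kappa>) * approx_err \<Xi>2 p (2 ^ (m + n)) f)" for m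
      proof -
        have "2 powr (- \<delta> * real m) * 2 powr (\<gamma> * real (m + n)) = 2 powr (\<delta> * real n) * 2 powr (real (m + n) * \<kappa>)"
          unfolding powr_add[symmetric] by (simp add: \<delta>_def algebra_simps)
        moreover have "q ^ m = 2 powr (- \<delta> * real m)" by (simp add: q_def powr_realpow[symmetric] powr_powr)
        ultimately show ?thesis unfolding e_def by (simp only: mult.assoc[symmetric])
      qed
      have "summable (\<lambda>m. 2 powr (\<delta> * real n) * (2 powr (real (m + n) * \<kappa>) * approx_err \<Xi>2 p (2 ^ (m + n)) f))"
        using qs[of n] by (simp only: t)
      then have "summable (\<lambda>m. 2 powr (real (m + n) * \<kappa>) * approx_err \<Xi>2 p (2 ^ (m + n)) f)"
        by (subst (asm) summable_cmult_iff) simp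
      then show ?thesis unfolding X_def t by (rule suminf_mult[symmetric])
    qed
    moreover have "2 powr (\<delta> * real n) * 2 powr (real n * (\<kappa> - \<beta>)) = q' ^ n"
      by (simp add: q'_def \<delta>_def powr_realpow[symmetric] powr_powr powr_add[symmetric] algebra_simps)
    moreover have "g (n + a) \<le> 2 powr (\<delta> * real (n + a)) * (C * ((\<Sum>m. 2 powr (real (m + n) * \<kappa>) * approx_err \<Xi>2 p (2 ^ (m + n)) f) + 2 powr (real n * (\<kappa> - \<beta>)) * N))"
      unfolding g_def by (intro mult_left_mono bound) simp
    moreover have "2 powr (\<delta> * real (n + a)) = 2 powr (\<delta> * real a) * 2 powr (\<delta> * real n)"
      by (simp add: powr_add[symmetric] algebra_simps)
    ultimately show ?thesis by (simp add: K_def algebra_simps)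
  qed
  \<comment> \<open>Indices below \<open>a\<close> are not reached by the shifted bound; being
    finitely many, they are covered by a maximum.\<close>
  have gB: "g j \<le> max (K * (W / (1 - q) + N)) (Max (g ` {..a}))" for j
  proof (cases "j \<le> a")
    case True
    then have "g j \<le> Max (g ` {..a})" by (intro Max_ge) auto
    then show ?thesis by simp
  next
    case False
    have "N * q' ^ (j - a) \<le> N * 1" using N q by (intro mult_left_mono power_le_one) auto
    then have "K * (X (j - a) + N * q' ^ (j - a)) \<le> K * (W / (1 - q) + N)"
      using K XW[of "j - a"] by (intro mult_left_mono add_mono) auto
    then show ?thesis using gX[of "j - a"] False by simp
  qed
  then obtain B where B: "\<And>j. g j \<le> B" by blast
  have "(\<lambda>j. B * q ^ j) \<longlonglongrightarrow> B * 0" using q by (intro tendsto_mult tendsto_const LIMSEQ_power_zero) auto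
  then have "(\<lambda>j. approx_err \<Xi>1 p (2 ^ j) F) \<longlonglongrightarrow> 0"
  proof (rule Lim_null_comparison[rotated, OF tendsto_eq_rhs], simp)
    have "approx_err \<Xi>1 p (2 ^ j) F = g j * q ^ j" for j
    proof -
      have "2 powr (\<delta> * real j) * q ^ j = 1"
        by (simp add: q_def powr_realpow[symmetric] powr_powr powr_add[symmetric])
      then show ?thesis by (simp add: g_def)
    qed
    then show "\<forall>\<^sub>F j in sequentially. norm (approx_err \<Xi>1 p (2 ^ j) F) \<le> B * q ^ j"
      using B g0 q by (simp add: abs_mult mult_right_mono)
  qed
  then have FX: "F \<in> X_space \<Xi>1 p" using F approx_err_tendsto_zero[OF adm] by (simp add: X_space_def)
  show ?thesis
  proof (cases "\<rho> = \<infinity>")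
    case True
    have "bdd_above (range (\<lambda>j::nat. 2 powr ((\<gamma> - \<kappa>) * real j) * approx_err \<Xi>1 p (2 ^ j) F))"
      using B unfolding g_def \<delta>_def by (intro bdd_aboveI[of _ B]) auto
    then show ?thesis using FX True by (simp add: besov_def)
  next
    case False
    define r where "r = enn2real \<rho>"
    have r: "r > 0" using \<rho> False by (simp add: r_def enn2real_positive_iff less_top)
    have "summable (\<lambda>j. e j powr r)"
      using f False by (simp add: besov_def e_def r_def powr_mult approx_err_nonneg powr_powr mult_ac)
    then have sX: "summable (\<lambda>n. X n powr r)"
      unfolding X_def by (rule summable_geometric_tail_powr[OF e0 r q(1,2)])
    have q'r: "q' powr r < 1" using q r powr_less_mono2[of r q' 1] by simp
    have sq: "summable (\<lambda>n. N powr r * (q' powr r) ^ n)"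
      using q'r by (intro summable_mult summable_geometric) simp
    have "summable (\<lambda>n. g (n + a) powr r)"
    proof (rule summable_comparison_test'[where N=0])
      show "summable (\<lambda>n. (2 * K) powr r * (X n powr r + N powr r * (q' powr r) ^ n))"
        by (intro summable_mult summable_add sX sq)
      fix n
      let ?y = "N * q' ^ n"
      have y0: "0 \<le> ?y" using N q by simp
      \<comment> \<open>Passing to the maximum avoids distinguishing \<open>r < 1\<close> from
        \<open>r \<ge> 1\<close> when the power of a sum is split.\<close>
      have "g (n + a) \<le> 2 * K * max (X n) ?y"
      proof -
        have "K * (X n + ?y) \<le> K * (2 * max (X n) ?y)" using K by (intro mult_left_mono) (auto simp: max_def)
        then show ?thesis using gX[of n] by simp
      qed
      then have "g (n + a) powr r \<le> (2 * K * max (X n) ?y) powr r" using g0 r by (intro powr_mono2) auto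
      also have "\<dots> = (2 * K) powr r * max (X n) ?y powr r" using K X0[of n] by (simp add: powr_mult)
      also have "\<dots> \<le> (2 * K) powr r * (X n powr r + ?y powr r)"
        by (intro mult_left_mono) (auto simp: max_def)
      also have "?y powr r = N powr r * (q' powr r) ^ n"
        using N q by (simp add: powr_mult powr_realpow[symmetric] powr_powr mult.commute)
      finally show "norm (g (n + a) powr r) \<le> (2 * K) powr r * (X n powr r + N powr r * (q' powr r) ^ n)" by simp
    qed
    then have "summable (\<lambda>n. g n powr r)" by (simp add: summable_iff_shift[where f="\<lambda>n. g n powr r"])
    then have "summable (\<lambda>j::nat. 2 powr ((\<gamma> - \<kappa>) * enn2real \<rho> * real j) * approx_err \<Xi>1 p (2 ^ j) F powr enn2real \<rho>)"
      by (simp add: g_def \<delta>_def r_def powr_mult approx_err_nonneg powr_powr mult_ac)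
    then show ?thesis using FX False by (simp add: besov_def)
  qed
qed

theorem theorem3p2:
  fixes \<Xi>1 :: "'a system" and \<Xi>2 :: "'b system"
    and d12 :: "'a \<Rightarrow> 'b \<Rightarrow> real"
    and A :: "nat \<Rightarrow> nat \<Rightarrow> complex" and l :: "nat \<Rightarrow> nat \<Rightarrow> real"
    and h :: "real \<Rightarrow> real"
    and Q q1 q2 \<beta> \<kappa> :: real and p :: ennreal
  assumes "admissible \<Xi>1" and "admissible \<Xi>2"
    and "joint_distance \<Xi>1 \<Xi>2 d12"
    and "joint_gaussian_bound \<Xi>1 \<Xi>2 d12 A l Q"
    and "low_pass_filter h" and "sufficiently_smooth q1 q2 Q h"
    and "joint_regular \<Xi>1 \<Xi>2 d12 q1 q2"
    and "1 \<le> p"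
    and "\<kappa> = Q - q2 - (q1 - q2) * enn2real (1 / p)"
    and "\<beta> > \<kappa>"
    and "\<exists>c>0. \<forall>n::real. n \<ge> 1 \<longrightarrow> (\<forall>P\<in>Pi_space \<Xi>2 n. \<forall>m::nat. m \<ge> 1 \<longrightarrow>
           Lp_norm (meas \<Xi>1) p
             (\<lambda>x. sigma_op \<Xi>1 \<Xi>2 A l h (2 ^ (m + 1)) P x - sigma_op \<Xi>1 \<Xi>2 A l h (2 ^ m) P x)
           \<le> c * 2 powr (- real m * \<beta>) * n powr \<kappa> * Lp_norm (meas \<Xi>2) p P)"
  shows
    "(\<exists>C>0. \<forall>f\<in>Lp_space (meas \<Xi>2) p.
        summable (\<lambda>m::nat. 2 powr (real m * \<kappa>) * approx_err \<Xi>2 p (2 ^ m) f) \<longrightarrow>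
        (\<exists>F. Lp_limit (meas \<Xi>1) p (\<lambda>n. sigma_op \<Xi>1 \<Xi>2 A l h (2 ^ n) f) F) \<and>
        (\<forall>F. Lp_limit (meas \<Xi>1) p (\<lambda>n. sigma_op \<Xi>1 \<Xi>2 A l h (2 ^ n) f) F \<longrightarrow>
          (\<forall>n::nat. Lp_norm (meas \<Xi>1) p (\<lambda>x. F x - sigma_op \<Xi>1 \<Xi>2 A l h (2 ^ n) f x)
             \<le> C * ((\<Sum>m. 2 powr (real (m + n) * \<kappa>) * approx_err \<Xi>2 p (2 ^ (m + n)) f)
                     + 2 powr (real n * (\<kappa> - \<beta>)) * Lp_norm (meas \<Xi>2) p f))))
     \<and>
     (\<forall>\<alpha>>0. (\<forall>j k. \<alpha> * l j k \<ge> lam \<Xi>1 j) \<longrightarrow>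
        (\<forall>f\<in>Lp_space (meas \<Xi>2) p. \<forall>n>0.
           sigma_op \<Xi>1 \<Xi>2 A l h n f \<in> Pi_space \<Xi>1 (\<alpha> * n)) \<and>
        (\<forall>\<gamma> \<rho>. \<gamma> > 0 \<and> \<kappa> < \<gamma> \<and> \<gamma> < \<beta> \<and> 0 < \<rho> \<longrightarrow>
           (\<forall>f\<in>besov \<Xi>2 p \<rho> \<gamma>.
              (\<exists>F. Lp_limit (meas \<Xi>1) p (\<lambda>n. sigma_op \<Xi>1 \<Xi>2 A l h (2 ^ n) f) F) \<and>
              (\<forall>F. Lp_limit (meas \<Xi>1) p (\<lambda>n. sigma_op \<Xi>1 \<Xi>2 A l h (2 ^ n) f) F \<longrightarrow>
                 F \<in> besov \<Xi>1 p \<rho> (\<gamma> - \<kappa>)))))"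
proof -
  note adm = assms(1,2) and p = assms(8)
  let ?\<sigma> = "\<lambda>n. sigma_op \<Xi>1 \<Xi>2 A l h (2 ^ n)"
  let ?E = "\<lambda>f m. 2 powr (real m * \<kappa>) * approx_err \<Xi>2 p (2 ^ m) f"
  let ?N1 = "Lp_norm (meas \<Xi>1) p" and ?N2 = "Lp_norm (meas \<Xi>2) p"
  obtain C where C: "C > 0" "\<And>f m. f \<in> Lp_space (meas \<Xi>2) p \<Longrightarrow> ?\<sigma> m f \<in> Lp_space (meas \<Xi>1) p"
    "\<And>f m. f \<in> Lp_space (meas \<Xi>2) p \<Longrightarrow> ?N1 (\<lambda>x. ?\<sigma> (Suc m) f x - ?\<sigma> m f x) \<le> C * (?E f m + 2 powr (real m * (\<kappa> - \<beta>)) * ?N2 f)"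
    using sigma_op_increment_bound[OF assms(1-9,11)] by blast
  define \<theta> where "\<theta> = 2 powr (\<kappa> - \<beta>)"
  have \<theta>: "0 < \<theta>" "\<theta> < 1" using assms(10) powr_less_mono[of "\<kappa> - \<beta>" 0 2] by (auto simp: \<theta>_def)
  have \<theta>p: "2 powr (real m * (\<kappa> - \<beta>)) = \<theta> ^ m" for m
    by (simp add: \<theta>_def powr_realpow[symmetric] powr_powr mult.commute)
  \<comment> \<open>The factor \<open>1 / (1 - \<theta>)\<close> sums the geometric tail of the norm
    terms; being at least 1, it also serves for the approximation errors.\<close>
  define D where "D = C / (1 - \<theta>)"
  have D: "D > 0" using C \<theta> by (simp add: D_def)
  have limit: "(\<exists>F. Lp_limit (meas \<Xi>1) p (\<lambda>n. ?\<sigma> n f) F) \<and>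
      (\<forall>F. Lp_limit (meas \<Xi>1) p (\<lambda>n. ?\<sigma> n f) F \<longrightarrow> (\<forall>n. ?N1 (\<lambda>x. F x - ?\<sigma> n f x)
         \<le> D * ((\<Sum>m. ?E f (m + n)) + 2 powr (real n * (\<kappa> - \<beta>)) * ?N2 f)))"
    if f: "f \<in> Lp_space (meas \<Xi>2) p" and sE: "summable (?E f)" for f
  proof -
    define b where "b m = C * (?E f m + \<theta> ^ m * ?N2 f)" for m
    have sb: "summable b"
      unfolding b_def using \<theta> by (intro summable_mult summable_add sE summable_mult2 summable_geometric) simp
    have inc: "?N1 (\<lambda>x. ?\<sigma> (Suc m) f x - ?\<sigma> m f x) \<le> b m" for m
      using C(3)[OF f, of m] by (simp only: b_def \<theta>p)
    have tail: "(\<Sum>m. b (m + n)) \<le> D * ((\<Sum>m. ?E f (m + n)) + 2 powr (real n * (\<kappa> - \<beta>)) * ?N2 f)" for n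
    proof -
      have s1: "summable (\<lambda>m. ?E f (m + n))" using summable_iff_shift[of "?E f" n] sE by blast
      have s2: "summable (\<lambda>m. \<theta> ^ m * (\<theta> ^ n * ?N2 f))" using \<theta> by (intro summable_mult2 summable_geometric) simp
      have "(\<Sum>m. b (m + n)) = (\<Sum>m. C * (?E f (m + n) + \<theta> ^ m * (\<theta> ^ n * ?N2 f)))"
        by (simp only: b_def power_add mult.assoc)
      also have "\<dots> = C * ((\<Sum>m. ?E f (m + n)) + (\<Sum>m. \<theta> ^ m * (\<theta> ^ n * ?N2 f)))"
        by (simp only: suminf_mult[OF summable_add[OF s1 s2]] suminf_add[OF s1 s2])
      also have "(\<Sum>m. \<theta> ^ m * (\<theta> ^ n * ?N2 f)) = 1 / (1 - \<theta>) * (\<theta> ^ n * ?N2 f)"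
        using \<theta> by (subst suminf_mult2[symmetric]) (auto intro: summable_geometric simp: suminf_geometric)
      also have "C * ((\<Sum>m. ?E f (m + n)) + 1 / (1 - \<theta>) * (\<theta> ^ n * ?N2 f)) \<le> C * (1 / (1 - \<theta>) * (\<Sum>m. ?E f (m + n)) + 1 / (1 - \<theta>) * (\<theta> ^ n * ?N2 f))"
      proof (intro mult_left_mono add_right_mono)
        have "0 \<le> (\<Sum>m. ?E f (m + n))" by (intro suminf_nonneg s1) (simp add: approx_err_nonneg)
        moreover have "1 \<le> 1 / (1 - \<theta>)" using \<theta> by simp
        ultimately have "1 * (\<Sum>m. ?E f (m + n)) \<le> 1 / (1 - \<theta>) * (\<Sum>m. ?E f (m + n))" by (intro mult_right_mono)
        then show "(\<Sum>m. ?E f (m + n)) \<le> 1 / (1 - \<theta>) * (\<Sum>m. ?E f (m + n))" by simp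
      qed (use C in simp)
      also have "\<dots> = D * ((\<Sum>m. ?E f (m + n)) + \<theta> ^ n * ?N2 f)"
        by (simp add: D_def distrib_left)
      finally show ?thesis by (simp only: \<theta>p)
    qed
    show ?thesis
      using Lp_limit_exists_and_bound[where s="\<lambda>n. ?\<sigma> n f", OF p C(2)[OF f] inc sb] tail
      by (blast intro: order.trans)
  qed
  have membership: "sigma_op \<Xi>1 \<Xi>2 A l h n f \<in> Pi_space \<Xi>1 (\<alpha> * n)"
    if "\<alpha> > 0" "\<forall>j k. \<alpha> * l j k \<ge> lam \<Xi>1 j" "n > 0" for \<alpha> n f
    using assms(4) that by (intro sigma_op_in_Pi_space adm assms(5)) (auto simp: joint_gaussian_bound_def Let_def)
  have besov: "(\<exists>F. Lp_limit (meas \<Xi>1) p (\<lambda>n. ?\<sigma> n f) F) \<and>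
      (\<forall>F. Lp_limit (meas \<Xi>1) p (\<lambda>n. ?\<sigma> n f) F \<longrightarrow> F \<in> besov \<Xi>1 p \<rho> (\<gamma> - \<kappa>))"
    if \<alpha>: "\<alpha> > 0" "\<forall>j k. \<alpha> * l j k \<ge> lam \<Xi>1 j" and \<gamma>: "\<kappa> < \<gamma>" "\<gamma> < \<beta>" and \<rho>: "0 < \<rho>"
      and fB: "f \<in> besov \<Xi>2 p \<rho> \<gamma>" for \<alpha> \<gamma> \<rho> f
  proof -
    have f: "f \<in> Lp_space (meas \<Xi>2) p" using fB by (simp add: besov_def X_space_def)
    obtain W where W: "W \<ge> 0" "\<And>j. 2 powr (\<gamma> * real j) * approx_err \<Xi>2 p (2 ^ j) f \<le> W"
      using besov_bounded[OF fB \<rho>] by blast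
    \<comment> \<open>The series condition of the first part holds automatically: the Besov sequence
      is bounded and \<open>\<kappa> < \<gamma>\<close> leaves a geometric factor.\<close>
    have sE: "summable (?E f)"
    proof (rule summable_comparison_test'[where N=0])
      have "2 powr (\<kappa> - \<gamma>) < 1" using \<gamma> powr_less_mono[of "\<kappa> - \<gamma>" 0 2] by simp
      then show "summable (\<lambda>m. (2 powr (\<kappa> - \<gamma>)) ^ m * W)" by (intro summable_mult2 summable_geometric) simp
      fix m :: nat
      have "?E f m = (2 powr (\<kappa> - \<gamma>)) ^ m * (2 powr (\<gamma> * real m) * approx_err \<Xi>2 p (2 ^ m) f)"
        by (simp add: powr_realpow[symmetric] powr_powr mult.assoc[symmetric] powr_add[symmetric] algebra_simps)
      also have "\<dots> \<le> (2 powr (\<kappa> - \<gamma>)) ^ m * W" by (intro mult_left_mono W) simp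
      finally show "norm (?E f m) \<le> (2 powr (\<kappa> - \<gamma>)) ^ m * W" by (simp add: approx_err_nonneg)
    qed
    \<comment> \<open>The degrees \<open>\<alpha> * 2 ^ n\<close> are not dyadic; enlarging \<alpha>
      to \<open>2 ^ a\<close> makes them so at the price of an index shift.\<close>
    obtain a :: nat where a: "\<alpha> \<le> 2 ^ a" using real_arch_pow[of 2 \<alpha>] by (auto intro: less_imp_le)
    have "F \<in> besov \<Xi>1 p \<rho> (\<gamma> - \<kappa>)" if F: "Lp_limit (meas \<Xi>1) p (\<lambda>n. ?\<sigma> n f) F" for F
    proof (rule besov_of_dyadic_bound[OF adm(1) fB \<rho> \<gamma> _ D Lp_norm_nonneg, where a=a])
      show "F \<in> Lp_space (meas \<Xi>1) p" using F by (simp add: Lp_limit_def)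
      fix n
      have "\<alpha> * 2 ^ n \<le> 2 ^ (n + a)" using a by (simp add: power_add mult.commute)
      then have "?\<sigma> n f \<in> Pi_space \<Xi>1 (2 ^ (n + a))"
        using membership[OF \<alpha>, of "2 ^ n" f] Pi_space_mono[OF adm(1)] by auto
      then have "approx_err \<Xi>1 p (2 ^ (n + a)) F \<le> ?N1 (\<lambda>x. F x - ?\<sigma> n f x)" by (rule approx_err_le)
      also have "\<dots> \<le> D * ((\<Sum>m. ?E f (m + n)) + 2 powr (real n * (\<kappa> - \<beta>)) * ?N2 f)"
        using limit[OF f sE] F by blast
      finally show "approx_err \<Xi>1 p (2 ^ (n + a)) F \<le> D * ((\<Sum>m. ?E f (m + n)) + 2 powr (real n * (\<kappa> - \<beta>)) * ?N2 f)" .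
    qed
    then show ?thesis using limit[OF f sE] by blast
  qed
  show ?thesis
  proof (rule conjI)
    show "\<exists>C>0. \<forall>f\<in>Lp_space (meas \<Xi>2) p. summable (?E f) \<longrightarrow>
        (\<exists>F. Lp_limit (meas \<Xi>1) p (\<lambda>n. ?\<sigma> n f) F) \<and>
        (\<forall>F. Lp_limit (meas \<Xi>1) p (\<lambda>n. ?\<sigma> n f) F \<longrightarrow> (\<forall>n. ?N1 (\<lambda>x. F x - ?\<sigma> n f x)
           \<le> C * ((\<Sum>m. ?E f (m + n)) + 2 powr (real n * (\<kappa> - \<beta>)) * ?N2 f)))"
      by (intro exI[of _ D] conjI[OF D] ballI impI limit)
    show "\<forall>\<alpha>>0. (\<forall>j k. \<alpha> * l j k \<ge> lam \<Xi>1 j) \<longrightarrow>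
        (\<forall>f\<in>Lp_space (meas \<Xi>2) p. \<forall>n>0. sigma_op \<Xi>1 \<Xi>2 A l h n f \<in> Pi_space \<Xi>1 (\<alpha> * n)) \<and>
        (\<forall>\<gamma> \<rho>. \<gamma> > 0 \<and> \<kappa> < \<gamma> \<and> \<gamma> < \<beta> \<and> 0 < \<rho> \<longrightarrow>
           (\<forall>f\<in>besov \<Xi>2 p \<rho> \<gamma>. (\<exists>F. Lp_limit (meas \<Xi>1) p (\<lambda>n. ?\<sigma> n f) F) \<and>
              (\<forall>F. Lp_limit (meas \<Xi>1) p (\<lambda>n. ?\<sigma> n f) F \<longrightarrow> F \<in> besov \<Xi>1 p \<rho> (\<gamma> - \<kappa>))))"
    proof (intro allI impI, rule conjI)
      fix \<alpha> assume \<alpha>: "\<alpha> > 0" "\<forall>j k. \<alpha> * l j k \<ge> lam \<Xi>1 j"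
      show "\<forall>f\<in>Lp_space (meas \<Xi>2) p. \<forall>n>0. sigma_op \<Xi>1 \<Xi>2 A l h n f \<in> Pi_space \<Xi>1 (\<alpha> * n)"
        by (intro ballI allI impI membership \<alpha>)
      show "\<forall>\<gamma> \<rho>. \<gamma> > 0 \<and> \<kappa> < \<gamma> \<and> \<gamma> < \<beta> \<and> 0 < \<rho> \<longrightarrow>
           (\<forall>f\<in>besov \<Xi>2 p \<rho> \<gamma>. (\<exists>F. Lp_limit (meas \<Xi>1) p (\<lambda>n. ?\<sigma> n f) F) \<and>
              (\<forall>F. Lp_limit (meas \<Xi>1) p (\<lambda>n. ?\<sigma> n f) F \<longrightarrow> F \<in> besov \<Xi>1 p \<rho> (\<gamma> - \<kappa>)))"
        by (intro allI impI ballI, elim conjE, rule besov[OF \<alpha>])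
    qed
  qed
qed

end
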